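(* Let $G$ be a finite abelian group, let $\mathcal{P}$ be the set of prime divisors of $|G|$, and let $\varepsilon>0$. Let $\mathbf{C}^{(h)}=\mathbf{A}^{(h)}+\mathbf{B}^{(h)}$, $h=1,2,\dots$, be any sequence of random integral block matrices satisfying assumptions (A.1)--(A.7) listed in the context (with this $\mathcal{P}$ and $\varepsilon$), where $\mathbf{C}^{(h)}$ has $k(h)\times k(h)$ blocks. Then $$\lim_{h\to\infty}\frac{\mathbb{E}\,|\operatorname{Hom}(\operatorname{cok}(\mathbf{C}^{(h)}),G)|}{k(h)^{\ell(G)}}=\frac{c(G,\ell(G))}{\ell(G)!}.$$
   Context: Cokernel: for an $n\times n$ integral matrix $\mathbf{M}$, $\operatorname{cok}(\mathbf{M})=\mathbb{Z}^n/\operatorname{RowSpace}(\mathbf{M})$, where $\operatorname{RowSpace}(\mathbf{M})$ is the subgroup of $\mathbb{Z}^n$ generated by the rows of $\mathbf{M}$. Balanced: for a set $\mathcal{P}$ of primes and $\varepsilon>0$, a $\mathbb{Z}$-valued random variable $X$ is $(\mathcal{P},\varepsilon)$-balanced if $\mathbb{P}(X\equiv r \bmod p)\le 1-\varepsilon$ for all $p\in\mathcal{P}$ and $r\in\mathbb{Z}$. A random matrix over $\mathbb{Z}$ is $(\mathcal{P},\varepsilon)$-balanced if its entries are independent and $(\mathcal{P},\varepsilon)$-balanced. Setting: for each $h$, let $k(h)$ and $n_1(h),\dots,n_{k(h)}(h)$ be positive integers, and let $\mathbf{A}^{(h)}=(\mathbf{A}^{(h)}_{i,j})_{1\le i,j\le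 k(h)}$ and $\mathbf{B}^{(h)}=(\mathbf{B}^{(h)}_{i,j})_{1\le i,j\le k(h)}$ be random block matrices over $\mathbb{Z}$, where the blocks $\mathbf{A}^{(h)}_{i,j}$ and $\mathbf{B}^{(h)}_{i,j}$ are $n_i(h)\times n_j(h)$ matrices. Put $\mathbf{C}^{(h)}=\mathbf{A}^{(h)}+\mathbf{B}^{(h)}$ and $n_\bullet(h)=\min_{1\le i\le k(h)} n_i(h)$. The assumptions are: (A.1) $\mathbf{A}^{(h)}$ and $\mathbf{B}^{(h)}$ are independent; (A.2) if $j\notin\{i-1,i\}$, then $\mathbf{A}^{(h)}_{i,j}=0$; (A.3) the blocks $\mathbf{A}^{(h)}_{i,j}$ ($i\in\{1,\dots,k(h)\}$, $j\in\{i-1,i\}$, $j\ge 1$) are independent $(\mathcal{P},\varepsilon)$-balanced random matrices; (A.4) if $j\ge i-1$, then $\mathbf{B}^{(h)}_{i,j}=0$; (A.5) $\lim_{h\to\infty}k(h)=\infty$; (A.6) $\lim_{h\to\infty}n_\bullet(h)=\infty$; (A.7) $\lim_{h\to\infty}\frac{\log k(h)}{n_\bullet(h)}=0$. Chains: for a finite abelian group $G$ and an integer $i\ge 0$, $c(G,i)$ is the number of chains of subgroups $\{0\}\subsetneq H_1\subsetneq H_2\subsetneq\cdots\subsetneq H_i\subseteq G$ of length $i$. If $|G|=\prod p_i^{e_i}$ is the prime factorization, then $\ell(G)=\sum e_i$, which is the largest possible length of such a chain. *)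

theory Defs
  imports
    "HOL-Probability.Probability"
    "HOL-Algebra.Coset"
    "HOL-Algebra.Generated_Groups"
    "HOL-Number_Theory.Cong"
    "Jordan_Normal_Form.Matrix"
begin

section \<open>Cokernels and homomorphisms\<close>

definition row_space_int :: "int mat \<Rightarrow> int vec set" where
  "row_space_int M = generate (add_monoid (module_vec TYPE(int) (dim_col M))) (set (rows M))"

definition cok :: "int mat \<Rightarrow> int vec set monoid" where
  "cok M = add_monoid (module_vec TYPE(int) (dim_col M)) Mod row_space_int M"

text \<open>The library's \<^const>\<open>hom\<close> leaves the values outside the carrier of the source
  arbitrary; extensionality makes each homomorphism be counted exactly once.\<close>

definition Hom :: "('a, 'c) monoid_scheme \<Rightarrow> ('b, 'd) monoid_scheme \<Rightarrow> ('a \<Rightarrow> 'b) set" where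
  "Hom H G = hom H G \<inter> extensional (carrier H)"


section \<open>Chains of subgroups\<close>

text \<open>A chain is the list \<open>[H\<^sub>1, \<dots>, H\<^sub>i]\<close>, without the trivial subgroup it starts from.\<close>

definition subgroup_chains :: "('a, 'c) monoid_scheme \<Rightarrow> nat \<Rightarrow> 'a set list set" where
  "subgroup_chains G i =
     {Hs. length Hs = i \<and> (\<forall>H\<in>set Hs. subgroup H G) \<and> sorted_wrt (\<subset>) ({\<one>\<^bsub>G\<^esub>} # Hs)}"

definition num_chains :: "('a, 'c) monoid_scheme \<Rightarrow> nat \<Rightarrow> nat" where
  "num_chains G i = card (subgroup_chains G i)"

definition chain_length :: "('a, 'c) monoid_scheme \<Rightarrow> nat" where
  "chain_length G = (\<Sum>p\<in>prime_factors (order G). multiplicity p (order G))"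


section \<open>Balanced random variables and matrices\<close>

definition balanced :: "'w measure \<Rightarrow> nat set \<Rightarrow> real \<Rightarrow> ('w \<Rightarrow> int) \<Rightarrow> bool" where
  "balanced M P \<epsilon> X \<longleftrightarrow>
     X \<in> measurable M (count_space UNIV) \<and>
     (\<forall>p\<in>P. \<forall>r. measure M {\<omega> \<in> space M. [X \<omega> = r] (mod int p)} \<le> 1 - \<epsilon>)"

definition balanced_matrix ::
    "'w measure \<Rightarrow> nat set \<Rightarrow> real \<Rightarrow> nat \<Rightarrow> nat \<Rightarrow> ('w \<Rightarrow> int mat) \<Rightarrow> bool" where
  "balanced_matrix M P \<epsilon> nr nc X \<longleftrightarrow>
     prob_space.indep_vars M (\<lambda>_. count_space UNIV) (\<lambda>(a, b) \<omega>. X \<omega> $$ (a, b)) ({..<nr} \<times> {..<nc}) \<and>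
     (\<forall>a<nr. \<forall>b<nc. balanced M P \<epsilon> (\<lambda>\<omega>. X \<omega> $$ (a, b)))"


section \<open>Block matrices\<close>

text \<open>A block matrix with block sizes \<open>n 1, \<dots>, n k\<close> is a square matrix of dimension
  \<open>total_size n k\<close>. Blocks are numbered from 1, whereas rows and columns of matrices are
  numbered from 0.\<close>

definition total_size :: "(nat \<Rightarrow> nat) \<Rightarrow> nat \<Rightarrow> nat" where
  "total_size n k = (\<Sum>i=1..k. n i)"

definition block_offset :: "(nat \<Rightarrow> nat) \<Rightarrow> nat \<Rightarrow> nat" where
  "block_offset n i = (\<Sum>l=1..<i. n l)"

definition block :: "(nat \<Rightarrow> nat) \<Rightarrow> nat \<Rightarrow> nat \<Rightarrow> 'a mat \<Rightarrow> 'a mat" where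
  "block n i j M = mat (n i) (n j) (\<lambda>(a, b). M $$ (block_offset n i + a, block_offset n j + b))"

text \<open>The positions of the blocks on the diagonal and directly below it. Subtraction is on
  natural numbers, but it never truncates here since \<open>i \<ge> 1\<close>.\<close>

definition bidiagonal_positions :: "nat \<Rightarrow> (nat \<times> nat) set" where
  "bidiagonal_positions k = {(i, j). i \<in> {1..k} \<and> j \<in> {i - 1, i} \<and> j \<ge> 1}"

definition min_block_size :: "(nat \<Rightarrow> nat) \<Rightarrow> nat \<Rightarrow> nat" where
  "min_block_size n k = Min (n ` {1..k})"

end

theory Submission
  imports Defs
begin

text \<open>Evaluating homomorphisms at the unit vectors identifies \<open>Hom (cok C) G\<close> with the solutions
  \<open>x\<close> of \<open>C x = 0\<close> over \<open>G\<close>, so the moment is the sum of the probabilities that \<open>C x = 0\<close>. Split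
  \<open>x\<close> into blocks \<open>x\<^sub>1, \<dots>, x\<^sub>k\<close> and let \<open>H\<^sub>i\<close> be the subgroup generated by the entries of \<open>x\<^sub>i\<close>.
  For all but an exponentially small proportion of the \<open>x\<^sub>i\<close> generating \<open>H\<^sub>i\<close>, if \<open>H\<^sub>i\<^sub>-\<^sub>1 \<subseteq> H\<^sub>i\<close> then
  each row of \<open>A\<close> in block \<open>i\<close> maps \<open>x\<close> to an element of \<open>H\<^sub>i\<close> that is uniform up to an error
  exponentially small in \<open>n\<^sub>i\<close>; the factor \<open>|H\<^sub>i|\<close> to the power \<open>-n\<^sub>i\<close> of block row \<open>i\<close> thus cancels
  the number of choices of \<open>x\<^sub>i\<close>. All other \<open>x\<^sub>i\<close> have an exponentially small total weight, whatever
  \<open>B\<close> contributes. Hence the moment is asymptotic to the number of weakly increasing chains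
  \<open>H\<^sub>1 \<subseteq> \<dots> \<subseteq> H\<^sub>k\<close>, which is the sum of \<open>c(G, i) (k choose i)\<close> over \<open>i\<close>; the errors are bounded by a
  power of \<open>k\<close> times \<open>r\<close> to the power \<open>n\<^sub>\<bullet>\<close> with \<open>r < 1\<close>.\<close>

subsection \<open>Equidistribution of random integral combinations\<close>

text \<open>Balancedness is used without characters. It says that the power of x_j given by one
  entry puts mass at most 1 - \<epsilon> on any coset of a subgroup that misses x_j. The values of
  not too small probability therefore multiply up, entry by entry, to a whole subgroup, and a law
  bounded below there contracts every other one towards uniformity. The obstacle is that an element
  needed to generate H_i may occur only a few times in x_i, which leaves the rows far from uniform.
  What is equidistributed is the subgroup generated by the values filling a fixed proportion of x_i.
  If it misses an entry of x_i or part of H_{i-1}, every row still loses a factor 1 - \<epsilon>;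
  the proportion is chosen so small that the surplus (1 + \<eta>)^n in the number of such vectors
  does not undo this gain. Given its value, B only shifts the targets of the rows of A. The upper
  bound holds for every target. The lower bound needs targets in H_i, and has them along increasing
  chains because B meets only earlier blocks. The error of each block is additive; a potential that
  is at least 1 makes it relative.\<close>

context comm_group
begin

lemma finprod_in_subgroup:
  assumes "subgroup R G" "finite S" "\<And>s. s \<in> S \<Longrightarrow> f s \<in> R"
  shows "finprod G f S \<in> R"
  using assms(2,3)
proof (induction S rule: finite_induct)
  case empty
  then show ?case using subgroup.one_closed[OF assms(1)] by simp
next
  case (insert s S)
  have "f \<in> S \<rightarrow> carrier G" "f s \<in> carrier G"
    using insert.prems subgroup.subset[OF assms(1)] by auto
  then show ?case using insert subgroup.m_closed[OF assms(1)] by simp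
qed

definition translation_stabilizer :: "'a set \<Rightarrow> 'a set" where
  "translation_stabilizer T = {h \<in> carrier G. \<forall>t\<in>T. t \<otimes> h \<in> T}"

text \<open>Only the inclusion of the translate in \<open>T\<close> is required of a stabilizing
  element. On a finite \<open>T\<close> translation is an injective self-map, hence onto, and this
  yields the inverses.\<close>

lemma subgroup_translation_stabilizer:
  assumes "T \<subseteq> carrier G" "finite T"
  shows "subgroup (translation_stabilizer T) G"
proof (rule subgroupI)
  show "translation_stabilizer T \<noteq> {}"
    using assms by (auto simp: translation_stabilizer_def intro!: exI[of _ \<one>])
  fix h assume h: "h \<in> translation_stabilizer T"
  then have hc: "h \<in> carrier G" and img: "(\<lambda>t. t \<otimes> h) ` T \<subseteq> T"
    by (auto simp: translation_stabilizer_def)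
  have "inj_on (\<lambda>t. t \<otimes> h) T"
    using assms hc by (intro inj_onI) (meson right_cancel subsetD)
  then have surj: "(\<lambda>t. t \<otimes> h) ` T = T"
    using img assms(2) endo_inj_surj by blast
  have "t \<otimes> inv h \<in> T" if "t \<in> T" for t
  proof -
    have "t \<in> (\<lambda>t. t \<otimes> h) ` T" unfolding surj by (rule that)
    then obtain t' where t': "t = t' \<otimes> h" "t' \<in> T" by (rule imageE)
    then have "t' \<in> carrier G" using assms(1) by blast
    then show ?thesis using hc t' by (simp add: m_assoc)
  qed
  then show "inv h \<in> translation_stabilizer T"
    using hc by (auto simp: translation_stabilizer_def)
next
  fix a b assume "a \<in> translation_stabilizer T" "b \<in> translation_stabilizer T"
  then show "a \<otimes> b \<in> translation_stabilizer T"
    using assms by (auto simp: translation_stabilizer_def simp flip: m_assoc)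
qed (auto simp: translation_stabilizer_def)

text \<open>Here \<open>m\<close> is the order of the image of \<open>g\<close> in G/U: it divides
  \<open>order G\<close>, and it exceeds 1 because \<open>g\<close> is outside \<open>U\<close>, so
  any prime divisor of \<open>m\<close> will do. The lemma translates membership of a power in a
  coset of \<open>U\<close> into the residue classes that balancedness controls.\<close>

lemma pow_coset_congruence:
  assumes fin: "finite (carrier G)" and U: "subgroup U G" and g: "g \<in> carrier G" "g \<notin> U"
  obtains p where "p \<in> prime_factors (order G)"
    "\<And>a b :: int. g [^] a \<otimes> inv (g [^] b) \<in> U \<Longrightarrow> [a = b] (mod int p)"
proof -
  define m where "m = (LEAST m. 0 < m \<and> g [^] (m::nat) \<in> U)"
  have ordpos: "order G > 0" using fin order_gt_0_iff_finite by blast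
  have ex: "0 < order G \<and> g [^] order G \<in> U"
    using ordpos power_order_eq_one[OF fin g(1)] subgroup.one_closed[OF U] by (simp add: order_def)
  have m: "0 < m" "g [^] m \<in> U"
    using LeastI[of "\<lambda>m. 0 < m \<and> g [^] (m::nat) \<in> U", OF ex] by (auto simp: m_def)
  have least: "m \<le> j" if "0 < j" "g [^] (j::nat) \<in> U" for j
    using that unfolding m_def by (intro Least_le) auto
  have gm: "g [^] (int m * z) \<in> U" for z :: int
    using m(2) U g(1) by (metis int_pow_int int_pow_pow subgroup_int_pow_closed)
  have dvd: "int m dvd z" if z: "g [^] z \<in> U" for z :: int
  proof -
    have "g [^] (z mod int m) = g [^] z \<otimes> inv (g [^] (int m * (z div int m)))"
      using g(1) by (simp add: int_pow_diff[symmetric] minus_mult_div_eq_mod)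
    then have "g [^] (z mod int m) \<in> U"
      using z gm U by (simp add: subgroup.m_closed subgroup.m_inv_closed)
    moreover have "z mod int m = int (nat (z mod int m))" using m(1) by simp
    ultimately have "g [^] nat (z mod int m) \<in> U" by (metis int_pow_int)
    moreover have "nat (z mod int m) < m" using m(1) by (simp add: nat_less_iff)
    ultimately have "nat (z mod int m) = 0" using least[of "nat (z mod int m)"] by fastforce
    then have "z mod int m = 0" using \<open>z mod int m = int (nat (z mod int m))\<close> by simp
    then show ?thesis by (rule mod_0_imp_dvd)
  qed
  have "m \<noteq> 1" using m(2) g by auto
  then obtain p where p: "prime p" "p dvd m" using prime_factor_nat by blast
  have "int m dvd int (order G)"
    by (rule dvd) (use ex in \<open>simp add: int_pow_int\<close>)
  then have "p \<in> prime_factors (order G)"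
    using p ordpos by (auto simp: prime_factors_dvd intro: dvd_trans)
  moreover have "[a = b] (mod int p)" if "g [^] a \<otimes> inv (g [^] b) \<in> U" for a b :: int
  proof -
    have "int m dvd a - b" by (rule dvd) (use that g(1) in \<open>simp add: int_pow_diff\<close>)
    then have "int p dvd a - b" using p(2) by (meson dvd_trans int_dvd_int_iff)
    then show ?thesis by (simp add: cong_iff_dvd_diff)
  qed
  ultimately show ?thesis using that by blast
qed

end

section \<open>The law of a random product of powers\<close>

locale balanced_combination = prob_space M + comm_group G
  for M :: "'w measure" and G (structure) +
  fixes X :: "'j \<Rightarrow> 'w \<Rightarrow> int" and x :: "'j \<Rightarrow> 'a" and J :: "'j set" and \<epsilon> :: real
  assumes finite_carrier: "finite (carrier G)"
    and finite_index: "finite J"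
    and coeff_carrier: "j \<in> J \<Longrightarrow> x j \<in> carrier G"
    and indep: "indep_vars (\<lambda>_. count_space UNIV) X J"
    and bal: "j \<in> J \<Longrightarrow> balanced M (prime_factors (order G)) \<epsilon> (X j)"
    and eps_pos: "0 < \<epsilon>" and eps_le_1: "\<epsilon> \<le> 1"
begin

definition comb :: "'j set \<Rightarrow> 'w \<Rightarrow> 'a" where
  "comb K \<omega> = finprod G (\<lambda>j. x j [^] X j \<omega>) K"

definition law :: "'j set \<Rightarrow> 'a \<Rightarrow> real" where
  "law K v = prob {\<omega> \<in> space M. comb K \<omega> = v}"

lemma comb_closed: "K \<subseteq> J \<Longrightarrow> comb K \<omega> \<in> carrier G"
  unfolding comb_def by (intro finprod_closed) (auto intro!: int_pow_closed coeff_carrier)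

lemma X_measurable: "j \<in> J \<Longrightarrow> X j \<in> measurable M (count_space UNIV)"
  using bal by (auto simp: balanced_def)

text \<open>Over a finite index set the product of countable discrete spaces is discrete again, so
  every predicate of a finite subfamily defines an event.\<close>

lemma PiM_int: "K \<subseteq> J \<Longrightarrow> PiM K (\<lambda>_. count_space (UNIV::int set)) = count_space (PiE K (\<lambda>_. UNIV))"
  using finite_index by (intro count_space_PiM_finite) (auto intro: finite_subset)

lemma measurable_X_fun:
  assumes "K \<subseteq> J"
  shows "(\<lambda>\<omega>. restrict (\<lambda>j. X j \<omega>) K) \<in> measurable M (count_space (PiE K (\<lambda>_. UNIV)))"
  unfolding PiM_int[OF assms, symmetric]
  by (intro measurable_restrict X_measurable) (use assms in auto)

lemma comb_restrict:
  "K \<subseteq> J \<Longrightarrow> comb K \<omega> = finprod G (\<lambda>j. x j [^] (restrict (\<lambda>j. X j \<omega>) K j)) K"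
  unfolding comb_def
  by (intro finprod_cong') (auto intro!: int_pow_closed coeff_carrier)

lemma comb_event:
  assumes "K \<subseteq> J"
  shows "{\<omega> \<in> space M. Q (comb K \<omega>)} \<in> events"
proof -
  have "{\<omega> \<in> space M. Q (comb K \<omega>)} = 
     (\<lambda>\<omega>. restrict (\<lambda>j. X j \<omega>) K) -` {a \<in> PiE K (\<lambda>_. UNIV). Q (finprod G (\<lambda>j. x j [^] a j) K)} \<inter> space M"
    using assms by (auto simp: comb_restrict)
  also have "\<dots> \<in> events"
    by (rule measurable_sets[OF measurable_X_fun[OF assms]]) auto
  finally show ?thesis .
qed

lemma prob_comb_pair:
  assumes K: "K \<subseteq> J" "K' \<subseteq> J" "K \<inter> K' = {}"
  shows "prob {\<omega> \<in> space M. comb K \<omega> = u \<and> comb K' \<omega> = v} = law K u * law K' v"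
proof -
  let ?S = "\<lambda>K u. {a \<in> PiE K (\<lambda>_. UNIV). finprod G (\<lambda>j. x j [^] (a j::int)) K = u}"
  have "prob ((\<lambda>\<omega>. (restrict (\<lambda>j. X j \<omega>) K, restrict (\<lambda>j. X j \<omega>) K')) -` (?S K u \<times> ?S K' v) \<inter> space M)
    = prob ((\<lambda>\<omega>. restrict (\<lambda>j. X j \<omega>) K) -` ?S K u \<inter> space M)
      * prob ((\<lambda>\<omega>. restrict (\<lambda>j. X j \<omega>) K') -` ?S K' v \<inter> space M)"
    by (rule indep_varD[OF indep_var_restrict[OF indep K(3,1,2)]]) (auto simp: PiM_int K)
  moreover have "(\<lambda>\<omega>. (restrict (\<lambda>j. X j \<omega>) K, restrict (\<lambda>j. X j \<omega>) K')) -` (?S K u \<times> ?S K' v) \<inter> space M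
     = {\<omega> \<in> space M. comb K \<omega> = u \<and> comb K' \<omega> = v}"
    using K by (auto simp: comb_restrict)
  moreover have "(\<lambda>\<omega>. restrict (\<lambda>j. X j \<omega>) K) -` ?S K u \<inter> space M = {\<omega> \<in> space M. comb K \<omega> = u}" if "K \<subseteq> J" for K u
    using that by (auto simp: comb_restrict)
  ultimately show ?thesis using K by (simp add: law_def)
qed

lemma comb_Un:
  assumes "K \<subseteq> J" "K' \<subseteq> J" "K \<inter> K' = {}"
  shows "comb (K \<union> K') \<omega> = comb K \<omega> \<otimes> comb K' \<omega>"
  unfolding comb_def using assms finite_index
  by (intro finprod_Un_disjoint) (auto intro: finite_subset intro!: int_pow_closed coeff_carrier)

lemma law_Un:
  assumes K: "K \<subseteq> J" "K' \<subseteq> J" "K \<inter> K' = {}" and g: "g \<in> carrier G"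
  shows "law (K \<union> K') g = (\<Sum>v\<in>carrier G. law K v * law K' (inv v \<otimes> g))"
proof -
  have eq: "{\<omega> \<in> space M. comb (K \<union> K') \<omega> = g} =
    (\<Union>v\<in>carrier G. {\<omega> \<in> space M. comb K \<omega> = v \<and> comb K' \<omega> = inv v \<otimes> g})"
  proof -
    have "comb K \<omega> \<otimes> comb K' \<omega> = g \<longleftrightarrow> comb K' \<omega> = inv (comb K \<omega>) \<otimes> g" for \<omega>
      using inv_solve_left[of "comb K' \<omega>" "comb K \<omega>" g] comb_closed[OF K(1)] comb_closed[OF K(2)] g by auto
    then show ?thesis using comb_closed[OF K(1)] by (auto simp: comb_Un[OF K])
  qed
  have ev: "{\<omega> \<in> space M. comb K \<omega> = v \<and> comb K' \<omega> = u} \<in> events" for u v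
    using sets.Int[OF comb_event[OF K(1), of "\<lambda>a. a = v"] comb_event[OF K(2), of "\<lambda>a. a = u"]]
    by (rule back_subst[of "\<lambda>S. S \<in> events"]) auto
  show ?thesis
    unfolding law_def eq
    by (subst finite_measure_finite_Union)
       (use finite_carrier K in \<open>auto simp: ev disjoint_family_on_def prob_comb_pair[unfolded law_def]\<close>)
qed

lemma law_nonneg [simp]: "law K v \<ge> 0"
  by (simp add: law_def)

lemma prob_comb_in:
  assumes "K \<subseteq> J" "S \<subseteq> carrier G"
  shows "prob {\<omega> \<in> space M. comb K \<omega> \<in> S} = (\<Sum>v\<in>S. law K v)"
proof -
  have "{\<omega> \<in> space M. comb K \<omega> \<in> S} = (\<Union>v\<in>S. {\<omega> \<in> space M. comb K \<omega> = v})" by auto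
  then show ?thesis
    unfolding law_def using assms finite_carrier
    using comb_event[OF assms(1)]
    by (simp only:, subst finite_measure_finite_Union)
       (auto simp: disjoint_family_on_def intro: finite_subset)
qed

lemma law_sum: "K \<subseteq> J \<Longrightarrow> (\<Sum>v\<in>carrier G. law K v) = 1"
  using prob_comb_in[of K "carrier G"] comb_closed by (simp add: prob_space)

lemma law_le_1: "law K v \<le> 1"
  by (simp add: law_def)

lemma comb_in_subgroup:
  assumes R: "subgroup R G" and "K \<subseteq> J" "x ` K \<subseteq> R"
  shows "comb K \<omega> \<in> R"
  unfolding comb_def
proof (rule finprod_in_subgroup[OF R])
  show "finite K" using assms finite_index finite_subset by blast
  fix j assume "j \<in> K"
  then show "x j [^] X j \<omega> \<in> R" using assms by (intro subgroup_int_pow_closed) auto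
qed

lemma law_outside_subgroup:
  assumes "subgroup R G" "K \<subseteq> J" "x ` K \<subseteq> R" "v \<notin> R"
  shows "law K v = 0"
proof -
  have "{\<omega> \<in> space M. comb K \<omega> = v} = {}" using comb_in_subgroup[OF assms(1-3)] assms(4) by auto
  then show ?thesis unfolding law_def by (simp only: measure_empty)
qed

lemma comb_singleton: "j \<in> J \<Longrightarrow> comb {j} \<omega> = x j [^] X j \<omega>"
  unfolding comb_def by (simp add: coeff_carrier)

text \<open>If two exponents put the power of \<open>x j\<close> into the same coset of
  \<open>U\<close>, they agree modulo the prime of \<open>pow_coset_congruence\<close>; the event
  thus lies inside one residue class of \<open>X j\<close>. A coset that contains no power has
  probability 0, and there \<open>\<epsilon> \<le> 1\<close> keeps the bound nonnegative.\<close>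

lemma prob_single_in_coset:
  assumes j: "j \<in> J" and U: "subgroup U G" and out: "x j \<notin> U" and v: "v \<in> carrier G"
  shows "prob {\<omega> \<in> space M. comb {j} \<omega> \<otimes> inv v \<in> U} \<le> 1 - \<epsilon>"
proof -
  obtain p where p: "p \<in> prime_factors (order G)"
    and pc: "\<And>a b :: int. x j [^] a \<otimes> inv (x j [^] b) \<in> U \<Longrightarrow> [a = b] (mod int p)"
    using pow_coset_congruence[OF finite_carrier U coeff_carrier[OF j] out] by blast
  have xj: "x j \<in> carrier G" using j coeff_carrier by blast
  have balj: "X j \<in> measurable M (count_space UNIV)" 
     "prob {\<omega> \<in> space M. [X j \<omega> = r] (mod int p)} \<le> 1 - \<epsilon>" for r
    using bal[OF j] p by (auto simp: balanced_def)
  show ?thesis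
  proof (cases "\<exists>b::int. x j [^] b \<otimes> inv v \<in> U")
    case True
    then obtain b :: int where b: "x j [^] b \<otimes> inv v \<in> U" by blast
    have "[a = b] (mod int p)" if "x j [^] a \<otimes> inv v \<in> U" for a :: int
    proof -
      have "(x j [^] a \<otimes> inv v) \<otimes> inv (x j [^] b \<otimes> inv v) \<in> U"
        using that b U by (simp add: subgroup.m_closed subgroup.m_inv_closed)
      also have "(x j [^] a \<otimes> inv v) \<otimes> inv (x j [^] b \<otimes> inv v) = x j [^] a \<otimes> inv (x j [^] b)"
      proof -
        have "(x j [^] a \<otimes> inv v) \<otimes> inv (x j [^] b \<otimes> inv v) = (v \<otimes> inv v) \<otimes> (x j [^] a \<otimes> inv (x j [^] b))"
          using xj v by (simp add: inv_mult m_ac del: r_inv l_inv Units_r_inv Units_l_inv)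
        also have "\<dots> = x j [^] a \<otimes> inv (x j [^] b)" using xj v by simp
        finally show ?thesis .
      qed
      finally show ?thesis by (rule pc)
    qed
    then have "{\<omega> \<in> space M. comb {j} \<omega> \<otimes> inv v \<in> U} \<subseteq> {\<omega> \<in> space M. [X j \<omega> = b] (mod int p)}"
      using j by (auto simp: comb_singleton)
    moreover have "{\<omega> \<in> space M. [X j \<omega> = b] (mod int p)} \<in> events"
      using measurable_sets[OF balj(1), of "{a. [a = b] (mod int p)}"]
      by (rule back_subst[of "\<lambda>S. S \<in> events"]) auto
    ultimately show ?thesis
      using finite_measure_mono balj(2) by (meson order_trans)
  next
    case False
    then have "{\<omega> \<in> space M. comb {j} \<omega> \<otimes> inv v \<in> U} = {}"
      using j by (auto simp: comb_singleton)
    then have "prob {\<omega> \<in> space M. comb {j} \<omega> \<otimes> inv v \<in> U} = 0" by (simp only: measure_empty)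
    then show ?thesis using eps_le_1 by simp
  qed
qed

section \<open>Values of non-negligible probability\<close>

definition atom_bound :: real where "atom_bound = \<epsilon> / real (order G)"

lemma order_pos: "order G > 0"
  using finite_carrier order_gt_0_iff_finite by blast

lemma atom_bound_pos: "atom_bound > 0"
  using order_pos eps_pos by (simp add: atom_bound_def)

lemma atom_bound_le_1: "atom_bound \<le> 1"
  using order_pos eps_le_1 by (simp add: atom_bound_def divide_le_eq)

text \<open>The exponent \<open>card K\<close> makes the threshold multiplicative over disjoint
  index sets, so that products of heavy values are heavy. The base \<open>atom_bound\<close> is
  \<epsilon> shared among \<open>order G\<close> values: the light values of a single index cannot
  together make up \<epsilon>.\<close>

definition heavy :: "'j set \<Rightarrow> 'a set" where
  "heavy K = {v \<in> carrier G. law K v \<ge> atom_bound ^ card K}"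

lemma heavy_subset: "heavy K \<subseteq> carrier G"
  by (auto simp: heavy_def)

lemma heavy_mult:
  assumes K: "K \<subseteq> J" "K' \<subseteq> J" "K \<inter> K' = {}" and s: "s \<in> heavy K" and t: "t \<in> heavy K'"
  shows "s \<otimes> t \<in> heavy (K \<union> K')"
proof -
  have c: "s \<in> carrier G" "t \<in> carrier G" using s t by (auto simp: heavy_def)
  have fin: "finite K" "finite K'" using K finite_index finite_subset by blast+
  have "atom_bound ^ card (K \<union> K') = atom_bound ^ card K * atom_bound ^ card K'"
    using fin K by (simp add: card_Un_disjoint power_add)
  also have "\<dots> \<le> law K s * law K' t"
    using s t atom_bound_pos by (intro mult_mono) (auto simp: heavy_def)
  also have "\<dots> = law K s * law K' (inv s \<otimes> (s \<otimes> t))"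
    using c by (simp add: m_assoc[symmetric])
  also have "\<dots> \<le> (\<Sum>v\<in>carrier G. law K v * law K' (inv v \<otimes> (s \<otimes> t)))"
    using c finite_carrier by (intro member_le_sum) auto
  also have "\<dots> = law (K \<union> K') (s \<otimes> t)"
    using c K by (simp add: law_Un)
  finally show ?thesis using c by (simp add: heavy_def)
qed

lemma heavy_empty: "heavy {} = {\<one>}"
proof -
  have "comb {} \<omega> = \<one>" for \<omega> by (simp add: comb_def)
  then have "law {} v = (if v = \<one> then 1 else 0)" for v
    by (simp add: law_def prob_space)
  then show ?thesis by (auto simp: heavy_def)
qed

text \<open>The values outside of \<open>heavy {j}\<close> are taken with probability less than \<open>\<epsilon>\<close> in total.\<close>

lemma heavy_singleton_spread:
  assumes j: "j \<in> J" and U: "subgroup U G" and out: "x j \<notin> U" and v: "v \<in> carrier G"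
  shows "\<exists>e\<in>heavy {j}. e \<otimes> inv v \<notin> U"
proof (rule ccontr)
  assume "\<not> (\<exists>e\<in>heavy {j}. e \<otimes> inv v \<notin> U)"
  then have sub: "e \<otimes> inv v \<in> U" if "e \<in> heavy {j}" for e using that by blast
  define S where "S = {e \<in> carrier G. e \<otimes> inv v \<in> U}"
  have eq: "{\<omega> \<in> space M. comb {j} \<omega> \<otimes> inv v \<in> U} = {\<omega> \<in> space M. comb {j} \<omega> \<in> S}"
    using comb_closed[of "{j}"] j by (auto simp: S_def)
  have "sum (law {j}) S \<le> 1 - \<epsilon>"
    using prob_single_in_coset[OF j U out v] prob_comb_in[of "{j}" S] j
    unfolding eq by (auto simp: S_def)
  moreover have "sum (law {j}) (carrier G) = sum (law {j}) (carrier G - S) + sum (law {j}) S"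
    using finite_carrier by (intro sum.subset_diff) (auto simp: S_def)
  ultimately have ge: "sum (law {j}) (carrier G - S) \<ge> \<epsilon>"
    using law_sum[of "{j}"] j by simp
  have light: "law {j} e < atom_bound" if "e \<in> carrier G - S" for e
    using that sub[of e] by (force simp: S_def heavy_def)
  show False
  proof (cases "carrier G - S = {}")
    case True then show False using ge eps_pos by (metis not_le sum.empty)
  next
    case False
    then have "sum (law {j}) (carrier G - S) < (\<Sum>e\<in>carrier G - S. atom_bound)"
      using finite_carrier light by (intro sum_strict_mono) auto
    also have "\<dots> \<le> real (order G) * atom_bound"
      using finite_carrier atom_bound_pos
      by (simp add: order_def card_mono)
    also have "\<dots> = \<epsilon>" using order_pos by (simp add: atom_bound_def)
    finally show False using ge by simp
  qed
qed

lemma heavy_singleton_nonempty: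
  assumes "j \<in> J" shows "heavy {j} \<noteq> {}"
proof
  assume "heavy {j} = {}"
  then have *: "law {j} e < atom_bound" if "e \<in> carrier G" for e
    using that by (force simp: heavy_def)
  have "sum (law {j}) (carrier G) < (\<Sum>e\<in>carrier G. atom_bound)"
    using finite_carrier * one_closed by (intro sum_strict_mono) blast+
  also have "\<dots> = \<epsilon>" using order_pos by (simp add: atom_bound_def order_def)
  finally show False using law_sum[of "{j}"] assms eps_le_1 by simp
qed

text \<open>Each additional summand with coefficient \<open>g\<close> either enlarges \<open>T\<close> or finds it invariant
  under translation by \<open>g\<close>.\<close>

lemma heavy_grow:
  assumes K: "K \<subseteq> J" and T: "T \<subseteq> heavy K" "T \<noteq> {}" "D \<subseteq> translation_stabilizer T"
    and "finite K'" "K' \<subseteq> J" "K \<inter> K' = {}" "\<forall>j\<in>K'. x j = g" "g \<in> carrier G"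
  shows "\<exists>T'\<subseteq>heavy (K \<union> K'). T' \<noteq> {} \<and> D \<subseteq> translation_stabilizer T' \<and>
    (g \<in> translation_stabilizer T' \<or> card T' > card K')"
  using assms(5-8)
proof (induction K' rule: finite_induct)
  case empty
  have "card T > 0" using T heavy_subset finite_carrier by (meson card_gt_0_iff finite_subset subset_trans)
  then show ?case using T by (intro exI[of _ T]) auto
next
  case (insert j K')
  then obtain T' where T': "T' \<subseteq> heavy (K \<union> K')" "T' \<noteq> {}" "D \<subseteq> translation_stabilizer T'"
    "g \<in> translation_stabilizer T' \<or> card T' > card K'" by auto
  have j: "j \<in> J" "x j = g" "j \<notin> K \<union> K'" using insert by auto
  have T'c: "T' \<subseteq> carrier G" "finite T'" 
    using subset_trans[OF T'(1) heavy_subset] finite_carrier finite_subset by auto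
  define E where "E = heavy {j}"
  define T'' where "T'' = (\<lambda>(t, e). t \<otimes> e) ` (T' \<times> E)"
  have Ec: "E \<subseteq> carrier G" "E \<noteq> {}" using heavy_subset heavy_singleton_nonempty[OF j(1)] by (auto simp: E_def)
  have T''c: "T'' \<subseteq> carrier G" "finite T''"
  proof -
    show "T'' \<subseteq> carrier G" using T'c Ec by (auto simp: T''_def)
    then show "finite T''" using finite_carrier finite_subset by blast
  qed
  have 1: "T'' \<subseteq> heavy (K \<union> insert j K')"
  proof
    fix s assume "s \<in> T''"
    then obtain t e where "t \<in> T'" "e \<in> E" "s = t \<otimes> e" by (auto simp: T''_def)
    then have "s \<in> heavy ((K \<union> K') \<union> {j})"
      using heavy_mult[of "K \<union> K'" "{j}" t e] T'(1) K insert.prems j by (auto simp: E_def)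
    then show "s \<in> heavy (K \<union> insert j K')" by simp
  qed
  have 2: "T'' \<noteq> {}" using T'(2) Ec(2) by (auto simp: T''_def)
  have 3: "h \<in> translation_stabilizer T''" if h: "h \<in> translation_stabilizer T'" for h
  proof -
    have hc: "h \<in> carrier G" using h by (simp add: translation_stabilizer_def)
    have "s \<otimes> h \<in> T''" if s: "s \<in> T''" for s
    proof -
      obtain t e where te: "t \<in> T'" "e \<in> E" "s = t \<otimes> e" using s unfolding T''_def by force
      have "s \<otimes> h = (t \<otimes> h) \<otimes> e" using te T'c Ec hc by (auto simp: m_ac subset_iff)
      moreover have "t \<otimes> h \<in> T'" using h te by (simp add: translation_stabilizer_def)
      ultimately show ?thesis using te by (auto simp: T''_def)
    qed
    then show ?thesis using hc by (simp add: translation_stabilizer_def)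
  qed
  have 4: "card T'' > card (insert j K')" if ng: "g \<notin> translation_stabilizer T'"
  proof -
    have stab: "subgroup (translation_stabilizer T') G" using T'c by (rule subgroup_translation_stabilizer)
    \<comment> \<open>The translate of \<open>T'\<close> by \<open>e0\<close> has as many elements
      as \<open>T'\<close>. Since \<open>e \<otimes> inv e0\<close> fails to stabilize
      \<open>T'\<close>, some product \<open>t \<otimes> e\<close> falls outside that translate, so
      \<open>T''\<close> is strictly larger.\<close>
    obtain e0 where e0: "e0 \<in> E" using Ec by blast
    then have e0c: "e0 \<in> carrier G" using Ec by blast
    obtain e where e: "e \<in> E" "e \<otimes> inv e0 \<notin> translation_stabilizer T'"
      using heavy_singleton_spread[OF j(1) stab _ e0c] ng j(2) by (auto simp: E_def)
    have ec: "e \<in> carrier G" using e Ec by blast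
    obtain t where t: "t \<in> T'" "t \<otimes> (e \<otimes> inv e0) \<notin> T'"
      using e ec e0c by (auto simp: translation_stabilizer_def)
    have tc: "t \<in> carrier G" using t T'c by blast
    let ?I = "(\<lambda>t. t \<otimes> e0) ` T'"
    have inj: "inj_on (\<lambda>t. t \<otimes> e0) T'"
      using T'c e0c by (intro inj_onI) (meson right_cancel subsetD)
    have "t \<otimes> e \<notin> ?I"
    proof
      assume "t \<otimes> e \<in> ?I"
      then obtain t' where t': "t \<otimes> e = t' \<otimes> e0" "t' \<in> T'" by (rule imageE)
      then have "t' = (t \<otimes> e) \<otimes> inv e0"
        using T'c e0c tc ec by (metis inv_solve_right m_closed subsetD)
      moreover have "(t \<otimes> e) \<otimes> inv e0 = t \<otimes> (e \<otimes> inv e0)" using tc ec e0c by (simp only: m_assoc inv_closed)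
      ultimately have "t \<otimes> (e \<otimes> inv e0) \<in> T'" using t'(2) by simp
      then show False using t by blast
    qed
    moreover have "insert (t \<otimes> e) ?I \<subseteq> T''" using t e e0 by (auto simp: T''_def)
    ultimately have "card T'' \<ge> Suc (card ?I)"
      using T''c(2) T'c(2) by (metis card_insert_disjoint card_mono finite_imageI)
    moreover have "card ?I = card T'" using inj by (rule card_image)
    moreover have "card T' > card K'" using T'(4) ng by blast
    ultimately show ?thesis using insert.hyps by simp
  qed
  show ?case
    using 1 2 3 4 T'(3) by (intro exI[of _ T'']) (auto simp: subset_iff)
qed

text \<open>The generators are treated one at a time. A heavy set has at most \<open>order G\<close>
  elements, so after \<open>order G\<close> copies of \<open>s\<close> the growing alternative of
  \<open>heavy_grow\<close> is exhausted and \<open>s\<close> must stabilize; earlier stabilizers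
  survive because that lemma preserves \<open>D\<close>.\<close>

lemma heavy_full:
  assumes "finite S" "S \<subseteq> carrier G" "K \<subseteq> J" "x ` K \<subseteq> S" "\<forall>s\<in>S. card {j\<in>K. x j = s} \<ge> order G"
  shows "\<exists>T\<subseteq>heavy K. T \<noteq> {} \<and> S \<subseteq> translation_stabilizer T"
  using assms
proof (induction S arbitrary: K rule: finite_induct)
  case empty
  then have "K = {}" by auto
  then show ?case using heavy_empty by auto
next
  case (insert s S)
  define K0 where "K0 = {j\<in>K. x j \<in> S}"
  define K1 where "K1 = {j\<in>K. x j = s}"
  have K: "K = K0 \<union> K1" "K0 \<inter> K1 = {}" using insert by (auto simp: K0_def K1_def)
  have "{j\<in>K0. x j = s'} = {j\<in>K. x j = s'}" if "s' \<in> S" for s'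
    using that by (auto simp: K0_def)
  then have "\<exists>T\<subseteq>heavy K0. T \<noteq> {} \<and> S \<subseteq> translation_stabilizer T"
    using insert.prems by (intro insert.IH) (auto simp: K0_def)
  then obtain T where T: "T \<subseteq> heavy K0" "T \<noteq> {}" "S \<subseteq> translation_stabilizer T" by blast
  have fK1: "finite K1" using finite_subset[OF insert.prems(2) finite_index] by (simp add: K1_def)
  obtain T' where T': "T' \<subseteq> heavy K" "T' \<noteq> {}" "S \<subseteq> translation_stabilizer T'"
    "s \<in> translation_stabilizer T' \<or> card T' > card K1"
  proof -
    have "K0 \<subseteq> J" "K1 \<subseteq> J" "\<forall>j\<in>K1. x j = s" "s \<in> carrier G"
      using insert.prems(1,2) by (auto simp: K0_def K1_def)
    then show thesis
      using heavy_grow[OF _ T fK1 _ K(2)] that unfolding K(1) by blast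
  qed
  have "card T' \<le> order G"
    using T'(1) heavy_subset finite_carrier by (metis card_mono order_def subset_trans)
  moreover have "order G \<le> card K1" using insert.prems by (auto simp: K1_def)
  ultimately show ?case using T' by auto
qed

text \<open>The nonempty heavy set \<open>T\<close> is invariant under everything that
  \<open>S\<close> generates. Heavy values have positive probability, so \<open>T\<close> meets the
  generated subgroup; being invariant, it then contains all of it.\<close>

lemma law_ge_full:
  assumes S: "S \<subseteq> carrier G" and K: "K \<subseteq> J" "x ` K \<subseteq> S" "\<forall>s\<in>S. card {j\<in>K. x j = s} \<ge> order G"
    and r: "r \<in> generate G S"
  shows "law K r \<ge> atom_bound ^ card K"
proof -
  have "finite S" using S finite_carrier finite_subset by blast
  then obtain T where T: "T \<subseteq> heavy K" "T \<noteq> {}" "S \<subseteq> translation_stabilizer T"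
    using heavy_full[OF _ S K] by blast
  have Tc: "T \<subseteq> carrier G" "finite T" 
    using subset_trans[OF T(1) heavy_subset] finite_carrier finite_subset by auto
  have gen: "generate G S \<subseteq> translation_stabilizer T"
    using T(3) Tc by (intro generate_subgroup_incl subgroup_translation_stabilizer)
  have R: "subgroup (generate G S) G" using S by (rule generate_is_subgroup)
  obtain t where t: "t \<in> T" using T by blast
  have tc: "t \<in> carrier G" using t Tc by blast
  have "law K t > 0" using t T(1) atom_bound_pos by (auto simp: heavy_def intro: less_le_trans[OF zero_less_power])
  moreover have "x ` K \<subseteq> generate G S" using K(2) by (auto intro: generate.incl)
  ultimately have "t \<in> generate G S" using law_outside_subgroup[OF R K(1)] by force
  then have "inv t \<otimes> r \<in> generate G S" using r R by (simp add: subgroup.m_closed subgroup.m_inv_closed)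
  then have "t \<otimes> (inv t \<otimes> r) \<in> T" using gen t by (auto simp: translation_stabilizer_def)
  moreover have "t \<otimes> (inv t \<otimes> r) = r"
    using tc subgroup.mem_carrier[OF R r] by (simp add: m_assoc[symmetric])
  ultimately show ?thesis using T(1) by (auto simp: heavy_def)
qed

text \<open>What is subtracted from 1 is a minorization constant: at most \<open>order G\<close>
  generators, each used \<open>order G\<close> times, make a family of at most
  \<open>(order G)\<^sup>2\<close> indices whose law is at least \<open>atom_bound\<close> to that
  power on the whole generated subgroup.\<close>

definition contraction :: real where "contraction = 1 - atom_bound ^ (order G)\<^sup>2"

lemma contraction_nonneg: "contraction \<ge> 0"
  using atom_bound_pos atom_bound_le_1 by (simp add: contraction_def power_le_one)

text \<open>A subfamily containing each generator \<open>order G\<close> times has a law bounded below on all of \<open>R\<close>,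
  so convolving with it contracts the distance to the uniform distribution.\<close>

lemma law_equidistributed:
  assumes S: "S \<subseteq> carrier G" and R_def: "R = generate G S"
  assumes "K \<subseteq> J" "x ` K \<subseteq> R" "\<forall>s\<in>S. L * order G \<le> card {j\<in>K. x j = s}" "r \<in> R"
  shows "\<bar>law K r - 1 / card R\<bar> \<le> contraction ^ L"
  using assms(3-)
proof (induction L arbitrary: K r)
  case 0
  have "0 \<le> 1 / real (card R)" "1 / real (card R) \<le> 1" by (auto simp: divide_le_eq)
  then show ?case unfolding power_0 using law_nonneg[of K r] law_le_1[of K r] by linarith
next
  case (Suc L)
  have R: "subgroup R G" unfolding R_def using S by (rule generate_is_subgroup)
  have Rc: "R \<subseteq> carrier G" using R by (rule subgroup.subset)
  have finR: "finite R" using Rc finite_carrier finite_subset by blast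
  have cR: "card R > 0" using R finR subgroup.one_closed by (metis card_gt_0_iff empty_iff)
  have finS: "finite S" using S finite_carrier finite_subset by blast
  have finK: "finite K" using Suc.prems(1) finite_index finite_subset by blast
  have "\<exists>F\<subseteq>{j\<in>K. x j = s}. card F = order G" if "s \<in> S" for s
  proof -
    have "order G \<le> card {j\<in>K. x j = s}" using Suc.prems(3) that by force
    then obtain F where "F \<subseteq> {j\<in>K. x j = s}" "card F = order G"
      by (rule obtain_subset_with_card_n)
    then show ?thesis by blast
  qed
  then have "\<forall>s\<in>S. \<exists>F. F \<subseteq> {j\<in>K. x j = s} \<and> card F = order G" by blast
  from bchoice[OF this] obtain F where F: "\<And>s. s \<in> S \<Longrightarrow> F s \<subseteq> {j\<in>K. x j = s}" "\<And>s. s \<in> S \<Longrightarrow> card (F s) = order G"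
    by blast
  define K1 where "K1 = (\<Union>s\<in>S. F s)"
  define K2 where "K2 = K - K1"
  have K1K: "K1 \<subseteq> K" using F(1) by (auto simp: K1_def)
  have K: "K = K1 \<union> K2" "K1 \<inter> K2 = {}" "K1 \<subseteq> J" "K2 \<subseteq> J"
    using K1K Suc.prems(1) by (auto simp: K2_def)
  have F1: "{j\<in>K1. x j = s} = F s" if "s \<in> S" for s
    using F(1) that by (auto simp: K1_def)
  have xK1: "x ` K1 \<subseteq> S" using F(1) by (auto simp: K1_def)
  have xK: "x ` K1 \<subseteq> R" "x ` K2 \<subseteq> R" using Suc.prems(2) K by auto
  have "card K1 \<le> (\<Sum>s\<in>S. card (F s))" unfolding K1_def using finS by (rule card_UN_le)
  also have "\<dots> = card S * order G" using F(2) by simp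
  also have "\<dots> \<le> (order G)\<^sup>2"
    using S finite_carrier by (simp add: power2_eq_square order_def card_mono)
  finally have cK1: "card K1 \<le> (order G)\<^sup>2" .
  define \<alpha> where "\<alpha> = atom_bound ^ (order G)\<^sup>2"
  have \<alpha>0: "\<alpha> > 0" using atom_bound_pos by (simp add: \<alpha>_def)
  have lower: "\<alpha> \<le> law K1 v" if "v \<in> R" for v
  proof -
    have "\<alpha> \<le> atom_bound ^ card K1"
      unfolding \<alpha>_def using cK1 atom_bound_pos atom_bound_le_1 by (intro power_decreasing) auto
    also have "\<dots> \<le> law K1 v"
      using that K xK1 F1 F(2) unfolding R_def by (intro law_ge_full[OF S]) auto
    finally show ?thesis .
  qed
  have IH: "\<bar>law K2 v - 1 / card R\<bar> \<le> contraction ^ L" if "v \<in> R" for v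
  proof (rule Suc.IH[OF K(4) xK(2) _ that], rule ballI)
    fix s assume s: "s \<in> S"
    have "{j\<in>K2. x j = s} = {j\<in>K. x j = s} - F s" using F1[OF s] by (auto simp: K2_def)
    moreover have "finite (F s)" using finite_subset[OF F(1)[OF s]] finK by simp
    ultimately have "card {j\<in>K2. x j = s} = card {j\<in>K. x j = s} - order G"
      using card_Diff_subset[OF _ F(1)[OF s]] F(2)[OF s] by simp
    then show "L * order G \<le> card {j\<in>K2. x j = s}"
      using Suc.prems(3) s by force
  qed
  have restr: "(\<Sum>v\<in>carrier G. law K1 v * h v) = (\<Sum>v\<in>R. law K1 v * h v)" for h
    using law_outside_subgroup[OF R K(3) xK(1)] Rc finite_carrier
    by (intro sum.mono_neutral_right) auto
  have sum1: "(\<Sum>v\<in>R. law K1 v) = 1"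
    using restr[of "\<lambda>_. 1"] law_sum[OF K(3)] by simp
  have rc: "r \<in> carrier G" using Rc Suc.prems(4) by blast
  have "(\<Sum>v\<in>R. law K2 (inv v \<otimes> r)) = (\<Sum>v\<in>R. law K2 v)"
  proof (rule sum.reindex_bij_witness[of _ "\<lambda>v. r \<otimes> inv v" "\<lambda>v. inv v \<otimes> r"])
    fix a assume a: "a \<in> R"
    then have ac: "a \<in> carrier G" using Rc by blast
    show "inv a \<otimes> r \<in> R" "r \<otimes> inv a \<in> R"
      using R a Suc.prems(4) by (auto intro!: subgroup.m_closed subgroup.m_inv_closed)
    show "r \<otimes> inv (inv a \<otimes> r) = a" "inv (r \<otimes> inv a) \<otimes> r = a"
      using ac rc by (auto simp: inv_mult m_assoc[symmetric] m_comm[of "inv r" a] m_comm[of r a] m_assoc)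
  qed auto
  also have "\<dots> = (\<Sum>v\<in>carrier G. law K2 v)"
    using law_outside_subgroup[OF R K(4) xK(2)] Rc finite_carrier
    by (intro sum.mono_neutral_left) auto
  finally have sum2: "(\<Sum>v\<in>R. law K2 (inv v \<otimes> r)) = 1" using law_sum[OF K(4)] by simp
  \<comment> \<open>The shifted \<open>law K2\<close> and the uniform law both have total mass 1 on
    \<open>R\<close>, so subtracting the constant \<alpha> from \<open>law K1\<close> does not
    change the sum; it leaves nonnegative weights of total mass
    \<open>1 - card R * \<alpha>\<close>.\<close>
  have "law K r - 1 / card R = (\<Sum>v\<in>R. (law K1 v - \<alpha>) * (law K2 (inv v \<otimes> r) - 1 / card R))"
  proof -
    have "(\<Sum>v\<in>R. (law K1 v - \<alpha>) * (law K2 (inv v \<otimes> r) - 1 / card R))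
       = (\<Sum>v\<in>R. law K1 v * law K2 (inv v \<otimes> r)) - (\<Sum>v\<in>R. law K1 v) / card R
          - \<alpha> * (\<Sum>v\<in>R. law K2 (inv v \<otimes> r)) + \<alpha> * (\<Sum>v\<in>R. 1 / card R)"
      by (simp add: algebra_simps sum.distrib sum_subtractf sum_distrib_left sum_divide_distrib)
    also have "\<dots> = law K r - 1 / card R"
      using K cR by (simp add: law_Un rc restr sum1 sum2)
    finally show ?thesis by simp
  qed
  also have "\<bar>\<dots>\<bar> \<le> (\<Sum>v\<in>R. (law K1 v - \<alpha>) * contraction ^ L)"
  proof (rule order_trans[OF sum_abs], rule sum_mono)
    fix v assume v: "v \<in> R"
    have "inv v \<otimes> r \<in> R" using R v Suc.prems(4) by (auto intro!: subgroup.m_closed subgroup.m_inv_closed)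
    then show "\<bar>(law K1 v - \<alpha>) * (law K2 (inv v \<otimes> r) - 1 / card R)\<bar> \<le> (law K1 v - \<alpha>) * contraction ^ L"
      using IH lower[OF v] by (simp add: abs_mult mult_left_mono)
  qed
  also have "\<dots> = (1 - card R * \<alpha>) * contraction ^ L"
    by (simp add: sum_distrib_right[symmetric] sum_subtractf sum1)
  also have "\<dots> \<le> contraction * contraction ^ L"
    using cR \<alpha>0 contraction_nonneg
    by (intro mult_right_mono) (auto simp: contraction_def \<alpha>_def[symmetric] mult_le_cancel_right2)
  finally show ?case by simp
qed

text \<open>One index \<open>j\<close> with coefficient outside \<open>U\<close> is split off.
  Whatever the other indices contribute, its power must then fall into one prescribed coset.\<close>

lemma prob_in_coset:
  assumes K: "K \<subseteq> J" and U: "subgroup U G" and j: "j \<in> K" "x j \<notin> U" and v: "v \<in> carrier G"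
  shows "(\<Sum>u | u \<in> carrier G \<and> inv u \<otimes> v \<in> U. law K u) \<le> 1 - \<epsilon>"
proof -
  define K' where "K' = K - {j}"
  have K': "K = K' \<union> {j}" "K' \<inter> {j} = {}" "K' \<subseteq> J" "{j} \<subseteq> J" using K j by (auto simp: K'_def)
  let ?U = "{u \<in> carrier G. inv u \<otimes> v \<in> U}"
  have inner: "(\<Sum>u\<in>?U. law {j} (inv w \<otimes> u)) \<le> 1 - \<epsilon>" if w: "w \<in> carrier G" for w
  proof -
    define v' where "v' = inv w \<otimes> v"
    have v': "v' \<in> carrier G" using w v by (simp add: v'_def)
    have mem: "a \<otimes> inv v' \<in> U \<longleftrightarrow> inv (w \<otimes> a) \<otimes> v \<in> U" if a: "a \<in> carrier G" for a
    proof -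
      have e: "inv (a \<otimes> inv v') = inv (w \<otimes> a) \<otimes> v" "inv (inv (w \<otimes> a) \<otimes> v) = a \<otimes> inv v'"
        using a v w by (simp_all add: v'_def inv_mult m_ac)
      show ?thesis using subgroup.m_inv_closed[OF U] e by metis
    qed
    have "(\<Sum>u\<in>?U. law {j} (inv w \<otimes> u)) = (\<Sum>a | a \<in> carrier G \<and> a \<otimes> inv v' \<in> U. law {j} a)"
      by (rule sum.reindex_bij_witness[of _ "\<lambda>a. w \<otimes> a" "\<lambda>u. inv w \<otimes> u"])
        (use w in \<open>auto simp: mem m_assoc[symmetric]\<close>)
    also have "\<dots> = prob {\<omega> \<in> space M. comb {j} \<omega> \<in> {a. a \<in> carrier G \<and> a \<otimes> inv v' \<in> U}}"
      using K' by (intro prob_comb_in[symmetric]) auto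
    also have "{\<omega> \<in> space M. comb {j} \<omega> \<in> {a. a \<in> carrier G \<and> a \<otimes> inv v' \<in> U}}
       = {\<omega> \<in> space M. comb {j} \<omega> \<otimes> inv v' \<in> U}" using comb_closed[OF K'(4)] by auto
    also have "prob \<dots> \<le> 1 - \<epsilon>" using K' j v' U by (intro prob_single_in_coset) auto
    finally show ?thesis .
  qed
  have "(\<Sum>u\<in>?U. law K u) = (\<Sum>u\<in>?U. \<Sum>w\<in>carrier G. law K' w * law {j} (inv w \<otimes> u))"
    unfolding K'(1) by (intro sum.cong law_Un K') auto
  also have "\<dots> = (\<Sum>w\<in>carrier G. law K' w * (\<Sum>u\<in>?U. law {j} (inv w \<otimes> u)))"
    by (subst sum.swap) (simp add: sum_distrib_left)
  also have "\<dots> \<le> (\<Sum>w\<in>carrier G. law K' w * (1 - \<epsilon>))"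
    by (intro sum_mono mult_left_mono inner) auto
  also have "\<dots> = 1 - \<epsilon>" by (simp add: sum_distrib_right[symmetric] law_sum[OF K'(3)])
  finally show ?thesis by simp
qed

text \<open>The indices with coefficient in \<open>R\<close> keep all the repetitions and give each
  value mass at most \<open>1 / card R + contraction ^ L\<close>. The remaining ones have to bring
  the product into the coset of \<open>R\<close> through \<open>v\<close>, which costs
  \<open>1 - \<epsilon>\<close> as soon as there is one of them. The target \<open>v\<close> is
  arbitrary because a shift coming from \<open>B\<close> must be allowed for.\<close>

lemma law_upper:
  assumes S: "S \<subseteq> carrier G" and R_def: "R = generate G S"
    and rep: "\<forall>s\<in>S. L * order G \<le> card {j\<in>J. x j = s}" and v: "v \<in> carrier G"
  shows "law J v \<le> (1 / card R + contraction ^ L) * (if x ` J \<subseteq> R then 1 else 1 - \<epsilon>)"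
proof -
  have R: "subgroup R G" unfolding R_def using S by (rule generate_is_subgroup)
  define J1 where "J1 = {j\<in>J. x j \<in> R}"
  define J2 where "J2 = {j\<in>J. x j \<notin> R}"
  have J: "J = J2 \<union> J1" "J2 \<inter> J1 = {}" "J1 \<subseteq> J" "J2 \<subseteq> J" by (auto simp: J1_def J2_def)
  have xJ1: "x ` J1 \<subseteq> R" by (auto simp: J1_def)
  define B where "B = 1 / card R + contraction ^ L"
  have B0: "B \<ge> 0" using contraction_nonneg by (simp add: B_def)
  have rep1: "\<forall>s\<in>S. L * order G \<le> card {j\<in>J1. x j = s}"
  proof
    fix s assume s: "s \<in> S"
    then have "s \<in> R" unfolding R_def by (rule generate.incl)
    then have "{j\<in>J1. x j = s} = {j\<in>J. x j = s}" by (auto simp: J1_def)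
    then show "L * order G \<le> card {j\<in>J1. x j = s}" using rep s by simp
  qed
  have bd: "law J1 u \<le> (if u \<in> R then B else 0)" for u
    using law_equidistributed[OF S R_def J(3) xJ1 rep1, of u] law_outside_subgroup[OF R J(3) xJ1, of u]
    by (auto simp: B_def abs_le_iff)
  have "law J v = (\<Sum>u\<in>carrier G. law J2 u * law J1 (inv u \<otimes> v))"
    by (subst J(1), subst law_Un) (use J v in auto)
  also have "\<dots> \<le> (\<Sum>u\<in>carrier G. law J2 u * (if inv u \<otimes> v \<in> R then B else 0))"
    by (intro sum_mono mult_left_mono bd) auto
  also have "\<dots> = (\<Sum>u | u \<in> carrier G \<and> inv u \<otimes> v \<in> R. law J2 u) * B"
    unfolding sum_distrib_right
    by (rule sum.mono_neutral_cong_right) (use finite_carrier in auto)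
  also have "\<dots> \<le> (if x ` J \<subseteq> R then 1 else 1 - \<epsilon>) * B"
  proof (intro mult_right_mono B0)
    show "(\<Sum>u | u \<in> carrier G \<and> inv u \<otimes> v \<in> R. law J2 u) \<le> (if x ` J \<subseteq> R then 1 else 1 - \<epsilon>)"
    proof (cases "x ` J \<subseteq> R")
      case True
      have "(\<Sum>u | u \<in> carrier G \<and> inv u \<otimes> v \<in> R. law J2 u) \<le> (\<Sum>u\<in>carrier G. law J2 u)"
        using finite_carrier by (intro sum_mono2) auto
      then show ?thesis using law_sum[OF J(4)] True by simp
    next
      case False
      then obtain j where "j \<in> J2" "x j \<notin> R" by (auto simp: J2_def)
      then show ?thesis using prob_in_coset[OF J(4) R _ _ v] False by auto
    qed
  qed
  finally show ?thesis by (simp add: B_def mult.commute)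
qed

end

subsection \<open>Counting vectors by the subgroup they robustly span\<close>

text \<open>With \<beta> the d-th root of \<kappa>, rounding down in \<open>n div d\<close> costs at
  most the constant factor 1 / \<kappa>; any rate strictly between \<beta> and 1 then absorbs the
  linear factor.\<close>

lemma eventually_linear_mult_power_div_le:
  fixes \<kappa> c :: real
  assumes \<kappa>: "0 < \<kappa>" "\<kappa> < 1" and d: "0 < (d::nat)" and c: "c \<ge> 0"
  obtains s where "0 < s" "s < 1" "\<forall>\<^sub>F n in sequentially. real n * c * \<kappa> ^ (n div d) \<le> s ^ n"
proof -
  define \<beta> where "\<beta> = root d \<kappa>"
  have \<beta>: "0 < \<beta>" "\<beta> < 1" "\<beta> ^ d = \<kappa>" using \<kappa> d by (auto simp: \<beta>_def)
  have le: "\<kappa> ^ (n div d) \<le> (1 / \<kappa>) * \<beta> ^ n" for n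
  proof -
    have "\<kappa> ^ (n div d) * \<kappa> \<le> \<kappa> ^ (n div d) * \<beta> ^ (n mod d)"
    proof (rule mult_left_mono)
      have "n mod d \<le> d" using d by (simp add: less_imp_le)
      then show "\<kappa> \<le> \<beta> ^ (n mod d)"
        using \<beta> power_decreasing[of "n mod d" d \<beta>] by simp
    qed (use \<kappa> in simp)
    also have "\<dots> = \<beta> ^ (d * (n div d) + n mod d)" by (simp only: \<beta>(3)[symmetric] power_add power_mult)
    also have "\<dots> = \<beta> ^ n" by simp
    finally show ?thesis using \<kappa> by (simp add: field_simps)
  qed
  define s where "s = (1 + \<beta>) / 2"
  have s: "0 < s" "s < 1" "\<beta> < s" using \<beta> by (auto simp: s_def)
  have "(\<lambda>n. (c / \<kappa>) * (real n * (\<beta> / s) ^ n)) \<longlonglongrightarrow> (c / \<kappa>) * 0"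
    using s \<beta> by (intro tendsto_intros powser_times_n_limit_0) auto
  then have "\<forall>\<^sub>F n in sequentially. (c / \<kappa>) * (real n * (\<beta> / s) ^ n) < 1"
    by (rule order_tendstoD) simp
  then have "\<forall>\<^sub>F n in sequentially. real n * c * \<kappa> ^ (n div d) \<le> s ^ n"
  proof eventually_elim
    case (elim n)
    have "real n * c * \<kappa> ^ (n div d) \<le> real n * c * ((1 / \<kappa>) * \<beta> ^ n)"
      using le c by (intro mult_left_mono) auto
    also have "\<dots> = (c / \<kappa>) * (real n * (\<beta> / s) ^ n) * s ^ n"
      using s by (simp add: power_divide)
    also have "\<dots> \<le> 1 * s ^ n" using elim s by (intro mult_right_mono) auto
    finally show ?case by simp
  qed
  then show ?thesis using that s by blast
qed

lemma power_one_plus_le: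
  fixes u :: real
  assumes "0 \<le> u" "real n * u \<le> 1"
  shows "(1 + u) ^ n \<le> 1 + 2 * (real n * u)"
proof -
  have "(1 + u) ^ n \<le> exp u ^ n" using assms by (intro power_mono exp_ge_add_one_self) auto
  also have "\<dots> = exp (real n * u)" by (simp add: exp_of_nat_mult)
  also have "\<dots> \<le> 1 + real n * u + (real n * u)\<^sup>2" using assms by (intro exp_bound) auto
  also have "(real n * u)\<^sup>2 \<le> real n * u" using assms by (simp add: power2_eq_square mult_left_le)
  finally show ?thesis by linarith
qed

context comm_group
begin

abbreviation vectors :: "nat \<Rightarrow> (nat \<Rightarrow> 'a) set" where
  "vectors m \<equiv> PiE {..<m} (\<lambda>_. carrier G)"

text \<open>The subgroup generated by the values that are attained too often for a few entries to matter.\<close>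

definition robust_span :: "nat \<Rightarrow> 'i set \<Rightarrow> ('i \<Rightarrow> 'a) \<Rightarrow> 'a set" where
  "robust_span L I y = generate G {s \<in> carrier G. L * order G \<le> card {b\<in>I. y b = s}}"

definition span :: "'i set \<Rightarrow> ('i \<Rightarrow> 'a) \<Rightarrow> 'a set" where
  "span I y = generate G (y ` I)"

definition subgroups :: "'a set set" where
  "subgroups = {H. subgroup H G}"

lemma finite_subgroups: "finite (carrier G) \<Longrightarrow> finite subgroups"
  unfolding subgroups_def
  by (rule finite_subset[of _ "Pow (carrier G)"]) (auto dest: subgroup.subset)

lemma card_subgroup_bounds:
  assumes "finite (carrier G)" "subgroup H G"
  shows "0 < card H" "card H \<le> order G" "finite H"
proof -
  show "finite H" using assms subgroup.subset finite_subset by metis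
  then show "0 < card H" using subgroup.one_closed[OF assms(2)] by (auto simp: card_gt_0_iff)
  show "card H \<le> order G" using assms subgroup.subset by (auto simp: order_def intro: card_mono)
qed

lemma subgroup_robust_span: "subgroup (robust_span L I y) G"
  unfolding robust_span_def by (rule generate_is_subgroup) auto

lemma subgroup_span: "y \<in> I \<rightarrow> carrier G \<Longrightarrow> subgroup (span I y) G"
  unfolding span_def by (rule generate_is_subgroup) auto

lemma span_subset_iff: "subgroup R G \<Longrightarrow> span I y \<subseteq> R \<longleftrightarrow> y ` I \<subseteq> R"
  unfolding span_def using generate_subgroup_incl[of "y ` I" R] by (auto intro: generate.incl)

text \<open>For \<open>L = 0\<close> the threshold is void and the robust span is all of G; from
  \<open>L = 1\<close> on, a value that passes it really occurs.\<close>

lemma robust_span_subset_span: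
  assumes "0 < L" "finite (carrier G)" "y \<in> I \<rightarrow> carrier G"
  shows "robust_span L I y \<subseteq> span I y"
  unfolding robust_span_def
proof (rule generate_subgroup_incl[OF _ subgroup_span[OF assms(3)]], safe)
  fix s assume "L * order G \<le> card {b\<in>I. y b = s}"
  moreover have "0 < L * order G" using assms order_gt_0_iff_finite by simp
  ultimately have "{b\<in>I. y b = s} \<noteq> {}" by (metis card.empty not_le)
  then show "s \<in> span I y" unfolding span_def by (auto intro: generate.incl)
qed

text \<open>A Chernoff bound: every entry outside of \<open>R\<close> is weighted by \<open>\<nu>\<close>.\<close>

lemma card_robust_span_chernoff:
  fixes \<nu> :: real
  assumes fin: "finite (carrier G)" and I: "finite I" and R: "subgroup R G"
    and lam: "0 < \<nu>" "\<nu> \<le> 1"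
  shows "real (card {y \<in> PiE I (\<lambda>_. carrier G). robust_span L I y = R}) * \<nu> ^ (order G * order G * L)
    \<le> (card R + \<nu> * order G) ^ card I"
proof -
  let ?Y = "PiE I (\<lambda>_. carrier G)" and ?w = "\<lambda>s. if s \<in> R then 1 else \<nu>"
  have finY: "finite ?Y" using fin I by (simp add: finite_PiE)
  have Rc: "R \<subseteq> carrier G" using R by (rule subgroup.subset)
  have lower: "\<nu> ^ (order G * order G * L) \<le> (\<Prod>b\<in>I. ?w (y b))"
    if y: "y \<in> ?Y" "robust_span L I y = R" for y
  proof -
    let ?out = "{b\<in>I. y b \<notin> R}"
    \<comment> \<open>No value outside \<open>R\<close> exceeds the threshold, and there are at most
      \<open>order G\<close> such values; hence the exponent
      \<open>order G * order G * L\<close>.\<close>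
    have few: "card {b\<in>I. y b = s} \<le> L * order G" if "s \<in> carrier G - R" for s
    proof (rule ccontr)
      assume "\<not> ?thesis"
      then have "s \<in> robust_span L I y"
        unfolding robust_span_def using that by (intro generate.incl) auto
      then show False using y that by simp
    qed
    have "?out \<subseteq> (\<Union>s\<in>carrier G - R. {b\<in>I. y b = s})" using y by auto
    then have "card ?out \<le> card (\<Union>s\<in>carrier G - R. {b\<in>I. y b = s})"
      using I fin by (intro card_mono) auto
    also have "\<dots> \<le> (\<Sum>s\<in>carrier G - R. card {b\<in>I. y b = s})" using fin by (intro card_UN_le) auto
    also have "\<dots> \<le> (\<Sum>s\<in>carrier G - R. L * order G)" by (intro sum_mono few)
    also have "\<dots> \<le> order G * order G * L"
      using fin by (simp add: order_def card_mono mult.commute mult.left_commute)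
    finally have "\<nu> ^ (order G * order G * L) \<le> \<nu> ^ card ?out"
      using lam by (intro power_decreasing) auto
    also have "\<dots> = (\<Prod>b\<in>I. ?w (y b))"
      using I by (simp add: prod.If_cases Int_def)
    finally show ?thesis .
  qed
  have "real (card {y \<in> ?Y. robust_span L I y = R}) * \<nu> ^ (order G * order G * L)
     = (\<Sum>y | y \<in> ?Y \<and> robust_span L I y = R. \<nu> ^ (order G * order G * L))" by simp
  also have "\<dots> \<le> (\<Sum>y | y \<in> ?Y \<and> robust_span L I y = R. \<Prod>b\<in>I. ?w (y b))"
    by (intro sum_mono lower) auto
  also have "\<dots> \<le> (\<Sum>y\<in>?Y. \<Prod>b\<in>I. ?w (y b))"
    using finY lam by (intro sum_mono2 prod_nonneg) auto
  also have "\<dots> = (\<Prod>b\<in>I. \<Sum>s\<in>carrier G. ?w s)"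
    by (rule prod_sum_PiE[symmetric]) (use fin I in auto)
  also have "\<dots> = (\<Sum>s\<in>carrier G. ?w s) ^ card I" by simp
  also have "\<dots> \<le> (card R + \<nu> * order G) ^ card I"
  proof (rule power_mono)
    have "(\<Sum>s\<in>carrier G. ?w s) = card R + card (carrier G - R) * \<nu>"
      using fin Rc by (simp add: sum.If_cases Int_absorb1 Diff_eq[symmetric])
    also have "\<dots> \<le> card R + \<nu> * order G"
      using fin lam by (simp add: order_def card_mono mult.commute)
    finally show "(\<Sum>s\<in>carrier G. ?w s) \<le> card R + \<nu> * order G" .
  qed (use lam in \<open>auto intro!: sum_nonneg\<close>)
  finally show ?thesis .
qed

text \<open>The weight \<nu> is taken with \<open>\<nu> * order G = \<eta> / 2\<close>, so that the
  base of the Chernoff bound is at most \<open>card R * (1 + \<eta> / 2)\<close>. Dividing by the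
  lower weight costs a constant to the power \<open>card I div d\<close>; for large \<open>d\<close>
  this is at most \<theta>, the ratio of \<open>1 + \<eta>\<close> to \<open>1 + \<eta> / 2\<close>,
  to the power \<open>card I\<close>. The proportion behind the robustness threshold has its origin
  here.\<close>

lemma card_robust_span_eq:
  assumes fin: "finite (carrier G)" and eta: "0 < \<eta>" "\<eta> \<le> (1::real)"
  obtains d where "0 < d"
    "\<And>I :: nat set. \<And>R. finite I \<Longrightarrow> subgroup R G \<Longrightarrow>
       real (card {y \<in> PiE I (\<lambda>_. carrier G). robust_span (card I div d) I y = R})
         \<le> real (card R) ^ card I * (1 + \<eta>) ^ card I"
proof -
  define g where "g = real (order G)"
  have g: "g \<ge> 1" using fin order_gt_0_iff_finite by (simp add: g_def Suc_leI)
  define \<nu> where "\<nu> = \<eta> / (2 * g)"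
  have lam: "0 < \<nu>" "\<nu> \<le> 1" using eta g by (auto simp: \<nu>_def divide_le_eq)
  have lg: "\<nu> * g = \<eta> / 2" using g by (simp add: \<nu>_def)
  define \<theta> where "\<theta> = (1 + \<eta>) / (1 + \<eta> / 2)"
  have th: "\<theta> > 1" using eta by (simp add: \<theta>_def)
  obtain d0 where d0: "(1 / \<nu>) ^ (order G * order G) < \<theta> ^ d0"
    using real_arch_pow[OF th] by blast
  define d where "d = Suc d0"
  have d: "(1 / \<nu>) ^ (order G * order G) \<le> \<theta> ^ d"
    using d0 th unfolding d_def by (smt (verit) power_Suc mult_le_cancel_right1 zero_less_power)
  show ?thesis
  proof (rule that[of d])
    show "0 < d" by (simp add: d_def)
    fix I :: "nat set" and R assume I: "finite I" and R: "subgroup R G"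
    let ?N = "real (card {y \<in> PiE I (\<lambda>_. carrier G). robust_span (card I div d) I y = R})"
    let ?L = "card I div d"
    have c: "real (card R) \<ge> 1" using card_subgroup_bounds(1)[OF fin R] by linarith
    have "?N = ?N * \<nu> ^ (order G * order G * ?L) * ((1 / \<nu>) ^ (order G * order G)) ^ ?L"
      using lam by (simp add: power_mult[symmetric] power_divide)
    also have "\<dots> \<le> (card R + \<nu> * order G) ^ card I * ((1 / \<nu>) ^ (order G * order G)) ^ ?L"
      using card_robust_span_chernoff[OF fin I R lam] lam by (intro mult_right_mono) auto
    also have "\<dots> \<le> (card R * (1 + \<eta> / 2)) ^ card I * (\<theta> ^ d) ^ ?L"
    proof (intro mult_mono power_mono)
      show "card R + \<nu> * order G \<le> card R * (1 + \<eta> / 2)"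
        using c lg eta mult_right_mono[OF c, of "\<eta> / 2"] by (simp add: g_def algebra_simps)
    qed (use lam d eta c in auto)
    also have "(\<theta> ^ d) ^ ?L \<le> \<theta> ^ card I"
      using th by (simp add: power_mult[symmetric] power_increasing)
    then have "(card R * (1 + \<eta> / 2)) ^ card I * (\<theta> ^ d) ^ ?L \<le> (card R * (1 + \<eta> / 2)) ^ card I * \<theta> ^ card I"
      using eta by (intro mult_left_mono) auto
    also have "\<dots> = real (card R) ^ card I * ((1 + \<eta> / 2) * \<theta>) ^ card I"
      by (simp add: power_mult_distrib)
    also have "(1 + \<eta> / 2) * \<theta> = 1 + \<eta>" using eta by (simp add: \<theta>_def)
    finally show "?N \<le> real (card R) ^ card I * (1 + \<eta>) ^ card I" .
  qed
qed

end

section \<open>Total weight of the vectors of one block\<close>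

context comm_group
begin

text \<open>A bound for the probability that the rows of a block send \<open>y\<close> to a given vector when the
  previous block spans \<open>H\<close>: an entry outside of the robust span costs a factor \<open>\<theta>\<close> in each row.\<close>

definition weight :: "real \<Rightarrow> real \<Rightarrow> nat \<Rightarrow> nat \<Rightarrow> 'a set \<Rightarrow> (nat \<Rightarrow> 'a) \<Rightarrow> real" where
  "weight \<theta> \<rho> L n H y =
     ((1 / card (robust_span L {..<n} y) + \<rho>) *
      (if H \<union> y ` {..<n} \<subseteq> robust_span L {..<n} y then 1 else \<theta>)) ^ n"

lemma weight_nonneg:
  fixes \<theta> \<rho> :: real
  shows "0 \<le> \<theta> \<Longrightarrow> 0 \<le> \<rho> \<Longrightarrow> 0 \<le> weight \<theta> \<rho> L n H y"
  by (simp add: weight_def)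

lemma card_proper_subgroup:
  assumes fin: "finite (carrier G)" and R: "subgroup R G" and K: "subgroup K G" and sub: "R \<subset> K"
  shows "2 * card R \<le> card K"
proof -
  interpret GK: group "G\<lparr>carrier := K\<rparr>" using K by (rule subgroup_imp_group)
  have fK: "finite K" using card_subgroup_bounds[OF fin K] by simp
  have "subgroup R (G\<lparr>carrier := K\<rparr>)" using subgroup_incl[OF R K] sub by auto
  then have "card R * card (rcosets\<^bsub>G\<lparr>carrier := K\<rparr>\<^esub> R) = card K"
    using GK.lagrange[of R] by (simp add: order_def mult.commute)
  moreover have "card R < card K" using fK sub by (rule psubset_card_mono)
  ultimately have "card (rcosets\<^bsub>G\<lparr>carrier := K\<rparr>\<^esub> R) \<ge> 2"
    by (metis One_nat_def less_2_cases_iff linorder_not_less mult_0_right mult.right_neutral not_less0 less_irrefl)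
  then show ?thesis using \<open>_ = card K\<close> by (metis mult.commute mult_le_mono1)
qed

text \<open>For a vector whose robust span contains its entries and \<open>H\<close>, that span is
  \<open>K\<close>; this forces \<open>H \<subseteq> K\<close>, and the at most
  \<open>card K ^ n\<close> such vectors each weigh about the inverse of that number. The others are
  regrouped by their robust span \<open>R\<close>: there the factor \<open>\<theta> ^ n\<close> has
  to beat only the surplus \<open>(1 + \<eta>) ^ n\<close> of the count over
  \<open>card R ^ n\<close>.\<close>

lemma sum_weight_le:
  fixes \<theta> \<rho> \<eta> :: real
  assumes fin: "finite (carrier G)" and \<theta>: "0 \<le> \<theta>" and \<rho>: "0 \<le> \<rho>" "real n * (real (order G) * \<rho>) \<le> 1" and L: "0 < L"
    and count: "\<And>R. subgroup R G \<Longrightarrow>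
        real (card {y \<in> vectors n. robust_span L {..<n} y = R}) \<le> real (card R) ^ n * (1 + \<eta>) ^ n"
    and \<eta>: "0 \<le> \<eta>" and H: "subgroup H G" and K: "subgroup K G"
  shows "(\<Sum>y | y \<in> vectors n \<and> span {..<n} y = K. weight \<theta> \<rho> L n H y)
    \<le> (if H \<subseteq> K then 1 else 0) + 2 * (real n * (real (order G) * \<rho>)) + 3 * card subgroups * (\<theta> * (1 + \<eta>)) ^ n"
proof -
  let ?I = "{..<n}" and ?g = "real (order G)"
  let ?Y = "PiE ?I (\<lambda>_. carrier G)"
  let ?R = "\<lambda>y. robust_span L ?I y"
  have finY: "finite ?Y" using fin by (simp add: finite_PiE)
  have finS: "finite subgroups" using fin by (rule finite_subgroups)
  have g0: "?g * \<rho> \<ge> 0" using \<rho> by simp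
  have pow: "(c * (1 / c + \<rho>)) ^ n \<le> 1 + 2 * (real n * (?g * \<rho>))" if "0 < c" "c \<le> ?g" for c
  proof -
    have "c * (1 / c + \<rho>) \<le> 1 + ?g * \<rho>"
      using that \<rho> by (simp add: distrib_left mult_right_mono)
    then have "(c * (1 / c + \<rho>)) ^ n \<le> (1 + ?g * \<rho>) ^ n" using that \<rho> by (intro power_mono) auto
    also have "\<dots> \<le> 1 + 2 * (real n * (?g * \<rho>))" by (rule power_one_plus_le[OF g0 \<rho>(2)])
    finally show ?thesis .
  qed
  define good where "good = {y \<in> ?Y. span ?I y = K \<and> H \<union> y ` ?I \<subseteq> ?R y}"
  define bad where "bad = {y \<in> ?Y. span ?I y = K \<and> \<not> H \<union> y ` ?I \<subseteq> ?R y}"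
  have good: "H \<subseteq> K \<and> y ` ?I \<subseteq> K \<and> ?R y = K" if "y \<in> good" for y
  proof -
    have y: "y \<in> ?I \<rightarrow> carrier G" "span ?I y = K" "H \<subseteq> ?R y" "y ` ?I \<subseteq> ?R y"
      using that by (auto simp: good_def)
    have "?R y \<subseteq> K" using robust_span_subset_span[OF L fin y(1)] y(2) by simp
    moreover have "K \<subseteq> ?R y" using span_subset_iff[OF subgroup_robust_span] y by metis
    ultimately show ?thesis using y by auto
  qed
  have goodsum: "(\<Sum>y\<in>good. weight \<theta> \<rho> L n H y) \<le> (if H \<subseteq> K then 1 else 0) + 2 * (real n * (?g * \<rho>))"
  proof (cases "H \<subseteq> K")
    case False
    then have "good = {}" using good by blast
    then show ?thesis using False g0 by simp
  next
    case True
    have cK: "real (card K) > 0" "real (card K) \<le> ?g" "finite K"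
      using card_subgroup_bounds[OF fin K] by auto
    have sub: "good \<subseteq> PiE ?I (\<lambda>_. K)" using good by (auto simp: good_def PiE_def Pi_def)
    have "card good \<le> card (PiE ?I (\<lambda>_. K))" using sub cK by (intro card_mono finite_PiE) auto
    also have "\<dots> = card K ^ n" by (simp add: card_PiE)
    finally have cg: "real (card good) \<le> real (card K) ^ n" by (metis of_nat_le_iff of_nat_power)
    have "(\<Sum>y\<in>good. weight \<theta> \<rho> L n H y) = (\<Sum>y\<in>good. (1 / card K + \<rho>) ^ n)"
      by (rule sum.cong) (use good True in \<open>auto simp: weight_def\<close>)
    also have "\<dots> = card good * (1 / card K + \<rho>) ^ n" by simp
    also have "\<dots> \<le> real (card K) ^ n * (1 / card K + \<rho>) ^ n"
      using cg \<rho> by (intro mult_right_mono) auto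
    also have "\<dots> = (card K * (1 / card K + \<rho>)) ^ n" by (simp add: power_mult_distrib)
    also have "\<dots> \<le> 1 + 2 * (real n * (?g * \<rho>))" by (rule pow) (use cK in auto)
    finally show ?thesis using True by simp
  qed
  \<comment> \<open>The 3 is \<open>1 + 2 * 1\<close>: the bound \<open>pow\<close> in the worst
    case that the assumption on \<rho> allows.\<close>
  have badR: "(\<Sum>y | y \<in> ?Y \<and> ?R y = R. ((1 / card R + \<rho>) * \<theta>) ^ n) \<le> 3 * (\<theta> * (1 + \<eta>)) ^ n"
    if R: "subgroup R G" for R
  proof -
    have cR: "real (card R) > 0" "real (card R) \<le> ?g" using card_subgroup_bounds[OF fin R] by auto
    have "(\<Sum>y | y \<in> ?Y \<and> ?R y = R. ((1 / card R + \<rho>) * \<theta>) ^ n)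
      = card {y \<in> ?Y. ?R y = R} * ((1 / card R + \<rho>) * \<theta>) ^ n" by simp
    also have "\<dots> \<le> (real (card R) ^ n * (1 + \<eta>) ^ n) * ((1 / card R + \<rho>) * \<theta>) ^ n"
      using count[OF R] \<rho> \<theta> by (intro mult_right_mono) auto
    also have "\<dots> = (card R * (1 / card R + \<rho>)) ^ n * (\<theta> * (1 + \<eta>)) ^ n"
      by (simp only: power_mult_distrib[symmetric]) (simp only: ac_simps)
    also have "\<dots> \<le> 3 * (\<theta> * (1 + \<eta>)) ^ n"
      using pow[OF cR] \<rho> \<theta> \<eta> by (intro mult_right_mono) auto
    finally show ?thesis .
  qed
  have "(\<Sum>y\<in>bad. weight \<theta> \<rho> L n H y) = (\<Sum>y\<in>bad. ((1 / card (?R y) + \<rho>) * \<theta>) ^ n)"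
    by (rule sum.cong) (auto simp: weight_def bad_def)
  also have "\<dots> \<le> (\<Sum>y\<in>?Y. ((1 / card (?R y) + \<rho>) * \<theta>) ^ n)"
    using finY \<theta> \<rho> by (intro sum_mono2) (auto simp: bad_def)
  also have "\<dots> = (\<Sum>R\<in>subgroups. \<Sum>y | y \<in> ?Y \<and> ?R y = R. ((1 / card (?R y) + \<rho>) * \<theta>) ^ n)"
  proof -
    have "?R ` ?Y \<subseteq> subgroups" using subgroup_robust_span by (auto simp: subgroups_def)
    then show ?thesis by (rule sum.group[OF finY finS, symmetric])
  qed
  also have "\<dots> = (\<Sum>R\<in>subgroups. \<Sum>y | y \<in> ?Y \<and> ?R y = R. ((1 / card R + \<rho>) * \<theta>) ^ n)"
    by (intro sum.cong) auto
  also have "\<dots> \<le> (\<Sum>R\<in>subgroups. 3 * (\<theta> * (1 + \<eta>)) ^ n)"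
    by (intro sum_mono badR) (simp add: subgroups_def)
  also have "\<dots> = 3 * card subgroups * (\<theta> * (1 + \<eta>)) ^ n" by simp
  finally have badsum: "(\<Sum>y\<in>bad. weight \<theta> \<rho> L n H y) \<le> 3 * card subgroups * (\<theta> * (1 + \<eta>)) ^ n" .
  have "{y. y \<in> ?Y \<and> span ?I y = K} = good \<union> bad" "good \<inter> bad = {}" by (auto simp: good_def bad_def)
  moreover have "finite good" "finite bad" using finY by (auto simp: good_def bad_def)
  ultimately show ?thesis using goodsum badsum by (simp add: sum.union_disjoint)
qed

text \<open>A vector over \<open>K\<close> that is not robust has as its robust span a proper
  subgroup of \<open>K\<close>, of at most half the size, so the count of these carries a factor
  \<open>((1 + \<eta>) / 2) ^ n\<close>. The loss from \<rho> over all rows is linear in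
  \<open>n\<close> by Bernoulli's inequality.\<close>

lemma sum_robust_ge:
  fixes \<rho> \<eta> :: real
  assumes fin: "finite (carrier G)" and \<rho>: "0 \<le> \<rho>" "real n * (real (order G) * \<rho>) \<le> 1" "0 < n" and L: "0 < L"
    and count: "\<And>R. subgroup R G \<Longrightarrow>
        real (card {y \<in> vectors n. robust_span L {..<n} y = R}) \<le> real (card R) ^ n * (1 + \<eta>) ^ n"
    and \<eta>: "0 \<le> \<eta>" and K: "subgroup K G"
  shows "\<rho> \<le> 1 / card K"
    "1 - real n * (real (order G) * \<rho>) - card subgroups * ((1 + \<eta>) / 2) ^ n
     \<le> (\<Sum>y | y \<in> vectors n \<and> span {..<n} y = K \<and> robust_span L {..<n} y = K. (1 / card K - \<rho>) ^ n)"
proof -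
  let ?I = "{..<n}" and ?g = "real (order G)"
  let ?Y = "PiE ?I (\<lambda>_. carrier G)"
  let ?R = "\<lambda>y. robust_span L ?I y"
  have finY: "finite ?Y" using fin by (simp add: finite_PiE)
  have finS: "finite subgroups" using fin by (rule finite_subgroups)
  have cK: "real (card K) > 0" "real (card K) \<le> ?g" "finite K"
    using card_subgroup_bounds[OF fin K] by auto
  have g0: "?g * \<rho> \<ge> 0" using \<rho> by simp
  have "card K * \<rho> \<le> ?g * \<rho>" using cK \<rho> by (intro mult_right_mono) auto
  also have "\<dots> \<le> real n * (?g * \<rho>)" using \<rho>(3) g0 by (intro mult_le_cancel_right1[THEN iffD2]) auto
  finally have cr: "card K * \<rho> \<le> real n * (?g * \<rho>)" .
  then have cr1: "card K * \<rho> \<le> 1" using \<rho> by linarith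
  then show 1: "\<rho> \<le> 1 / card K" using cK by (simp add: pos_le_divide_eq mult.commute)
  let ?YK = "PiE ?I (\<lambda>_. K)"
  have YKY: "?YK \<subseteq> ?Y" using subgroup.subset[OF K] by (intro PiE_mono) auto
  define T where "T = {y. y \<in> ?Y \<and> span ?I y = K \<and> ?R y = K}"
  have RK: "?R y \<subseteq> K" if "y \<in> ?YK" for y
  proof -
    have "y \<in> ?I \<rightarrow> carrier G" using that YKY by auto
    then have "?R y \<subseteq> span ?I y" by (rule robust_span_subset_span[OF L fin])
    also have "\<dots> \<subseteq> K" using that span_subset_iff[OF K] by blast
    finally show ?thesis .
  qed
  have sub: "?YK - T \<subseteq> (\<Union>R\<in>{R\<in>subgroups. R \<subset> K}. {y\<in>?Y. ?R y = R})"
  proof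
    fix y assume y: "y \<in> ?YK - T"
    then have yc: "y \<in> ?I \<rightarrow> carrier G" "y \<in> ?Y" using YKY by auto
    have "?R y \<noteq> K"
    proof
      assume e: "?R y = K"
      then have "K \<subseteq> span ?I y" using robust_span_subset_span[OF L fin yc(1)] by simp
      moreover have "span ?I y \<subseteq> K" using y span_subset_iff[OF K] by blast
      ultimately show False using e y yc by (auto simp: T_def)
    qed
    then have "?R y \<subset> K" using RK y by blast
    then show "y \<in> (\<Union>R\<in>{R\<in>subgroups. R \<subset> K}. {y\<in>?Y. ?R y = R})"
      using yc(2) subgroup_robust_span[of L ?I y] unfolding subgroups_def by blast
  qed
  have "card (?YK - T) \<le> card (\<Union>R\<in>{R\<in>subgroups. R \<subset> K}. {y\<in>?Y. ?R y = R})"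
    using finS finY by (intro card_mono[OF _ sub]) auto
  also have "\<dots> \<le> (\<Sum>R\<in>{R\<in>subgroups. R \<subset> K}. card {y\<in>?Y. ?R y = R})"
    using finS by (intro card_UN_le) auto
  finally have cle: "card (?YK - T) \<le> (\<Sum>R\<in>{R\<in>subgroups. R \<subset> K}. card {y\<in>?Y. ?R y = R})" .
  have "real (card (?YK - T)) \<le> (\<Sum>R\<in>{R\<in>subgroups. R \<subset> K}. real (card {y\<in>?Y. ?R y = R}))"
    using of_nat_mono[OF cle, where 'a = real] unfolding of_nat_sum .
  also have "\<dots> \<le> (\<Sum>R\<in>{R\<in>subgroups. R \<subset> K}. real (card K) ^ n * ((1 + \<eta>) / 2) ^ n)"
  proof (rule sum_mono)
    fix R assume "R \<in> {R\<in>subgroups. R \<subset> K}"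
    then have R: "subgroup R G" "R \<subset> K" by (auto simp: subgroups_def)
    have "2 * card R \<le> card K" by (rule card_proper_subgroup[OF fin R(1) K R(2)])
    then have "real (card R) \<le> real (card K) / 2" by simp
    then have "real (card R) ^ n * (1 + \<eta>) ^ n \<le> (real (card K) / 2) ^ n * (1 + \<eta>) ^ n"
      using \<eta> by (intro mult_right_mono power_mono) auto
    also have "\<dots> = real (card K) ^ n * ((1 + \<eta>) / 2) ^ n"
      by (simp add: power_divide)
    finally show "real (card {y\<in>?Y. ?R y = R}) \<le> real (card K) ^ n * ((1 + \<eta>) / 2) ^ n"
      using count[OF R(1)] by linarith
  qed
  also have "\<dots> = card {R\<in>subgroups. R \<subset> K} * (real (card K) ^ n * ((1 + \<eta>) / 2) ^ n)" by simp
  also have "\<dots> \<le> card subgroups * (real (card K) ^ n * ((1 + \<eta>) / 2) ^ n)"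
    using finS \<eta> by (intro mult_right_mono) (auto intro!: card_mono)
  finally have few: "real (card (?YK - T)) \<le> card subgroups * (real (card K) ^ n * ((1 + \<eta>) / 2) ^ n)" .
  have finT: "finite T" using finY by (simp add: T_def)
  have "card ?YK \<le> card (T \<union> (?YK - T))" using finT cK by (intro card_mono) (auto intro!: finite_PiE)
  also have "\<dots> \<le> card T + card (?YK - T)" by (rule card_Un_le)
  finally have "real (card K) ^ n \<le> real (card T) + real (card (?YK - T))"
    by (simp add: card_PiE flip: of_nat_power of_nat_add)
  then have T: "real (card K) ^ n * (1 - card subgroups * ((1 + \<eta>) / 2) ^ n) \<le> card T"
    using few by (simp add: algebra_simps)
  have bern: "1 - real n * (?g * \<rho>) \<le> (1 - card K * \<rho>) ^ n"
  proof -
    have "1 - real n * (?g * \<rho>) \<le> 1 + real n * (- (card K * \<rho>))"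
      using cK \<rho> by (simp add: mult_left_mono mult_right_mono)
    also have "\<dots> \<le> (1 + - (card K * \<rho>)) ^ n" using cr1 by (intro Bernoulli_inequality) auto
    finally show ?thesis by simp
  qed
  have le1: "(1 - card K * \<rho>) ^ n \<le> 1" using cr1 \<rho> by (intro power_le_one) auto
  define q where "q = card subgroups * ((1 + \<eta>) / 2) ^ n"
  have q0: "0 \<le> q" using \<eta> by (simp add: q_def)
  have "1 - real n * (?g * \<rho>) - q \<le> (1 - card K * \<rho>) ^ n - q * (1 - card K * \<rho>) ^ n"
    using bern mult_left_mono[OF le1 q0] by simp
  also have "\<dots> = (1 - q) * (1 - card K * \<rho>) ^ n" by (simp add: algebra_simps)
  also have "(1 - card K * \<rho>) ^ n = real (card K) ^ n * (1 / card K - \<rho>) ^ n"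
  proof -
    have "1 - card K * \<rho> = card K * (1 / card K - \<rho>)" using cK(1) by (simp add: field_simps)
    then show ?thesis by (simp only: power_mult_distrib)
  qed
  also have "(1 - q) * (real (card K) ^ n * (1 / card K - \<rho>) ^ n) \<le> card T * (1 / card K - \<rho>) ^ n"
    using mult_right_mono[OF T, of "(1 / card K - \<rho>) ^ n"] 1 by (simp add: q_def algebra_simps)
  also have "\<dots> = (\<Sum>y\<in>T. (1 / card K - \<rho>) ^ n)" by simp
  finally show "1 - real n * (?g * \<rho>) - card subgroups * ((1 + \<eta>) / 2) ^ n
     \<le> (\<Sum>y | y \<in> ?Y \<and> span ?I y = K \<and> ?R y = K. (1 / card K - \<rho>) ^ n)"
    by (simp add: q_def T_def)
qed

text \<open>One \<open>d\<close>, one rate and one threshold \<open>N\<close> serve all pairs of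
  subgroups, so that the same error can be used in every block of every matrix of the
  sequence.\<close>

theorem block_weights:
  fixes \<kappa> \<theta> :: real
  assumes fin: "finite (carrier G)" and \<kappa>: "0 < \<kappa>" "\<kappa> < 1" and \<theta>: "0 \<le> \<theta>" "\<theta> < 1"
  obtains d r N where "0 < d" "0 < r" "r < 1"
    "\<And>n H K. n \<ge> N \<Longrightarrow> subgroup H G \<Longrightarrow> subgroup K G \<Longrightarrow>
      (\<Sum>y | y \<in> vectors n \<and> span {..<n} y = K. weight \<theta> (\<kappa> ^ (n div d)) (n div d) n H y)
      \<le> (if H \<subseteq> K then 1 else 0) + r ^ n"
    "\<And>n K. n \<ge> N \<Longrightarrow> subgroup K G \<Longrightarrow> \<kappa> ^ (n div d) \<le> 1 / card K"
    "\<And>n K. n \<ge> N \<Longrightarrow> subgroup K G \<Longrightarrow> 1 - r ^ n \<le>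
      (\<Sum>y | y \<in> vectors n \<and> span {..<n} y = K \<and> robust_span (n div d) {..<n} y = K.
        (1 / card K - \<kappa> ^ (n div d)) ^ n)"
proof -
  \<comment> \<open>Half the gap between \<theta> and 1: then
    \<open>\<theta> * (1 + \<eta>) \<le> (1 + \<theta>) / 2 < 1\<close>, and
    \<open>(1 + \<eta>) / 2 \<le> 3 / 4\<close>.\<close>
  define \<eta> where "\<eta> = (1 - \<theta>) / 2"
  have \<eta>: "0 < \<eta>" "\<eta> \<le> 1 / 2" using \<theta> by (auto simp: \<eta>_def)
  obtain d where d: "0 < d"
    "\<And>I :: nat set. \<And>R. finite I \<Longrightarrow> subgroup R G \<Longrightarrow>
       real (card {y \<in> PiE I (\<lambda>_. carrier G). robust_span (card I div d) I y = R})
         \<le> real (card R) ^ card I * (1 + \<eta>) ^ card I"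
  proof -
    have "\<eta> \<le> 1" using \<eta>(2) by simp
    then show thesis using card_robust_span_eq[OF fin \<eta>(1)] that by blast
  qed
  have count: "real (card {y \<in> vectors n. robust_span (n div d) {..<n} y = R})
      \<le> real (card R) ^ n * (1 + \<eta>) ^ n" if "subgroup R G" for R and n :: nat
    using d(2)[of "{..<n}" R] that by simp
  define g where "g = real (order G)"
  have g: "g \<ge> 0" by (simp add: g_def)
  obtain s where s: "0 < s" "s < 1" "\<forall>\<^sub>F n in sequentially. real n * (2 * g) * \<kappa> ^ (n div d) \<le> s ^ n"
    using eventually_linear_mult_power_div_le[OF \<kappa> d(1), of "2 * g"] g by auto
  \<comment> \<open>The worst of the three decay rates. The rate \<open>r\<close>, strictly between
    \<open>u\<close> and 1, later absorbs the constant \<open>c\<close>, which collects the errors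
    of \<open>sum_weight_le\<close>.\<close>
  define u where "u = max s (max (\<theta> * (1 + \<eta>)) ((1 + \<eta>) / 2))"
  have "\<theta> * (1 + \<eta>) \<le> \<theta> + \<eta>" using \<theta> \<eta> by (simp add: algebra_simps mult_left_le_one_le)
  also have "\<dots> < 1" using \<theta> by (simp add: \<eta>_def field_simps)
  finally have u: "0 < u" "u < 1" using s \<eta> by (auto simp: u_def)
  have u_ge: "(1 + \<eta>) / 2 \<le> u" unfolding u_def by (intro max.coboundedI2 order_refl)
  define c where "c = 1 + 3 * real (card subgroups)"
  define r where "r = (1 + u) / 2"
  have r: "0 < r" "r < 1" "u < r" using u by (auto simp: r_def)
  have "(\<lambda>n. c * (u / r) ^ n) \<longlonglongrightarrow> c * 0"
    using u r by (intro tendsto_intros LIMSEQ_realpow_zero) auto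
  then have "\<forall>\<^sub>F n in sequentially. c * (u / r) ^ n < 1" by (rule order_tendstoD) simp
  then have ev: "\<forall>\<^sub>F n in sequentially. c * u ^ n \<le> r ^ n"
    by eventually_elim (use r in \<open>simp add: power_divide divide_simps\<close>)
  have "\<forall>\<^sub>F n in sequentially. c * u ^ n \<le> r ^ n \<and> real n * (2 * g) * \<kappa> ^ (n div d) \<le> s ^ n \<and> d \<le> n \<and> 1 \<le> n"
    using ev s(3) eventually_ge_at_top[of d] eventually_ge_at_top[of 1] by eventually_elim auto
  then obtain N where N: "\<And>n. n \<ge> N \<Longrightarrow> c * u ^ n \<le> r ^ n \<and> real n * (2 * g) * \<kappa> ^ (n div d) \<le> s ^ n \<and> d \<le> n \<and> 1 \<le> n"
    unfolding eventually_sequentially by blast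
  have L: "0 < n div d" if "n \<ge> N" for n using N[OF that] d(1) by (simp add: div_greater_zero_iff)
  have small: "2 * (real n * (g * \<kappa> ^ (n div d))) \<le> u ^ n" "real n * (g * \<kappa> ^ (n div d)) \<le> 1"
      "real n * (g * \<kappa> ^ (n div d)) \<ge> 0" if "n \<ge> N" for n
  proof -
    have "2 * (real n * (g * \<kappa> ^ (n div d))) \<le> s ^ n" using N[OF that] by (simp add: mult_ac)
    moreover have "s ^ n \<le> u ^ n" using s by (intro power_mono) (auto simp: u_def)
    moreover have "s ^ n \<le> 1" using s by (intro power_le_one) auto
    moreover show "real n * (g * \<kappa> ^ (n div d)) \<ge> 0" using g \<kappa> by simp
    ultimately show "2 * (real n * (g * \<kappa> ^ (n div d))) \<le> u ^ n" "real n * (g * \<kappa> ^ (n div d)) \<le> 1" by linarith+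
  qed
  have rn: "u ^ n + 3 * card subgroups * u ^ n \<le> r ^ n" if "n \<ge> N" for n
    using N[OF that] by (simp add: c_def algebra_simps)
  show ?thesis
  proof (rule that[of d r N])
    fix n H K assume n: "n \<ge> N" and H: "subgroup H G" and K: "subgroup K G"
    have "(\<Sum>y | y \<in> vectors n \<and> span {..<n} y = K. weight \<theta> (\<kappa> ^ (n div d)) (n div d) n H y)
      \<le> (if H \<subseteq> K then 1 else 0) + 2 * (real n * (g * \<kappa> ^ (n div d))) + 3 * card subgroups * (\<theta> * (1 + \<eta>)) ^ n"
      unfolding g_def using \<kappa> \<theta> \<eta> small(2)[OF n]
      by (intro sum_weight_le[OF fin _ _ _ L[OF n] count _ H K]) (auto simp: g_def)
    also have "3 * card subgroups * (\<theta> * (1 + \<eta>)) ^ n \<le> 3 * card subgroups * u ^ n"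
      using \<theta> \<eta> by (intro mult_left_mono power_mono) (auto simp: u_def)
    finally show "(\<Sum>y | y \<in> vectors n \<and> span {..<n} y = K. weight \<theta> (\<kappa> ^ (n div d)) (n div d) n H y)
      \<le> (if H \<subseteq> K then 1 else 0) + r ^ n"
      using small(1)[OF n] rn[OF n] by linarith
  next
    fix n K assume n: "n \<ge> N" and K: "subgroup K G"
    have n0: "0 < n" using N[OF n] by linarith
    note ge = sum_robust_ge[OF fin _ _ n0 L[OF n] count _ K, of "\<kappa> ^ (n div d)"]
    show "\<kappa> ^ (n div d) \<le> 1 / card K" using ge(1) \<kappa> \<eta> small(2)[OF n] by (simp add: g_def)
    have "1 - r ^ n \<le> 1 - real n * (g * \<kappa> ^ (n div d)) - card subgroups * ((1 + \<eta>) / 2) ^ n"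
    proof -
      have "card subgroups * ((1 + \<eta>) / 2) ^ n \<le> card subgroups * u ^ n"
        using \<eta> u_ge by (intro mult_left_mono power_mono) auto
      moreover have "0 \<le> card subgroups * u ^ n" using u by simp
      ultimately show ?thesis using small(1,3)[OF n] rn[OF n] by linarith
    qed
    also have "\<dots> \<le> (\<Sum>y | y \<in> vectors n \<and> span {..<n} y = K \<and> robust_span (n div d) {..<n} y = K.
        (1 / card K - \<kappa> ^ (n div d)) ^ n)"
      using ge(2) \<kappa> \<eta> small(2)[OF n] by (simp add: g_def)
    finally show "1 - r ^ n \<le> (\<Sum>y | y \<in> vectors n \<and> span {..<n} y = K \<and> robust_span (n div d) {..<n} y = K.
        (1 / card K - \<kappa> ^ (n div d)) ^ n)" .
  qed (use d r in auto)
qed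

end

subsection \<open>Sums over paths and chains of subgroups\<close>

lemma sum_PiE_insert:
  assumes "x \<notin> A" "finite A" "\<And>i. i \<in> insert x A \<Longrightarrow> finite (B i)"
  shows "(\<Sum>g\<in>PiE (insert x A) B. h g) = (\<Sum>g\<in>PiE A B. \<Sum>v\<in>B x. h (g(x := v)))"
proof -
  have "(\<Sum>g\<in>PiE (insert x A) B. h g) = (\<Sum>(v, g)\<in>B x \<times> PiE A B. h (g(x := v)))"
    unfolding PiE_insert_eq
    by (subst sum.reindex[OF inj_combinator[OF assms(1)]]) (simp add: case_prod_unfold)
  also have "\<dots> = (\<Sum>v\<in>B x. \<Sum>g\<in>PiE A B. h (g(x := v)))"
    by (simp add: sum.cartesian_product)
  also have "\<dots> = (\<Sum>g\<in>PiE A B. \<Sum>v\<in>B x. h (g(x := v)))" by (rule sum.swap)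
  finally show ?thesis .
qed

text \<open>Weights depend on the past only through the state left by the preceding block. The state
  in front of block 1 is \<open>s0\<close>, and that in front of block \<open>m + 1\<close> is the
  final state of a path of length \<open>m\<close>.\<close>

definition state_before :: "'s \<Rightarrow> (nat \<Rightarrow> 'y \<Rightarrow> 's) \<Rightarrow> (nat \<Rightarrow> 'y) \<Rightarrow> nat \<Rightarrow> 's" where
  "state_before s0 st y i = (if i \<le> 1 then s0 else st (i - 1) (y (i - 1)))"

text \<open>\<open>F\<close> may be negative, so that the lower bound follows by passing to \<open>- F\<close>.\<close>

lemma path_sum_le:
  fixes w :: "nat \<Rightarrow> 's \<Rightarrow> 'y \<Rightarrow> real" and F :: "nat \<Rightarrow> 's \<Rightarrow> real"
  assumes fin: "\<And>i. i \<in> {1..k} \<Longrightarrow> finite (Y i)"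
    and w: "\<And>i s v. i \<in> {1..k} \<Longrightarrow> v \<in> Y i \<Longrightarrow> 0 \<le> w i s v" and c: "0 \<le> c"
    and s0: "s0 \<in> S" and st: "\<And>i v. i \<in> {1..k} \<Longrightarrow> v \<in> Y i \<Longrightarrow> st i v \<in> S"
    and step: "\<And>i s. i < k \<Longrightarrow> s \<in> S \<Longrightarrow>
       (\<Sum>v\<in>Y (Suc i). w (Suc i) s v * F (Suc i) (st (Suc i) v)) \<le> c * F i s"
    and "m \<le> k"
  shows "(\<Sum>y\<in>PiE {1..m} Y. (\<Prod>i\<in>{1..m}. w i (state_before s0 st y i) (y i)) * F m (state_before s0 st y (Suc m)))
    \<le> c ^ m * F 0 s0"
  using \<open>m \<le> k\<close>
proof (induction m)
  case 0
  then show ?case by (simp add: state_before_def)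
next
  case (Suc m)
  have ins: "{1..Suc m} = insert (Suc m) {1..m}" by auto
  let ?W = "\<lambda>y. \<Prod>i\<in>{1..m}. w i (state_before s0 st y i) (y i)"
  have st_upd: "state_before s0 st (g(Suc m := v)) i = state_before s0 st g i" if "i \<le> Suc m" for g v i
    using that by (auto simp: state_before_def)
  have upd: "?W (g(Suc m := v)) = ?W g" for g v
    by (rule prod.cong) (auto simp: st_upd)
  have "(\<Sum>y\<in>PiE {1..Suc m} Y. (\<Prod>i\<in>{1..Suc m}. w i (state_before s0 st y i) (y i)) * F (Suc m) (state_before s0 st y (Suc (Suc m))))
    = (\<Sum>g\<in>PiE {1..m} Y. \<Sum>v\<in>Y (Suc m).
        ?W g * (w (Suc m) (state_before s0 st g (Suc m)) v * F (Suc m) (st (Suc m) v)))"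
    unfolding ins
  proof (subst sum_PiE_insert)
    have "(\<Prod>i\<in>insert (Suc m) {1..m}. w i (state_before s0 st (g(Suc m := v)) i) ((g(Suc m := v)) i))
       * F (Suc m) (state_before s0 st (g(Suc m := v)) (Suc (Suc m)))
      = ?W g * (w (Suc m) (state_before s0 st g (Suc m)) v * F (Suc m) (st (Suc m) v))" for g v
    proof -
      have "(\<Prod>i\<in>insert (Suc m) {1..m}. w i (state_before s0 st (g(Suc m := v)) i) ((g(Suc m := v)) i))
        = w (Suc m) (state_before s0 st (g(Suc m := v)) (Suc m)) v * ?W (g(Suc m := v))"
        by (subst prod.insert) auto
      moreover have "state_before s0 st (g(Suc m := v)) (Suc (Suc m)) = st (Suc m) v"
        by (simp add: state_before_def)
      ultimately show ?thesis by (simp only: upd st_upd order_refl mult_ac)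
    qed
    then show "(\<Sum>g\<in>PiE {1..m} Y. \<Sum>v\<in>Y (Suc m).
       (\<Prod>i\<in>insert (Suc m) {1..m}. w i (state_before s0 st (g(Suc m := v)) i) ((g(Suc m := v)) i))
       * F (Suc m) (state_before s0 st (g(Suc m := v)) (Suc (Suc m)))) = (\<Sum>g\<in>PiE {1..m} Y. \<Sum>v\<in>Y (Suc m).
        ?W g * (w (Suc m) (state_before s0 st g (Suc m)) v * F (Suc m) (st (Suc m) v)))"
      by (simp only:)
  qed (use fin Suc.prems in auto)
  also have "\<dots> = (\<Sum>g\<in>PiE {1..m} Y. ?W g * (\<Sum>v\<in>Y (Suc m).
        w (Suc m) (state_before s0 st g (Suc m)) v * F (Suc m) (st (Suc m) v)))"
    by (simp only: sum_distrib_left)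
  \<comment> \<open>The last block is summed first: for a fixed beginning \<open>g\<close>, the
    potential passes from stage \<open>m + 1\<close> to stage \<open>m\<close> at the cost of
    \<open>c\<close>.\<close>
  also have "\<dots> \<le> (\<Sum>g\<in>PiE {1..m} Y. ?W g * (c * F m (state_before s0 st g (Suc m))))"
  proof (rule sum_mono, rule mult_left_mono)
    fix g assume g: "g \<in> PiE {1..m} Y"
    have gi: "g i \<in> Y i" if "i \<in> {1..m}" for i using g that by (auto simp: PiE_def Pi_def)
    have "state_before s0 st g (Suc m) \<in> S"
      using s0 st[of m "g m"] gi[of m] Suc.prems by (cases m) (auto simp: state_before_def)
    then show "(\<Sum>v\<in>Y (Suc m). w (Suc m) (state_before s0 st g (Suc m)) v * F (Suc m) (st (Suc m) v))
      \<le> c * F m (state_before s0 st g (Suc m))"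
      using Suc.prems by (intro step) auto
    show "0 \<le> ?W g" using gi w Suc.prems by (intro prod_nonneg) auto
  qed
  also have "\<dots> = c * (\<Sum>g\<in>PiE {1..m} Y. ?W g * F m (state_before s0 st g (Suc m)))"
    by (simp add: sum_distrib_left mult_ac)
  also have "\<dots> \<le> c * (c ^ m * F 0 s0)"
    using Suc c by (intro mult_left_mono) auto
  finally show ?case by simp
qed

lemma path_sum_ge:
  fixes w :: "nat \<Rightarrow> 's \<Rightarrow> 'y \<Rightarrow> real" and F :: "nat \<Rightarrow> 's \<Rightarrow> real"
  assumes fin: "\<And>i. i \<in> {1..k} \<Longrightarrow> finite (Y i)"
    and w: "\<And>i s v. i \<in> {1..k} \<Longrightarrow> v \<in> Y i \<Longrightarrow> 0 \<le> w i s v" and c: "0 \<le> c"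
    and s0: "s0 \<in> S" and st: "\<And>i v. i \<in> {1..k} \<Longrightarrow> v \<in> Y i \<Longrightarrow> st i v \<in> S"
    and step: "\<And>i s. i < k \<Longrightarrow> s \<in> S \<Longrightarrow>
       c * F i s \<le> (\<Sum>v\<in>Y (Suc i). w (Suc i) s v * F (Suc i) (st (Suc i) v))"
  shows "c ^ k * F 0 s0 \<le>
    (\<Sum>y\<in>PiE {1..k} Y. (\<Prod>i\<in>{1..k}. w i (state_before s0 st y i) (y i)) * F k (state_before s0 st y (Suc k)))"
  using path_sum_le[of k Y w c s0 S st "\<lambda>i s. - F i s" k] assms
  by (simp add: sum_negf)

section \<open>Weakly and strictly increasing chains of subgroups\<close>

context comm_group
begin

text \<open>\<open>K\<close> is a lower bound and not a member of the chain. Chains are peeled from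
  the bottom, so that \<open>weak_chains (k - i)\<close> satisfies the error-free step from block
  \<open>i\<close> to block \<open>i + 1\<close> with equality.\<close>

primrec weak_chains :: "nat \<Rightarrow> 'a set \<Rightarrow> nat" where
  "weak_chains 0 K = 1"
| "weak_chains (Suc m) K = (\<Sum>K' | K' \<in> subgroups \<and> K \<subseteq> K'. weak_chains m K')"

primrec strict_chains :: "nat \<Rightarrow> 'a set \<Rightarrow> nat" where
  "strict_chains 0 K = 1"
| "strict_chains (Suc m) K = (\<Sum>K' | K' \<in> subgroups \<and> K \<subset> K'. strict_chains m K')"

text \<open>A weak chain is given by the steps at which it grows and by the strict chain of its new
  members, hence \<open>m choose i\<close> choices for \<open>i\<close> proper steps. The induction
  is Pascal's rule.\<close>

lemma weak_chains_eq_sum_binomial: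
  assumes fin: "finite (carrier G)" and "K \<in> subgroups"
  shows "weak_chains m K = (\<Sum>i\<le>m. strict_chains i K * (m choose i))"
  using assms(2)
proof (induction m arbitrary: K)
  case 0
  then show ?case by simp
next
  case (Suc m)
  have finS: "finite subgroups" using fin by (rule finite_subgroups)
  have eq: "{K' \<in> subgroups. K \<subseteq> K'} = insert K {K' \<in> subgroups. K \<subset> K'}" using Suc.prems by auto
  have "weak_chains (Suc m) K = weak_chains m K + (\<Sum>K' | K' \<in> subgroups \<and> K \<subset> K'. weak_chains m K')"
    using finS by (simp add: eq)
  also have "(\<Sum>K' | K' \<in> subgroups \<and> K \<subset> K'. weak_chains m K')
    = (\<Sum>K' | K' \<in> subgroups \<and> K \<subset> K'. \<Sum>i\<le>m. strict_chains i K' * (m choose i))"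
    by (rule sum.cong) (auto simp: Suc.IH)
  also have "\<dots> = (\<Sum>i\<le>m. strict_chains (Suc i) K * (m choose i))"
    by (subst sum.swap) (simp add: sum_distrib_right)
  also have "weak_chains m K = (\<Sum>i\<le>m. strict_chains i K * (m choose i))" using Suc by simp
  also have "(\<Sum>i\<le>m. strict_chains i K * (m choose i)) = 1 + (\<Sum>i\<le>m. strict_chains (Suc i) K * (m choose Suc i))"
  proof -
    have "(\<Sum>i\<le>m. strict_chains i K * (m choose i)) = (\<Sum>i\<le>Suc m. strict_chains i K * (m choose i))" by simp
    also have "\<dots> = 1 + (\<Sum>i\<le>m. strict_chains (Suc i) K * (m choose Suc i))"
      by (subst sum.atMost_Suc_shift) simp
    finally show ?thesis .
  qed
  also have "1 + (\<Sum>i\<le>m. strict_chains (Suc i) K * (m choose Suc i)) + (\<Sum>i\<le>m. strict_chains (Suc i) K * (m choose i))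
     = 1 + (\<Sum>i\<le>m. strict_chains (Suc i) K * (Suc m choose Suc i))"
    by (simp add: sum.distrib[symmetric] algebra_simps)
  also have "\<dots> = (\<Sum>i\<le>Suc m. strict_chains i K * (Suc m choose i))"
    by (subst sum.atMost_Suc_shift) (simp del: binomial_Suc_Suc)
  finally show ?case .
qed

lemma chain_length_eq_size: "chain_length G = size (prime_factorization (order G))"
  unfolding chain_length_def size_multiset_overloaded_eq
  by (intro sum.cong) (auto simp: count_prime_factorization in_prime_factors_iff)

lemma size_prime_factorization_subgroup_less:
  assumes fin: "finite (carrier G)" and K: "subgroup K G" and K': "subgroup K' G" and sub: "K \<subset> K'"
  shows "size (prime_factorization (card K)) < size (prime_factorization (card K'))"
proof -
  interpret GK: group "G\<lparr>carrier := K'\<rparr>" using K' by (rule subgroup_imp_group)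
  have fK: "finite K'" "card K > 0" "card K' > 0"
    using card_subgroup_bounds[OF fin K'] card_subgroup_bounds[OF fin K] by auto
  have "subgroup K (G\<lparr>carrier := K'\<rparr>)" using subgroup_incl[OF K K'] sub by auto
  then have e: "card K' = card (rcosets\<^bsub>G\<lparr>carrier := K'\<rparr>\<^esub> K) * card K" (is "_ = ?c * _")
    using GK.lagrange[of K] by (simp add: order_def)
  have "card K < card K'" using fK(1) sub by (rule psubset_card_mono)
  then have "?c \<noteq> 1" "?c \<noteq> 0" using e fK by auto
  then have "prime_factorization ?c \<noteq> {#}" by (simp add: prime_factorization_empty_iff)
  moreover have "prime_factorization (card K') = prime_factorization ?c + prime_factorization (card K)"
    unfolding e using \<open>?c \<noteq> 0\<close> fK by (simp add: prime_factorization_mult)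
  ultimately show ?thesis by (simp add: nonempty_has_size)
qed

text \<open>Each proper inclusion adds at least one prime factor to the order, by Lagrange. Strict
  chains thus have at most \<open>chain_length G\<close> members, which cuts the sum over
  \<open>i\<close> off independently of \<open>m\<close>.\<close>

lemma strict_chains_nonzero:
  assumes fin: "finite (carrier G)" and "K \<in> subgroups" "strict_chains i K \<noteq> 0"
  shows "size (prime_factorization (card K)) + i \<le> chain_length G"
  using assms(2-)
proof (induction i arbitrary: K)
  case 0
  then have K: "subgroup K G" by (simp add: subgroups_def)
  show ?case
  proof (cases "K = carrier G")
    case True then show ?thesis by (simp add: chain_length_eq_size order_def)
  next
    case False
    then have "K \<subset> carrier G" using subgroup.subset[OF K] by blast
    then show ?thesis
      using size_prime_factorization_subgroup_less[OF fin K subgroup_self]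
      by (simp add: chain_length_eq_size order_def)
  qed
next
  case (Suc i)
  then have "(\<Sum>K' | K' \<in> subgroups \<and> K \<subset> K'. strict_chains i K') \<noteq> 0" by simp
  then obtain K' where K': "K' \<in> subgroups" "K \<subset> K'" "strict_chains i K' \<noteq> 0"
    by (rule sum.not_neutral_contains_not_neutral) blast
  then show ?case
    using Suc.IH[of K'] size_prime_factorization_subgroup_less[OF fin _ _ K'(2)] Suc.prems
    by (force simp: subgroups_def)
qed

text \<open>The base \<open>K\<close> is kept general because removing the first member of a list
  makes that member the new base.\<close>

lemma strict_chains_eq_card:
  assumes fin: "finite (carrier G)" and "K \<in> subgroups"
  defines "Ch \<equiv> \<lambda>i K. {Hs. length Hs = i \<and> (\<forall>H\<in>set Hs. subgroup H G) \<and> sorted_wrt (\<subset>) (K # Hs)}"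
  shows "finite (Ch i K) \<and> strict_chains i K = card (Ch i K)"
  using assms(2)
proof (induction i arbitrary: K)
  case 0
  have "Ch 0 K = {[]}" by (auto simp: Ch_def)
  then show ?case by simp
next
  case (Suc i)
  let ?U = "{K' \<in> subgroups. K \<subset> K'}"
  have finU: "finite ?U" using finite_subgroups[OF fin] by simp
  have eq: "Ch (Suc i) K = (\<Union>K'\<in>?U. (#) K' ` Ch i K')"
  proof (intro equalityI subsetI)
    fix Hs assume "Hs \<in> Ch (Suc i) K"
    then show "Hs \<in> (\<Union>K'\<in>?U. (#) K' ` Ch i K')"
      by (cases Hs) (auto simp: Ch_def subgroups_def)
  next
    fix Hs assume "Hs \<in> (\<Union>K'\<in>?U. (#) K' ` Ch i K')"
    then obtain K' Hs' where h: "K' \<in> ?U" "Hs' \<in> Ch i K'" "Hs = K' # Hs'" by blast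
    then show "Hs \<in> Ch (Suc i) K"
      by (auto simp: Ch_def subgroups_def intro: psubset_trans)
  qed
  have IH: "finite (Ch i K')" "strict_chains i K' = card (Ch i K')" if "K' \<in> ?U" for K'
    using Suc.IH[of K'] that by auto
  have "card (Ch (Suc i) K) = (\<Sum>K'\<in>?U. card ((#) K' ` Ch i K'))"
    unfolding eq using finU IH by (intro card_UN_disjoint) auto
  also have "\<dots> = (\<Sum>K'\<in>?U. strict_chains i K')"
    by (intro sum.cong) (auto simp: IH card_image)
  finally show ?case using finU IH(1) unfolding eq by simp
qed

lemma strict_chains_eq_num_chains:
  assumes "finite (carrier G)"
  shows "strict_chains i {\<one>} = num_chains G i"
  using strict_chains_eq_card[OF assms, of "{\<one>}" i] triv_subgroup
  by (simp add: num_chains_def subgroup_chains_def subgroups_def)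

end

lemma binomial_div_power_tendsto:
  "(\<lambda>m. real (m choose i) / real m ^ i) \<longlonglongrightarrow> 1 / fact i"
proof -
  have "(\<lambda>m. (\<Prod>j\<in>{0..<i}. 1 - real j / real m) / fact i) \<longlonglongrightarrow> (\<Prod>j\<in>{0..<i}. 1 - 0) / fact i"
    by (intro tendsto_intros lim_const_over_n) auto
  then have "(\<lambda>m. (\<Prod>j\<in>{0..<i}. 1 - real j / real m) / fact i) \<longlonglongrightarrow> 1 / fact i" by simp
  moreover have "\<forall>\<^sub>F m in sequentially. (\<Prod>j\<in>{0..<i}. 1 - real j / real m) / fact i = real (m choose i) / real m ^ i"
    using eventually_gt_at_top[of 0]
  proof eventually_elim
    case (elim m)
    have "real (m choose i) = (\<Prod>j\<in>{0..<i}. real m - real j) / fact i"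
      by (simp add: binomial_gbinomial gbinomial_prod_rev)
    also have "(\<Prod>j\<in>{0..<i}. real m - real j) = (\<Prod>j\<in>{0..<i}. real m * (1 - real j / real m))"
      using elim by (intro prod.cong) (auto simp: field_simps)
    also have "\<dots> = real m ^ i * (\<Prod>j\<in>{0..<i}. 1 - real j / real m)"
      by (simp add: prod.distrib)
    finally show ?case using elim by simp
  qed
  ultimately show ?thesis by (rule Lim_transform_eventually)
qed

text \<open>The sum of binomials is a polynomial in \<open>m\<close> of degree at most
  \<open>chain_length G\<close>, and only the top binomial survives the division.\<close>

lemma (in comm_group) weak_chains_asymptotic:
  assumes fin: "finite (carrier G)" and K: "K \<in> subgroups"
  shows "(\<lambda>m. real (weak_chains m K) / real m ^ chain_length G)
    \<longlonglongrightarrow> real (strict_chains (chain_length G) K) / fact (chain_length G)"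
proof -
  define l where "l = chain_length G"
  have zero: "strict_chains i K = 0" if "i > l" for i
    using strict_chains_nonzero[OF fin K, of i] that by (auto simp: l_def)
  have eq: "weak_chains m K = (\<Sum>i\<le>l. strict_chains i K * (m choose i))" for m
  proof -
    have "weak_chains m K = (\<Sum>i\<le>m. strict_chains i K * (m choose i))"
      using weak_chains_eq_sum_binomial[OF fin K] .
    \<comment> \<open>Both ranges extend to \<open>max l m\<close>: the binomials vanish for
      \<open>i > m\<close>, the strict chains for \<open>i > l\<close>.\<close>
    also have "\<dots> = (\<Sum>i\<le>max l m. strict_chains i K * (m choose i))"
      by (intro sum.mono_neutral_left) auto
    also have "\<dots> = (\<Sum>i\<le>l. strict_chains i K * (m choose i))"
      by (intro sum.mono_neutral_right) (auto simp: zero)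
    finally show ?thesis .
  qed
  have lim: "(\<lambda>m. real (m choose i) / real m ^ l) \<longlonglongrightarrow> (if i = l then 1 / fact l else 0)" if "i \<le> l" for i
  proof (cases "i = l")
    case True then show ?thesis using binomial_div_power_tendsto[of l] by simp
  next
    case False
    have "(\<lambda>m. (real (m choose i) / real m ^ i) * (1 / real m) ^ (l - i)) \<longlonglongrightarrow> 1 / fact i * 0 ^ (l - i)"
      by (intro tendsto_intros binomial_div_power_tendsto lim_const_over_n)
    moreover have "(real (m choose i) / real m ^ i) * (1 / real m) ^ (l - i) = real (m choose i) / real m ^ l" for m
      using that by (simp add: power_divide power_add[symmetric])
    ultimately show ?thesis using False that by (simp add: power_0_left)
  qed
  have "(\<lambda>m. \<Sum>i\<le>l. real (strict_chains i K) * (real (m choose i) / real m ^ l))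
     \<longlonglongrightarrow> (\<Sum>i\<le>l. real (strict_chains i K) * (if i = l then 1 / fact l else 0))"
    by (intro tendsto_sum tendsto_mult tendsto_const lim) auto
  moreover have "(\<Sum>i\<le>l. real (strict_chains i K) * (if i = l then 1 / fact l else 0)) = real (strict_chains l K) / fact l"
    by (simp add: if_distrib cong: if_cong)
  moreover have "(\<Sum>i\<le>l. real (strict_chains i K) * (real (m choose i) / real m ^ l)) = real (weak_chains m K) / real m ^ l" for m
    by (simp add: eq sum_divide_distrib)
  ultimately show ?thesis by (simp add: l_def)
qed

section \<open>The chain count as a potential\<close>

context comm_group
begin

lemma trivial_in_subgroups: "{\<one>} \<in> subgroups"
  using triv_subgroup by (simp add: subgroups_def)

lemma weak_chains_Suc_ge:
  assumes fin: "finite (carrier G)" and "K \<in> subgroups"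
  shows "weak_chains m K \<le> weak_chains (Suc m) K"
  using finite_subgroups[OF fin] assms(2)
  by (auto intro!: member_le_sum)

lemma weak_chains_pos:
  assumes fin: "finite (carrier G)" and "K \<in> subgroups"
  shows "1 \<le> weak_chains m K"
  using assms(2)
proof (induction m)
  case (Suc m)
  then show ?case using weak_chains_Suc_ge[OF fin Suc.prems, of m] by linarith
qed simp

text \<open>The trivial subgroup lies below every other and chains may repeat members, so one number
  dominates every intermediate potential. By \<open>weak_chains_asymptotic\<close> it grows only
  polynomially in \<open>k\<close>.\<close>

lemma weak_chains_le_trivial:
  assumes fin: "finite (carrier G)" and K: "K \<in> subgroups" and "m \<le> k"
  shows "weak_chains m K \<le> weak_chains k {\<one>}"
proof -
  have sub: "\<one> \<in> K'" if "K' \<in> subgroups" for K' using that subgroup.one_closed by (auto simp: subgroups_def)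
  have "weak_chains m K \<le> weak_chains m {\<one>}"
    using finite_subgroups[OF fin] sub[OF K] by (cases m) (auto intro!: sum_mono2)
  also have "\<dots> \<le> weak_chains k {\<one>}"
    using lift_Suc_mono_le[of "\<lambda>m. weak_chains m {\<one>}", OF _ \<open>m \<le> k\<close>]
      weak_chains_Suc_ge[OF fin trivial_in_subgroups] by blast
  finally show ?thesis .
qed

lemma sum_span_split:
  fixes W :: "(nat \<Rightarrow> 'a) \<Rightarrow> real"
  assumes fin: "finite (carrier G)"
  shows "(\<Sum>v\<in>vectors n. W v * F (span {..<n} v))
    = (\<Sum>K\<in>subgroups. F K * (\<Sum>v | v \<in> vectors n \<and> span {..<n} v = K. W v))"
proof -
  let ?Y = "vectors n"
  have finY: "finite ?Y" using fin by (simp add: finite_PiE)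
  have "span {..<n} ` ?Y \<subseteq> subgroups"
  proof
    fix K assume "K \<in> span {..<n} ` ?Y"
    then obtain v where "v \<in> ?Y" "K = span {..<n} v" by blast
    moreover from this have "v \<in> {..<n} \<rightarrow> carrier G" by auto
    ultimately show "K \<in> subgroups" using subgroup_span by (simp add: subgroups_def)
  qed
  then have "(\<Sum>v\<in>?Y. W v * F (span {..<n} v))
     = (\<Sum>K\<in>subgroups. \<Sum>v | v \<in> ?Y \<and> span {..<n} v = K. W v * F (span {..<n} v))"
    by (rule sum.group[OF finY finite_subgroups[OF fin], symmetric])
  also have "\<dots> = (\<Sum>K\<in>subgroups. \<Sum>v | v \<in> ?Y \<and> span {..<n} v = K. F K * W v)"
    by (intro sum.cong) auto
  finally show ?thesis by (simp only: sum_distrib_left)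
qed

abbreviation span_before :: "(nat \<Rightarrow> nat) \<Rightarrow> (nat \<Rightarrow> nat \<Rightarrow> 'a) \<Rightarrow> nat \<Rightarrow> 'a set" where
  "span_before n \<equiv> state_before {\<one>} (\<lambda>i. span {..<n i})"

lemma span_in_subgroups: "v \<in> PiE I (\<lambda>_. carrier G) \<Longrightarrow> span I v \<in> subgroups"
  using subgroup_span[of v I] by (auto simp: subgroups_def PiE_def)

text \<open>The potential is the number of weakly increasing chains through the remaining blocks.\<close>

lemma sum_block_paths_le:
  fixes W :: "nat \<Rightarrow> 'a set \<Rightarrow> (nat \<Rightarrow> 'a) \<Rightarrow> real"
  assumes fin: "finite (carrier G)" and q: "0 \<le> q"
    and W0: "\<And>i H y. i \<in> {1..k} \<Longrightarrow> 0 \<le> W i H y"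
    and W: "\<And>i H K. i \<in> {1..k} \<Longrightarrow> subgroup H G \<Longrightarrow> subgroup K G \<Longrightarrow>
      (\<Sum>y | y \<in> vectors (n i) \<and> span {..<n i} y = K. W i H y) \<le> (if H \<subseteq> K then 1 else 0) + q"
  shows "(\<Sum>y\<in>PiE {1..k} (\<lambda>i. vectors (n i)). \<Prod>i\<in>{1..k}. W i (span_before n y i) (y i))
    \<le> (1 + q * card subgroups * weak_chains k {\<one>}) ^ k * weak_chains k {\<one>}"
proof -
  \<comment> \<open>The error \<open>q\<close> arises for every target subgroup and is multiplied
    there by a potential of at most \<open>weak_chains k {\<one>}\<close>. It becomes a relative
    error because the potential at the source is at least 1.\<close>
  define c where "c = 1 + q * card subgroups * weak_chains k {\<one>}"
  have finS: "finite subgroups" using fin by (rule finite_subgroups)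
  have step: "(\<Sum>v\<in>vectors (n (Suc i)). W (Suc i) s v * real (weak_chains (k - Suc i) (span {..<n (Suc i)} v)))
     \<le> c * real (weak_chains (k - i) s)" if i: "i < k" and s: "s \<in> subgroups" for i s
  proof -
    have "(\<Sum>v\<in>vectors (n (Suc i)). W (Suc i) s v * real (weak_chains (k - Suc i) (span {..<n (Suc i)} v)))
      = (\<Sum>K\<in>subgroups. real (weak_chains (k - Suc i) K) *
          (\<Sum>v | v \<in> vectors (n (Suc i)) \<and> span {..<n (Suc i)} v = K. W (Suc i) s v))"
      by (rule sum_span_split[OF fin])
    also have "\<dots> \<le> (\<Sum>K\<in>subgroups. real (weak_chains (k - Suc i) K) * ((if s \<subseteq> K then 1 else 0) + q))"
      using i s by (intro sum_mono mult_left_mono W) (auto simp: subgroups_def)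
    also have "\<dots> = (\<Sum>K\<in>subgroups. if s \<subseteq> K then real (weak_chains (k - Suc i) K) else 0)
        + q * (\<Sum>K\<in>subgroups. real (weak_chains (k - Suc i) K))"
      unfolding sum_distrib_left sum.distrib[symmetric] by (rule sum.cong) (auto simp: algebra_simps)
    also have "(\<Sum>K\<in>subgroups. if s \<subseteq> K then real (weak_chains (k - Suc i) K) else 0) = real (weak_chains (k - i) s)"
    proof -
      have "k - i = Suc (k - Suc i)" using i by simp
      then show ?thesis using finS by (simp add: sum.inter_filter[symmetric])
    qed
    also have "(\<Sum>K\<in>subgroups. real (weak_chains (k - Suc i) K)) \<le> (\<Sum>K\<in>subgroups. real (weak_chains k {\<one>}))"
      by (intro sum_mono) (use weak_chains_le_trivial[OF fin] in auto)
    then have "q * (\<Sum>K\<in>subgroups. real (weak_chains (k - Suc i) K)) \<le> q * card subgroups * weak_chains k {\<one>}"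
      using q by (simp add: mult_left_mono mult.assoc)
    also have "\<dots> \<le> q * card subgroups * weak_chains k {\<one>} * real (weak_chains (k - i) s)"
      using weak_chains_pos[OF fin s, of "k - i"] q
        mult_left_mono[of 1 "real (weak_chains (k - i) s)" "q * card subgroups * weak_chains k {\<one>}"] by simp
    finally show ?thesis by (simp add: c_def algebra_simps)
  qed
  have "(\<Sum>y\<in>PiE {1..k} (\<lambda>i. vectors (n i)). (\<Prod>i\<in>{1..k}. W i (span_before n y i) (y i))
      * real (weak_chains (k - k) (span_before n y (Suc k)))) \<le> c ^ k * real (weak_chains (k - 0) {\<one>})"
  proof (rule path_sum_le[where S = subgroups and k = k and F = "\<lambda>i s. real (weak_chains (k - i) s)"])
    show "0 \<le> c" using q by (simp add: c_def)
  qed (use fin W0 step trivial_in_subgroups span_in_subgroups in \<open>auto intro!: finite_PiE\<close>)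
  then show ?thesis by (simp add: c_def)
qed

text \<open>Targets not above the current subgroup are discarded, the weights being nonnegative. On
  the remaining ones the error is relative from the outset, so neither the number of subgroups nor
  the chain count enters the factor \<open>1 - q\<close>.\<close>

lemma sum_block_paths_ge:
  fixes W :: "nat \<Rightarrow> 'a set \<Rightarrow> (nat \<Rightarrow> 'a) \<Rightarrow> real"
  assumes fin: "finite (carrier G)" and q: "q \<le> 1"
    and W0: "\<And>i H y. i \<in> {1..k} \<Longrightarrow> y \<in> vectors (n i) \<Longrightarrow> 0 \<le> W i H y"
    and W: "\<And>i H K. i \<in> {1..k} \<Longrightarrow> subgroup H G \<Longrightarrow> subgroup K G \<Longrightarrow> H \<subseteq> K \<Longrightarrow>
      1 - q \<le> (\<Sum>y | y \<in> vectors (n i) \<and> span {..<n i} y = K. W i H y)"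
  shows "(1 - q) ^ k * weak_chains k {\<one>} \<le>
    (\<Sum>y\<in>PiE {1..k} (\<lambda>i. vectors (n i)). \<Prod>i\<in>{1..k}. W i (span_before n y i) (y i))"
proof -
  have finS: "finite subgroups" using fin by (rule finite_subgroups)
  have step: "(1 - q) * real (weak_chains (k - i) s) \<le>
     (\<Sum>v\<in>vectors (n (Suc i)). W (Suc i) s v * real (weak_chains (k - Suc i) (span {..<n (Suc i)} v)))"
     if i: "i < k" and s: "s \<in> subgroups" for i s
  proof -
    have "k - i = Suc (k - Suc i)" using i by simp
    then have "(1 - q) * real (weak_chains (k - i) s) = (\<Sum>K | K \<in> subgroups \<and> s \<subseteq> K. real (weak_chains (k - Suc i) K) * (1 - q))"
      by (simp add: sum_distrib_left mult.commute)
    also have "\<dots> \<le> (\<Sum>K | K \<in> subgroups \<and> s \<subseteq> K. real (weak_chains (k - Suc i) K) *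
          (\<Sum>v | v \<in> vectors (n (Suc i)) \<and> span {..<n (Suc i)} v = K. W (Suc i) s v))"
      using i s by (intro sum_mono mult_left_mono W) (auto simp: subgroups_def)
    also have "\<dots> \<le> (\<Sum>K\<in>subgroups. real (weak_chains (k - Suc i) K) *
          (\<Sum>v | v \<in> vectors (n (Suc i)) \<and> span {..<n (Suc i)} v = K. W (Suc i) s v))"
      using finS i W0 by (intro sum_mono2) (auto intro!: mult_nonneg_nonneg sum_nonneg)
    also have "\<dots> = (\<Sum>v\<in>vectors (n (Suc i)). W (Suc i) s v * real (weak_chains (k - Suc i) (span {..<n (Suc i)} v)))"
      by (rule sum_span_split[OF fin, symmetric])
    finally show ?thesis .
  qed
  have "(1 - q) ^ k * real (weak_chains (k - 0) {\<one>}) \<le>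
    (\<Sum>y\<in>PiE {1..k} (\<lambda>i. vectors (n i)). (\<Prod>i\<in>{1..k}. W i (span_before n y i) (y i))
      * real (weak_chains (k - k) (span_before n y (Suc k))))"
    by (rule path_sum_ge[where S = subgroups])
       (use fin W0 q step trivial_in_subgroups span_in_subgroups in \<open>auto intro!: finite_PiE\<close>)
  then show ?thesis by simp
qed

end

subsection \<open>Homomorphisms from a cokernel\<close>

definition "int_vec_group N = add_monoid (module_vec TYPE(int) N)"

lemma int_vec_group_simps [simp]:
  "carrier (int_vec_group N) = carrier_vec N"
  "mult (int_vec_group N) = (+)"
  "one (int_vec_group N) = 0\<^sub>v N"
  by (simp_all add: int_vec_group_def module_vec_simps)

lemma comm_group_int_vec_group: "comm_group (int_vec_group N)"
proof (rule comm_groupI)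
  fix v assume "v \<in> carrier (int_vec_group N)"
  then show "\<exists>y\<in>carrier (int_vec_group N). y \<otimes>\<^bsub>int_vec_group N\<^esub> v = \<one>\<^bsub>int_vec_group N\<^esub>"
    by (intro bexI[of _ "- v"]) (auto simp: uminus_l_inv_vec)
qed (auto simp: assoc_add_vec comm_add_vec)

lemma int_vec_group_int_pow:
  fixes z :: int
  assumes v: "v \<in> carrier_vec N"
  shows "v [^]\<^bsub>int_vec_group N\<^esub> z = z \<cdot>\<^sub>v v"
proof -
  interpret V: comm_group "int_vec_group N" by (rule comm_group_int_vec_group)
  have inv: "inv\<^bsub>int_vec_group N\<^esub> u = - u" if "u \<in> carrier_vec N" for u
    using V.inv_equality[of "- u" u] that by (simp add: uminus_l_inv_vec)
  have nat: "v [^]\<^bsub>int_vec_group N\<^esub> m = int m \<cdot>\<^sub>v v" for m :: nat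
  proof (induction m)
    case 0
    then show ?case using v by (intro eq_vecI) auto
  next
    case (Suc m)
    have "int m \<cdot>\<^sub>v v + v = (1 + int m) \<cdot>\<^sub>v v" using v by (intro eq_vecI) (auto simp: algebra_simps)
    then show ?case using Suc v by simp
  qed
  show ?thesis
  proof (cases "z \<ge> 0")
    case True
    then obtain m where z: "z = int m" by (rule nonneg_int_cases)
    show ?thesis unfolding z int_pow_int by (rule nat)
  next
    case False
    then have "v [^]\<^bsub>int_vec_group N\<^esub> z = inv\<^bsub>int_vec_group N\<^esub> (v [^]\<^bsub>int_vec_group N\<^esub> nat (- z))"
      by (simp only: int_pow_def2 not_le if_True)
    also have "\<dots> = - (int (nat (- z)) \<cdot>\<^sub>v v)" unfolding nat using v by (intro inv) simp
    also have "\<dots> = z \<cdot>\<^sub>v v" using False v by (intro eq_vecI) auto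
    finally show ?thesis .
  qed
qed

context comm_group
begin

definition vec_comb :: "nat \<Rightarrow> (nat \<Rightarrow> 'a) \<Rightarrow> int vec \<Rightarrow> 'a" where
  "vec_comb N x v = (\<Otimes>s\<in>{..<N}. x s [^] (v $ s))"

lemma vec_comb_hom:
  assumes "x \<in> {..<N} \<rightarrow> carrier G"
  shows "vec_comb N x \<in> hom (int_vec_group N) G"
proof (rule homI)
  fix u v assume uv: "u \<in> carrier (int_vec_group N)" "v \<in> carrier (int_vec_group N)"
  have "vec_comb N x (u + v) = (\<Otimes>s\<in>{..<N}. x s [^] (u $ s) \<otimes> x s [^] (v $ s))"
    unfolding vec_comb_def
    using uv assms by (intro finprod_cong') (auto simp: int_pow_mult Pi_iff)
  also have "\<dots> = vec_comb N x u \<otimes> vec_comb N x v"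
    unfolding vec_comb_def using assms by (intro finprod_multf) auto
  finally show "vec_comb N x (u \<otimes>\<^bsub>int_vec_group N\<^esub> v) = vec_comb N x u \<otimes> vec_comb N x v" by simp
qed (use assms in \<open>auto simp: vec_comb_def intro!: finprod_closed\<close>)

lemma vec_comb_unit_vec:
  assumes "x \<in> {..<N} \<rightarrow> carrier G" "j < N"
  shows "vec_comb N x (unit_vec N j) = x j"
proof -
  have "vec_comb N x (unit_vec N j) = (\<Otimes>s\<in>{..<N}. if j = s then x s else \<one>)"
    unfolding vec_comb_def using assms by (intro finprod_cong') (auto simp: unit_vec_def Pi_iff)
  also have "\<dots> = x j" using assms by (intro finprod_singleton) auto
  finally show ?thesis .
qed

lemma hom_eq_vec_comb:
  assumes h: "h \<in> hom (int_vec_group N) G" and v: "v \<in> carrier_vec N"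
  shows "h v = vec_comb N (\<lambda>s. h (unit_vec N s)) v"
proof -
  have hc: "h u \<in> carrier G" if "u \<in> carrier_vec N" for u using h that by (auto simp: hom_def)
  \<comment> \<open>\<open>v\<close> cut off after \<open>m\<close> coordinates is assembled one
    unit vector at a time.\<close>
  have part: "h (vec N (\<lambda>s. if s < m then v $ s else 0)) = (\<Otimes>s\<in>{..<m}. h (unit_vec N s) [^] (v $ s))"
    if "m \<le> N" for m
    using that
  proof (induction m)
    case 0
    have "vec N (\<lambda>s. if s < 0 then v $ s else 0) = \<one>\<^bsub>int_vec_group N\<^esub>" by auto
    then show ?case
      using hom_one[OF h comm_group.axioms(2)[OF comm_group_int_vec_group] is_group] by simp
  next
    case (Suc m)
    let ?p = "\<lambda>m. vec N (\<lambda>s. if s < m then v $ s else 0)"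
    have "?p (Suc m) = v $ m \<cdot>\<^sub>v unit_vec N m + ?p m"
      using Suc.prems by (intro eq_vecI) (auto simp: unit_vec_def less_Suc_eq)
    then have "h (?p (Suc m)) = h (unit_vec N m [^]\<^bsub>int_vec_group N\<^esub> (v $ m)) \<otimes> h (?p m)"
      using hom_mult[OF h, of "v $ m \<cdot>\<^sub>v unit_vec N m" "?p m"] by (simp add: int_vec_group_int_pow)
    also have "h (unit_vec N m [^]\<^bsub>int_vec_group N\<^esub> (v $ m)) = h (unit_vec N m) [^] (v $ m)"
      using comm_group.axioms(2)[OF comm_group_int_vec_group] is_group
      by (intro hom_int_pow[OF h]) auto
    finally show ?case using Suc hc by (simp add: lessThan_Suc)
  qed
  have "vec N (\<lambda>s. if s < N then v $ s else 0) = v" using v by auto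
  then show ?thesis using part[of N] by (simp add: vec_comb_def)
qed

definition solutions :: "nat \<Rightarrow> int mat \<Rightarrow> (nat \<Rightarrow> 'a) set" where
  "solutions N A = {x \<in> vectors N. \<forall>r<N. (\<Otimes>s\<in>{..<N}. x s [^] (A $$ (r, s))) = \<one>}"

text \<open>The cokernel is taken by rows, so a homomorphism on the integer vectors factors through
  it exactly when it kills each row; that is one equation over G per row of
  \<open>A\<close>.\<close>

lemma card_Hom_cok:
  assumes A: "A \<in> carrier_mat N N"
  shows "card (Hom (cok A) G) = card (solutions N A)"
proof -
  let ?V = "int_vec_group N"
  interpret V: comm_group ?V by (rule comm_group_int_vec_group)
  define RS where "RS = generate ?V (set (rows A))"
  have rows: "set (rows A) \<subseteq> carrier_vec N" using A by (auto simp: rows_def)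
  have subRS: "subgroup RS ?V" unfolding RS_def using rows by (intro V.generate_is_subgroup) auto
  have RSc: "RS \<subseteq> carrier_vec N" using subgroup.subset[OF subRS] by simp
  have norm: "RS \<lhd> ?V" using subRS by (rule V.subgroup_imp_normal)
  have cok: "cok A = ?V Mod RS" using A by (simp add: cok_def row_space_int_def RS_def int_vec_group_def)
  interpret Q: group "?V Mod RS" using norm by (rule normal.factorgroup_is_group)
  let ?c = "\<lambda>v. RS #>\<^bsub>?V\<^esub> v"
  have proj: "?c \<in> hom ?V (?V Mod RS)" using norm by (rule normal.r_coset_hom_Mod)
  have row_comb: "(\<Otimes>s\<in>{..<N}. x s [^] (A $$ (r, s))) = vec_comb N x (row A r)" 
    if "r < N" "x \<in> {..<N} \<rightarrow> carrier G" for x r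
    unfolding vec_comb_def using A that by (intro finprod_cong') (auto simp: Pi_iff)
  have eval: "\<phi> (?c v) = vec_comb N (\<lambda>s. \<phi> (?c (unit_vec N s))) v"
    if "\<phi> \<in> hom (?V Mod RS) G" "v \<in> carrier_vec N" for \<phi> v
    using hom_eq_vec_comb[OF Group.hom_compose[OF proj that(1)] that(2)] by (simp add: comp_def)
  define \<Phi> :: "(int vec set \<Rightarrow> 'a) \<Rightarrow> nat \<Rightarrow> 'a" where "\<Phi> = (\<lambda>\<phi>. restrict (\<lambda>s. \<phi> (?c (unit_vec N s))) {..<N})"
  have comb_restrict: "vec_comb N (restrict f {..<N}) v = vec_comb N f v" if "f \<in> {..<N} \<rightarrow> carrier G" for f v
    unfolding vec_comb_def using that by (intro finprod_cong') (auto simp: Pi_iff)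
  have c_carrier: "?c v \<in> carrier (?V Mod RS)" if "v \<in> carrier_vec N" for v
    using that by (simp add: carrier_FactGroup)
  have \<Phi>c: "(\<lambda>s. \<phi> (?c (unit_vec N s))) \<in> {..<N} \<rightarrow> carrier G" if "\<phi> \<in> hom (?V Mod RS) G" for \<phi>
    using that c_carrier by (auto simp: hom_def)
  have evalr: "\<phi> (?c v) = vec_comb N (\<Phi> \<phi>) v"
    if "\<phi> \<in> hom (?V Mod RS) G" "v \<in> carrier_vec N" for \<phi> v
    unfolding \<Phi>_def using eval[OF that] comb_restrict[OF \<Phi>c[OF that(1)]] by simp
  have "bij_betw \<Phi> (Hom (cok A) G) (solutions N A)"
    unfolding bij_betw_def
  proof
    show "inj_on \<Phi> (Hom (cok A) G)"
    proof (rule inj_onI)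
      fix \<phi> \<psi> assume h: "\<phi> \<in> Hom (cok A) G" "\<psi> \<in> Hom (cok A) G" and eq: "\<Phi> \<phi> = \<Phi> \<psi>"
      show "\<phi> = \<psi>"
      proof (rule extensionalityI[of _ "carrier (?V Mod RS)"])
        fix X assume "X \<in> carrier (?V Mod RS)"
        then obtain v where v: "v \<in> carrier_vec N" "X = ?c v" by (auto simp: carrier_FactGroup)
        show "\<phi> X = \<psi> X"
          using evalr[of \<phi> v] evalr[of \<psi> v] h v eq by (auto simp: Hom_def cok)
      qed (use h in \<open>auto simp: Hom_def cok\<close>)
    qed
    show "\<Phi> ` Hom (cok A) G = solutions N A"
    proof (intro equalityI subsetI)
      fix x assume "x \<in> \<Phi> ` Hom (cok A) G"
      then obtain \<phi> where \<phi>: "\<phi> \<in> hom (?V Mod RS) G" "x = \<Phi> \<phi>" by (auto simp: Hom_def cok)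
      have x: "x \<in> vectors N" using \<Phi>c[OF \<phi>(1)] \<phi>(2) by (auto simp: \<Phi>_def PiE_def Pi_def)
      have "(\<Otimes>s\<in>{..<N}. x s [^] (A $$ (r, s))) = \<one>" if r: "r < N" for r
      proof -
        have rc: "row A r \<in> carrier_vec N" using A r by auto
        have "row A r \<in> RS"
          unfolding RS_def using A r by (intro generate.incl) (auto simp: rows_def)
        then have "?c (row A r) = RS" using V.coset_join2[OF _ subRS] rc by simp
        then have "vec_comb N x (row A r) = \<phi> RS"
          using evalr[OF \<phi>(1) rc] \<phi>(2) by simp
        also have "\<dots> = \<one>" using hom_one[OF \<phi>(1) Q.is_group is_group] by simp
        finally show ?thesis using row_comb[OF r] x by (auto simp: PiE_def)
      qed
      then show "x \<in> solutions N A" using x by (simp add: solutions_def)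
    next
      fix x assume x: "x \<in> solutions N A"
      then have xc: "x \<in> {..<N} \<rightarrow> carrier G" and xe: "x \<in> extensional {..<N}"
        by (auto simp: solutions_def PiE_def)
      have hx: "vec_comb N x \<in> hom ?V G" using xc by (rule vec_comb_hom)
      interpret h: group_hom ?V G "vec_comb N x"
        using hx by unfold_locales
      have "set (rows A) \<subseteq> kernel ?V G (vec_comb N x)"
      proof
        fix u assume "u \<in> set (rows A)"
        then obtain r where r: "r < N" "u = row A r" using A by (auto simp: rows_def)
        then show "u \<in> kernel ?V G (vec_comb N x)"
          using x row_comb[OF r(1) xc] A by (auto simp: kernel_def solutions_def)
      qed
      then have ker: "RS \<subseteq> kernel ?V G (vec_comb N x)"
        unfolding RS_def by (intro V.generate_subgroup_incl h.subgroup_kernel)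
      have "vec_comb N x u = vec_comb N x v"
        if uv: "u \<in> carrier ?V" "v \<in> carrier ?V" "?c u = ?c v" for u v
      proof -
        have "u \<in> ?c v" using V.rcos_self[OF uv(1) subRS] uv(3) by simp
        then obtain w where w: "w \<in> RS" "u = w \<otimes>\<^bsub>?V\<^esub> v" by (auto simp: r_coset_def)
        then have "vec_comb N x u = vec_comb N x w \<otimes> vec_comb N x v"
          using RSc uv by (simp only:) (rule h.hom_mult, auto)
        also have "vec_comb N x w = \<one>" using ker w by (auto simp: kernel_def)
        finally show ?thesis using h.hom_closed[OF uv(2)] by simp
      qed
      then obtain g where g: "g \<in> hom (?V Mod RS) G" "\<And>v. v \<in> carrier ?V \<Longrightarrow> g (?c v) = vec_comb N x v"
        using FactGroup_universal[OF hx norm] by blast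
      \<comment> \<open>\<open>Hom\<close> contains only extensional functions, so the values of
        \<open>g\<close> off the quotient must be reset.\<close>
      define \<phi> where "\<phi> = restrict g (carrier (?V Mod RS))"
      have "\<phi> \<in> Hom (cok A) G"
        using g(1) Q.m_closed by (auto simp: Hom_def cok \<phi>_def hom_def Pi_def)
      moreover have "\<Phi> \<phi> = x"
        using g(2) c_carrier xc xe vec_comb_unit_vec[OF xc]
        by (intro extensionalityI[of _ "{..<N}"]) (auto simp: \<Phi>_def \<phi>_def)
      ultimately show "x \<in> \<Phi> ` Hom (cok A) G" by blast
    qed
  qed
  then show ?thesis by (rule bij_betw_same_card)
qed

end

subsection \<open>Independence of discrete random variables\<close>

text \<open>Independence is given in two layers, among the blocks and inside each block. For fixed
  \<open>p\<close> a condition on all the \<open>E p q\<close> is one event of \<open>Z p\<close>,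
  so the product over \<open>p\<close> splits into a double product.\<close>

lemma (in prob_space) indep_vars_Sigma:
  fixes E :: "'i \<Rightarrow> 'k \<Rightarrow> 'z \<Rightarrow> 'v"
  assumes fin: "finite I" "\<And>p. p \<in> I \<Longrightarrow> finite (J p)"
    and Z: "indep_vars M' Z I"
    and E: "\<And>p q. p \<in> I \<Longrightarrow> q \<in> J p \<Longrightarrow> E p q \<in> measurable (M' p) (count_space UNIV)"
    and inner: "\<And>p. p \<in> I \<Longrightarrow> indep_vars (\<lambda>_. count_space UNIV) (\<lambda>q \<omega>. E p q (Z p \<omega>)) (J p)"
  shows "indep_vars (\<lambda>_. count_space UNIV) (\<lambda>(p, q) \<omega>. E p q (Z p \<omega>)) (Sigma I J)"
proof (cases "Sigma I J = {}")
  case True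
  then show ?thesis unfolding indep_vars_def indep_sets_def by auto
next
  case False
  have I: "I \<noteq> {}" using False by auto
  have Zm: "Z p \<in> measurable M (M' p)" if "p \<in> I" for p using Z that by (auto simp: indep_vars_def)
  have Xm: "(case d of (p, q) \<Rightarrow> \<lambda>\<omega>. E p q (Z p \<omega>)) \<in> measurable M (count_space UNIV)" if "d \<in> Sigma I J" for d
    using that measurable_compose[OF Zm E] by auto
  show ?thesis
  proof (subst indep_vars_finite[OF False, where E = "\<lambda>_. UNIV"])
    show "finite (Sigma I J)" using fin by auto
    show "\<And>d. d \<in> Sigma I J \<Longrightarrow> sets (count_space UNIV) = sigma_sets (space (count_space UNIV)) UNIV"
      by (simp add: sigma_algebra.sigma_sets_eq[OF sigma_algebra_Pow, of UNIV, simplified])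
    show "\<forall>A\<in>Sigma I J \<rightarrow> UNIV. prob (\<Inter>d\<in>Sigma I J. (case d of (p, q) \<Rightarrow> \<lambda>\<omega>. E p q (Z p \<omega>)) -` A d \<inter> space M)
      = (\<Prod>d\<in>Sigma I J. prob ((case d of (p, q) \<Rightarrow> \<lambda>\<omega>. E p q (Z p \<omega>)) -` A d \<inter> space M))"
    proof
      fix A :: "'i \<times> 'k \<Rightarrow> 'v set" assume "A \<in> Sigma I J \<rightarrow> UNIV"
      define S where "S p = {z \<in> space (M' p). \<forall>q\<in>J p. E p q z \<in> A (p, q)}" for p
      have Zs: "Z p \<omega> \<in> space (M' p)" if "p \<in> I" "\<omega> \<in> space M" for p \<omega>
        using measurable_space[OF Zm[OF that(1)] that(2)] .
      have Ss: "S p \<in> sets (M' p)" if p: "p \<in> I" for p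
      proof -
        have "E p q -` A (p, q) \<inter> space (M' p) \<in> sets (M' p)" if "q \<in> J p" for q
          using measurable_sets[OF E[OF p that], of "A (p, q)"] by simp
        moreover have "E p q -` A (p, q) \<inter> space (M' p) = {z \<in> space (M' p). E p q z \<in> A (p, q)}" for q
          by auto
        ultimately have "{z \<in> space (M' p). E p q z \<in> A (p, q)} \<in> sets (M' p)" if "q \<in> J p" for q
          using that by (simp only:)
        then show ?thesis unfolding S_def using fin(2)[OF p] by (intro sets.sets_Collect_finite_All) auto
      qed
      have "(\<Inter>d\<in>Sigma I J. (case d of (p, q) \<Rightarrow> \<lambda>\<omega>. E p q (Z p \<omega>)) -` A d \<inter> space M)
        = (\<Inter>p\<in>I. Z p -` S p \<inter> space M)"
        using False I Zs by (auto simp: S_def)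
      then have "prob (\<Inter>d\<in>Sigma I J. (case d of (p, q) \<Rightarrow> \<lambda>\<omega>. E p q (Z p \<omega>)) -` A d \<inter> space M)
        = (\<Prod>p\<in>I. prob (Z p -` S p \<inter> space M))"
        using indep_varsD_finite[OF Z I fin(1), of S] Ss by simp
      also have "\<dots> = (\<Prod>p\<in>I. \<Prod>q\<in>J p. prob ((\<lambda>\<omega>. E p q (Z p \<omega>)) -` A (p, q) \<inter> space M))"
      proof (rule prod.cong[OF refl])
        fix p assume p: "p \<in> I"
        show "prob (Z p -` S p \<inter> space M) = (\<Prod>q\<in>J p. prob ((\<lambda>\<omega>. E p q (Z p \<omega>)) -` A (p, q) \<inter> space M))"
        proof (cases "J p = {}")
          case True
          then have "Z p -` S p \<inter> space M = space M" using Zs[OF p] by (auto simp: S_def)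
          then show ?thesis using True by (simp add: prob_space)
        next
          case False
          then have "Z p -` S p \<inter> space M = (\<Inter>q\<in>J p. (\<lambda>\<omega>. E p q (Z p \<omega>)) -` A (p, q) \<inter> space M)"
            using Zs[OF p] by (auto simp: S_def)
          then show ?thesis
            using indep_varsD_finite[OF inner[OF p] False fin(2)[OF p], of "\<lambda>q. A (p, q)"] by simp
        qed
      qed
      also have "\<dots> = (\<Prod>(p, q)\<in>Sigma I J. prob ((\<lambda>\<omega>. E p q (Z p \<omega>)) -` A (p, q) \<inter> space M))"
        using fin by (intro prod.Sigma) auto
      also have "\<dots> = (\<Prod>d\<in>Sigma I J. prob ((case d of (p, q) \<Rightarrow> \<lambda>\<omega>. E p q (Z p \<omega>)) -` A d \<inter> space M))"
        by (rule prod.cong) auto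
      finally show "prob (\<Inter>d\<in>Sigma I J. (case d of (p, q) \<Rightarrow> \<lambda>\<omega>. E p q (Z p \<omega>)) -` A d \<inter> space M)
        = (\<Prod>d\<in>Sigma I J. prob ((case d of (p, q) \<Rightarrow> \<lambda>\<omega>. E p q (Z p \<omega>)) -` A d \<inter> space M))" .
    qed
  qed (use Xm in \<open>auto simp: Int_stable_def\<close>)
qed

lemma (in prob_space) indep_prob_all:
  fixes X :: "'j \<Rightarrow> 'a \<Rightarrow> int"
  assumes X: "indep_vars (\<lambda>_. count_space UNIV) X D" and fin: "finite D" "finite L"
    and K: "\<And>l. l \<in> L \<Longrightarrow> K l \<subseteq> D" "disjoint_family_on K L"
  shows "prob {\<omega> \<in> space M. \<forall>l\<in>L. Q l (restrict (\<lambda>d. X d \<omega>) (K l))}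
     = (\<Prod>l\<in>L. prob {\<omega> \<in> space M. Q l (restrict (\<lambda>d. X d \<omega>) (K l))})"
proof (cases "L = {}")
  case True
  then show ?thesis by (simp add: prob_space)
next
  case False
  have PiM: "PiM (K l) (\<lambda>_. count_space (UNIV :: int set)) = count_space (PiE (K l) (\<lambda>_. UNIV))" if "l \<in> L" for l
    using fin K(1)[OF that] by (intro count_space_PiM_finite) (auto intro: finite_subset)
  have "prob (\<Inter>l\<in>L. (\<lambda>\<omega>. restrict (\<lambda>d. X d \<omega>) (K l)) -` {a \<in> PiE (K l) (\<lambda>_. UNIV). Q l a} \<inter> space M)
    = (\<Prod>l\<in>L. prob ((\<lambda>\<omega>. restrict (\<lambda>d. X d \<omega>) (K l)) -` {a \<in> PiE (K l) (\<lambda>_. UNIV). Q l a} \<inter> space M))"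
    by (rule indep_varsD_finite[OF indep_vars_restrict[OF X K] False fin(2)]) (auto simp: PiM)
  moreover have "(\<Inter>l\<in>L. (\<lambda>\<omega>. restrict (\<lambda>d. X d \<omega>) (K l)) -` {a \<in> PiE (K l) (\<lambda>_. UNIV). Q l a} \<inter> space M)
    = {\<omega> \<in> space M. \<forall>l\<in>L. Q l (restrict (\<lambda>d. X d \<omega>) (K l))}" using False by auto
  moreover have "(\<lambda>\<omega>. restrict (\<lambda>d. X d \<omega>) (K l)) -` {a \<in> PiE (K l) (\<lambda>_. UNIV). Q l a} \<inter> space M
    = {\<omega> \<in> space M. Q l (restrict (\<lambda>d. X d \<omega>) (K l))}" for l by auto
  ultimately show ?thesis by simp
qed

context prob_space
begin

context
  fixes S S' :: "'b set" and A B :: "'a \<Rightarrow> 'b"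
  assumes AB: "indep_var (count_space S) A (count_space S') B"
begin

lemma indep_discrete_measurable:
  "A \<in> measurable M (count_space S)" "B \<in> measurable M (count_space S')"
  using AB by (auto simp: indep_var_eq)

lemma indep_discrete_event:
  "{\<omega> \<in> space M. Q (A \<omega>)} \<in> events" "{\<omega> \<in> space M. Q (B \<omega>)} \<in> events"
proof -
  have "{\<omega> \<in> space M. Q (A \<omega>)} = A -` {a \<in> S. Q a} \<inter> space M"
    "{\<omega> \<in> space M. Q (B \<omega>)} = B -` {a \<in> S'. Q a} \<inter> space M"
    using indep_discrete_measurable[THEN measurable_space] by auto
  moreover have "A -` {a \<in> S. Q a} \<inter> space M \<in> events"
    by (rule measurable_sets[OF indep_discrete_measurable(1)]) auto
  moreover have "B -` {a \<in> S'. Q a} \<inter> space M \<in> events"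
    by (rule measurable_sets[OF indep_discrete_measurable(2)]) auto
  ultimately show "{\<omega> \<in> space M. Q (A \<omega>)} \<in> events" "{\<omega> \<in> space M. Q (B \<omega>)} \<in> events"
    by (simp_all only:)
qed

text \<open>\<open>F\<close> reduces the second variable to finitely many values, so conditioning on
  it is a finite sum. The same decomposition gives the measurability of an event that involves both
  variables.\<close>

lemma indep_discrete_disintegrate:
  assumes fin: "finite T" and F: "\<And>b. b \<in> S' \<Longrightarrow> F b \<in> T"
  shows "{\<omega> \<in> space M. Q (A \<omega>) (F (B \<omega>))} \<in> events"
    "prob {\<omega> \<in> space M. Q (A \<omega>) (F (B \<omega>))}
      = (\<Sum>c\<in>T. prob {\<omega> \<in> space M. F (B \<omega>) = c} * prob {\<omega> \<in> space M. Q (A \<omega>) c})"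
    "(\<Sum>c\<in>T. prob {\<omega> \<in> space M. F (B \<omega>) = c}) = 1"
proof -
  have Bs: "B \<omega> \<in> S'" if "\<omega> \<in> space M" for \<omega>
    using measurable_space[OF indep_discrete_measurable(2) that] by simp
  have As: "A \<omega> \<in> S" if "\<omega> \<in> space M" for \<omega>
    using measurable_space[OF indep_discrete_measurable(1) that] by simp
  have U: "{\<omega> \<in> space M. Q (A \<omega>) (F (B \<omega>))} = (\<Union>c\<in>T. {\<omega> \<in> space M. Q (A \<omega>) c} \<inter> {\<omega> \<in> space M. F (B \<omega>) = c})"
    using F Bs by auto
  have ev: "{\<omega> \<in> space M. Q (A \<omega>) c} \<inter> {\<omega> \<in> space M. F (B \<omega>) = c} \<in> events" for c
    using indep_discrete_event(1)[of "\<lambda>a. Q a c"] indep_discrete_event(2)[of "\<lambda>b. F b = c"] by (rule sets.Int)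
  show "{\<omega> \<in> space M. Q (A \<omega>) (F (B \<omega>))} \<in> events"
    unfolding U using fin ev by (intro sets.finite_UN)
  have prod: "prob ({\<omega> \<in> space M. Q (A \<omega>) c} \<inter> {\<omega> \<in> space M. F (B \<omega>) = c})
     = prob {\<omega> \<in> space M. F (B \<omega>) = c} * prob {\<omega> \<in> space M. Q (A \<omega>) c}" for c
  proof -
    have "prob ((\<lambda>x. (A x, B x)) -` ({a \<in> S. Q a c} \<times> {b \<in> S'. F b = c}) \<inter> space M)
      = prob (A -` {a \<in> S. Q a c} \<inter> space M) * prob (B -` {b \<in> S'. F b = c} \<inter> space M)"
      by (rule indep_varD[OF AB]) auto
    moreover have "(\<lambda>x. (A x, B x)) -` ({a \<in> S. Q a c} \<times> {b \<in> S'. F b = c}) \<inter> space M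
      = {\<omega> \<in> space M. Q (A \<omega>) c} \<inter> {\<omega> \<in> space M. F (B \<omega>) = c}" using As Bs by auto
    moreover have "A -` {a \<in> S. Q a c} \<inter> space M = {\<omega> \<in> space M. Q (A \<omega>) c}" using As by auto
    moreover have "B -` {b \<in> S'. F b = c} \<inter> space M = {\<omega> \<in> space M. F (B \<omega>) = c}" using Bs by auto
    ultimately show ?thesis by simp
  qed
  show "prob {\<omega> \<in> space M. Q (A \<omega>) (F (B \<omega>))}
      = (\<Sum>c\<in>T. prob {\<omega> \<in> space M. F (B \<omega>) = c} * prob {\<omega> \<in> space M. Q (A \<omega>) c})"
    unfolding U prod[symmetric]
    by (rule finite_measure_finite_Union[OF fin]) (use ev in \<open>auto simp: disjoint_family_on_def\<close>)
  have "(\<Sum>c\<in>T. prob {\<omega> \<in> space M. F (B \<omega>) = c}) = prob (\<Union>c\<in>T. {\<omega> \<in> space M. F (B \<omega>) = c})"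
    using indep_discrete_event(2)
    by (intro finite_measure_finite_Union[OF fin, symmetric]) (auto simp: disjoint_family_on_def)
  also have "(\<Union>c\<in>T. {\<omega> \<in> space M. F (B \<omega>) = c}) = space M" using F Bs by auto
  finally show "(\<Sum>c\<in>T. prob {\<omega> \<in> space M. F (B \<omega>) = c}) = 1" by (simp add: prob_space)
qed

lemma indep_discrete_prob_le:
  assumes fin: "finite T" and F: "\<And>b. b \<in> S' \<Longrightarrow> F b \<in> T"
    and W: "\<And>c. c \<in> T \<Longrightarrow> prob {\<omega> \<in> space M. Q (A \<omega>) c} \<le> W"
  shows "prob {\<omega> \<in> space M. Q (A \<omega>) (F (B \<omega>))} \<le> W"
proof -
  have dis: "prob {\<omega> \<in> space M. Q (A \<omega>) (F (B \<omega>))}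
      = (\<Sum>c\<in>T. prob {\<omega> \<in> space M. F (B \<omega>) = c} * prob {\<omega> \<in> space M. Q (A \<omega>) c})"
    by (rule indep_discrete_disintegrate(2)[OF fin]) (rule F)
  have total: "(\<Sum>c\<in>T. prob {\<omega> \<in> space M. F (B \<omega>) = c}) = 1"
    by (rule indep_discrete_disintegrate(3)[OF fin]) (rule F)
  have "prob {\<omega> \<in> space M. Q (A \<omega>) (F (B \<omega>))} \<le> (\<Sum>c\<in>T. prob {\<omega> \<in> space M. F (B \<omega>) = c} * W)"
    unfolding dis by (intro sum_mono mult_left_mono W) auto
  also have "\<dots> = W"
    unfolding sum_distrib_right[symmetric] total by simp
  finally show ?thesis .
qed

text \<open>A value of \<open>F\<close> outside \<open>T'\<close> has probability 0 and contributes
  nothing, so a bound that is valid only for admissible shifts suffices.\<close>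

lemma indep_discrete_prob_ge:
  assumes fin: "finite T" and F: "\<And>b. b \<in> S' \<Longrightarrow> F b \<in> T"
    and good: "AE \<omega> in M. F (B \<omega>) \<in> T'"
    and V: "\<And>c. c \<in> T \<Longrightarrow> c \<in> T' \<Longrightarrow> V \<le> prob {\<omega> \<in> space M. Q (A \<omega>) c}"
  shows "V \<le> prob {\<omega> \<in> space M. Q (A \<omega>) (F (B \<omega>))}"
proof -
  have dis: "prob {\<omega> \<in> space M. Q (A \<omega>) (F (B \<omega>))}
      = (\<Sum>c\<in>T. prob {\<omega> \<in> space M. F (B \<omega>) = c} * prob {\<omega> \<in> space M. Q (A \<omega>) c})"
    by (rule indep_discrete_disintegrate(2)[OF fin]) (rule F)
  have total: "(\<Sum>c\<in>T. prob {\<omega> \<in> space M. F (B \<omega>) = c}) = 1"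
    by (rule indep_discrete_disintegrate(3)[OF fin]) (rule F)
  have "V = (\<Sum>c\<in>T. prob {\<omega> \<in> space M. F (B \<omega>) = c} * V)"
    unfolding sum_distrib_right[symmetric] total by simp
  also have "\<dots> \<le> (\<Sum>c\<in>T. prob {\<omega> \<in> space M. F (B \<omega>) = c} * prob {\<omega> \<in> space M. Q (A \<omega>) c})"
  proof (rule sum_mono)
    fix c assume c: "c \<in> T"
    show "prob {\<omega> \<in> space M. F (B \<omega>) = c} * V
      \<le> prob {\<omega> \<in> space M. F (B \<omega>) = c} * prob {\<omega> \<in> space M. Q (A \<omega>) c}"
    proof (cases "c \<in> T'")
      case True
      then show ?thesis using V c by (intro mult_left_mono) auto
    next
      case False
      have "prob {\<omega> \<in> space M. F (B \<omega>) = c} = 0"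
      proof (subst prob_eq_0[OF indep_discrete_event(2)])
        show "AE \<omega> in M. \<omega> \<notin> {\<omega> \<in> space M. F (B \<omega>) = c}"
          using good by eventually_elim (use False in auto)
      qed
      then show ?thesis by simp
    qed
  qed
  also have "\<dots> = prob {\<omega> \<in> space M. Q (A \<omega>) (F (B \<omega>))}"
    using dis by simp
  finally show ?thesis .
qed

end
end

subsection \<open>Random block matrices\<close>

lemma block_offset_Suc: "1 \<le> i \<Longrightarrow> block_offset n (Suc i) = block_offset n i + n i"
  by (simp add: block_offset_def)

lemma block_offset_mono: "1 \<le> i \<Longrightarrow> i \<le> i' \<Longrightarrow> block_offset n i \<le> block_offset n i'"
  unfolding block_offset_def by (intro sum_mono2) auto

lemma total_size_eq_offset: "total_size n k = block_offset n (Suc k)"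
  by (simp add: block_offset_def total_size_def atLeastLessThanSuc_atLeastAtMost)

text \<open>Offsets increase by the block sizes, which makes the map injective with values below the
  total size; surjectivity follows by comparing cardinalities.\<close>

lemma bij_betw_block_index:
  "bij_betw (\<lambda>(i, a). block_offset n i + a) (SIGMA i:{1..k}. {..<n i}) {..<total_size n k}"
proof -
  let ?e = "\<lambda>(i, a). block_offset n i + a" and ?S = "SIGMA i:{1..k}. {..<n i}"
  have less: "block_offset n i + a < block_offset n i' + a'" if "1 \<le> i" "i < i'" "a < n i" for i i' a a'
  proof -
    have "block_offset n i + a < block_offset n (Suc i)" using that by (simp add: block_offset_Suc)
    also have "\<dots> \<le> block_offset n i'" using that by (intro block_offset_mono) auto
    finally show ?thesis by simp
  qed
  have inj: "inj_on ?e ?S"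
  proof (rule inj_onI, clarify)
    fix i a i' a' assume *: "i \<in> {1..k}" "a < n i" "i' \<in> {1..k}" "a' < n i'"
      and eq: "block_offset n i + a = block_offset n i' + a'"
    have "i = i'" using less[of i i' a a'] less[of i' i a' a] * eq by (metis atLeastAtMost_iff linorder_cases less_irrefl)
    then show "i = i' \<and> a = a'" using eq by simp
  qed
  have sub: "?e ` ?S \<subseteq> {..<total_size n k}"
    using less[of _ "Suc k" _ 0] by (fastforce simp: total_size_eq_offset)
  have "card (?e ` ?S) = card {..<total_size n k}"
    using card_image[OF inj] by (simp add: total_size_def)
  then have "?e ` ?S = {..<total_size n k}" using sub by (intro card_subset_eq) auto
  then show ?thesis using inj by (simp add: bij_betw_def)
qed

text \<open>Both levels are restricted so that the splitting is a bijection between extensional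
  families.\<close>

definition blocks :: "(nat \<Rightarrow> nat) \<Rightarrow> nat \<Rightarrow> (nat \<Rightarrow> 'a) \<Rightarrow> nat \<Rightarrow> nat \<Rightarrow> 'a" where
  "blocks n k x = (\<lambda>i\<in>{1..k}. \<lambda>a\<in>{..<n i}. x (block_offset n i + a))"

lemma bij_betw_blocks:
  "bij_betw (blocks n k) (PiE {..<total_size n k} (\<lambda>_. S)) (PiE {1..k} (\<lambda>i. PiE {..<n i} (\<lambda>_. S)))"
proof -
  let ?e = "\<lambda>(i, a). block_offset n i + a" and ?I = "SIGMA i:{1..k}. {..<n i}"
  note e = bij_betw_block_index[of n k]
  define g where "g = inv_into ?I ?e"
  have g: "g (block_offset n i + a) = (i, a)" if "i \<in> {1..k}" "a < n i" for i a
    using bij_betw_inv_into_left[OF e, of "(i, a)"] that by (simp add: g_def)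
  have e_less: "block_offset n i + a < total_size n k" if "i \<in> {1..k}" "a < n i" for i a
    using bij_betwE[OF e] that by auto
  have e_ex: "\<exists>i a. i \<in> {1..k} \<and> a < n i \<and> s = block_offset n i + a" if "s < total_size n k" for s
  proof -
    have "s \<in> ?e ` ?I" using e that by (simp add: bij_betw_def)
    then show ?thesis by auto
  qed
  define join where "join y = restrict (\<lambda>s. y (fst (g s)) (snd (g s))) {..<total_size n k}" for y :: "nat \<Rightarrow> nat \<Rightarrow> 'a"
  show ?thesis
  proof (rule bij_betw_byWitness[where f' = join])
    show "\<forall>x\<in>PiE {..<total_size n k} (\<lambda>_. S). join (blocks n k x) = x"
    proof
      fix x assume x: "x \<in> PiE {..<total_size n k} (\<lambda>_. S)"
      show "join (blocks n k x) = x"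
      proof (rule extensionalityI[of _ "{..<total_size n k}"])
        fix s assume "s \<in> {..<total_size n k}"
        then obtain i a where "i \<in> {1..k}" "a < n i" "s = block_offset n i + a" using e_ex[of s] by blast
        then show "join (blocks n k x) s = x s"
          using g e_less by (simp add: join_def blocks_def)
      qed (use x in \<open>auto simp: join_def PiE_def\<close>)
    qed
    show "\<forall>y\<in>PiE {1..k} (\<lambda>i. PiE {..<n i} (\<lambda>_. S)). blocks n k (join y) = y"
    proof
      fix y assume y: "y \<in> PiE {1..k} (\<lambda>i. PiE {..<n i} (\<lambda>_. S))"
      show "blocks n k (join y) = y"
      proof (rule extensionalityI[of _ "{1..k}"])
        fix i assume i: "i \<in> {1..k}"
        then have "y i \<in> extensional {..<n i}" using y by (auto simp: PiE_def Pi_def)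
        then show "blocks n k (join y) i = y i"
          using i g e_less
          by (intro extensionalityI[of _ "{..<n i}"]) (auto simp: blocks_def join_def)
      qed (use y in \<open>auto simp: blocks_def PiE_def\<close>)
    qed
    show "blocks n k ` PiE {..<total_size n k} (\<lambda>_. S) \<subseteq> PiE {1..k} (\<lambda>i. PiE {..<n i} (\<lambda>_. S))"
      using e_less by (auto simp: blocks_def PiE_def Pi_def)
    show "join ` PiE {1..k} (\<lambda>i. PiE {..<n i} (\<lambda>_. S)) \<subseteq> PiE {..<total_size n k} (\<lambda>_. S)"
    proof (intro subsetI, elim imageE)
      fix x y assume y: "y \<in> PiE {1..k} (\<lambda>i. PiE {..<n i} (\<lambda>_. S))" and x: "x = join y"
      have "x s \<in> S" if "s < total_size n k" for s
        using e_ex[OF that] y g by (auto simp: x join_def that PiE_def Pi_def)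
      then show "x \<in> PiE {..<total_size n k} (\<lambda>_. S)" by (auto simp: x join_def)
    qed
  qed
qed

section \<open>The rows of one random block matrix\<close>

locale random_block_matrices = prob_space M + comm_group G
  for M :: "'w measure" and G (structure) +
  fixes A B :: "'w \<Rightarrow> int mat" and n :: "nat \<Rightarrow> nat" and k :: nat and \<epsilon> :: real
  assumes finite_carrier: "finite (carrier G)"
    and eps_pos: "0 < \<epsilon>" and eps_le_1: "\<epsilon> \<le> 1"
    and indep_AB: "indep_var (count_space (carrier_mat (total_size n k) (total_size n k))) A
      (count_space (carrier_mat (total_size n k) (total_size n k))) B"
    and A_zero: "i \<in> {1..k} \<Longrightarrow> j \<in> {1..k} \<Longrightarrow> j \<notin> {i - 1, i} \<Longrightarrow>
        AE \<omega> in M. block n i j (A \<omega>) = 0\<^sub>m (n i) (n j)"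
    and A_indep: "indep_vars (\<lambda>(i, j). count_space (carrier_mat (n i) (n j)))
        (\<lambda>(i, j) \<omega>. block n i j (A \<omega>)) (bidiagonal_positions k)"
    and A_balanced: "(i, j) \<in> bidiagonal_positions k \<Longrightarrow>
        balanced_matrix M (prime_factors (order G)) \<epsilon> (n i) (n j) (\<lambda>\<omega>. block n i j (A \<omega>))"
    and B_zero: "i \<in> {1..k} \<Longrightarrow> j \<in> {1..k} \<Longrightarrow> j \<ge> i - 1 \<Longrightarrow>
        AE \<omega> in M. block n i j (B \<omega>) = 0\<^sub>m (n i) (n j)"
begin

abbreviation "row_index \<equiv> SIGMA i:{1..k}. {..<n i}"

definition entries :: "((nat \<times> nat) \<times> (nat \<times> nat)) set" where
  "entries = Sigma (bidiagonal_positions k) (\<lambda>(i, j). {..<n i} \<times> {..<n j})"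

definition entry :: "(nat \<times> nat) \<times> (nat \<times> nat) \<Rightarrow> 'w \<Rightarrow> int" where
  "entry = (\<lambda>((i, j), (a, b)) \<omega>. A \<omega> $$ (block_offset n i + a, block_offset n j + b))"

lemma finite_bidiagonal: "finite (bidiagonal_positions k)"
  by (rule finite_subset[of _ "{1..k} \<times> {..k}"]) (auto simp: bidiagonal_positions_def)

lemma finite_entries: "finite entries"
  unfolding entries_def by (rule finite_SigmaI[OF finite_bidiagonal]) auto

lemma entry_indep: "indep_vars (\<lambda>_. count_space UNIV) entry entries"
proof -
  have "indep_vars (\<lambda>_. count_space UNIV)
     (\<lambda>(p, q) \<omega>. (\<lambda>(a, b). \<lambda>z. z $$ (a, b)) q ((\<lambda>(i, j) \<omega>. block n i j (A \<omega>)) p \<omega>)) entries"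
    unfolding entries_def
  proof (rule indep_vars_Sigma[OF finite_bidiagonal _ A_indep])
    fix p assume p: "p \<in> bidiagonal_positions k"
    obtain i j where ij: "p = (i, j)" by (cases p)
    have "indep_vars (\<lambda>_. count_space UNIV) (\<lambda>(a, b) \<omega>. block n i j (A \<omega>) $$ (a, b)) ({..<n i} \<times> {..<n j})"
      using A_balanced[of i j] p ij by (simp add: balanced_matrix_def)
    moreover have "(\<lambda>q \<omega>. (case q of (a, b) \<Rightarrow> \<lambda>z. z $$ (a, b)) ((case p of (i, j) \<Rightarrow> \<lambda>\<omega>. block n i j (A \<omega>)) \<omega>))
      = (\<lambda>(a, b) \<omega>. block n i j (A \<omega>) $$ (a, b))"
      by (auto simp: ij fun_eq_iff)
    ultimately show "indep_vars (\<lambda>_. count_space UNIV)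
      (\<lambda>q \<omega>. (case q of (a, b) \<Rightarrow> \<lambda>z. z $$ (a, b)) ((case p of (i, j) \<Rightarrow> \<lambda>\<omega>. block n i j (A \<omega>)) \<omega>))
      (case p of (i, j) \<Rightarrow> {..<n i} \<times> {..<n j})" by (simp add: ij)
  qed auto
  then show ?thesis
    by (rule indep_vars_cong[THEN iffD1, rotated -1])
       (auto simp: entry_def entries_def block_def fun_eq_iff)
qed

lemma entry_balanced: "d \<in> entries \<Longrightarrow> balanced M (prime_factors (order G)) \<epsilon> (entry d)"
proof -
  assume d: "d \<in> entries"
  obtain i j a b where d_eq: "d = ((i, j), (a, b))" by (metis prod.exhaust)
  then have *: "(i, j) \<in> bidiagonal_positions k" "a < n i" "b < n j" using d by (auto simp: entries_def)
  then have "balanced M (prime_factors (order G)) \<epsilon> (\<lambda>\<omega>. block n i j (A \<omega>) $$ (a, b))"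
    using A_balanced by (auto simp: balanced_matrix_def)
  moreover have "(\<lambda>\<omega>. block n i j (A \<omega>) $$ (a, b)) = entry d"
    using * by (auto simp: entry_def block_def d_eq)
  ultimately show ?thesis by simp
qed

definition row_entries :: "nat \<times> nat \<Rightarrow> ((nat \<times> nat) \<times> (nat \<times> nat)) set" where
  "row_entries = (\<lambda>(i, a). {d \<in> entries. fst (fst d) = i \<and> fst (snd d) = a})"

definition coeff :: "(nat \<Rightarrow> nat \<Rightarrow> 'a) \<Rightarrow> (nat \<times> nat) \<times> (nat \<times> nat) \<Rightarrow> 'a" where
  "coeff y = (\<lambda>((i, j), (a, b)). y j b)"

abbreviation "families \<equiv> PiE {1..k} (\<lambda>i. vectors (n i))"

lemma row_entries_subset: "row_entries \<rho> \<subseteq> entries"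
  by (auto simp: row_entries_def)

lemma finite_row_entries: "finite (row_entries \<rho>)"
  using row_entries_subset finite_entries by (rule finite_subset)

lemma family_closed: "y \<in> families \<Longrightarrow> i \<in> {1..k} \<Longrightarrow> a < n i \<Longrightarrow> y i a \<in> carrier G"
  by (auto simp: PiE_def Pi_def)

lemma row_balanced_combination:
  assumes y: "y \<in> families"
  shows "balanced_combination M G entry (coeff y) (row_entries \<rho>) \<epsilon>"
proof unfold_locales
  fix d assume d: "d \<in> row_entries \<rho>"
  then have "d \<in> entries" using row_entries_subset by blast
  then show "balanced M (prime_factors (order G)) \<epsilon> (entry d)" by (rule entry_balanced)
  show "coeff y d \<in> carrier G"
  proof -
    obtain i j a b where d_eq: "d = ((i, j), (a, b))" by (metis prod.exhaust)
    have "j \<in> {1..k}" "b < n j"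
      using \<open>d \<in> entries\<close> by (auto simp: d_eq entries_def bidiagonal_positions_def)
    then show ?thesis using family_closed[OF y] by (simp add: d_eq coeff_def)
  qed
next
  show "indep_vars (\<lambda>_. count_space UNIV) entry (row_entries \<rho>)"
    using entry_indep row_entries_subset by (rule indep_vars_subset)
qed (use finite_carrier finite_row_entries eps_pos eps_le_1 in auto)

text \<open>The random entries of block row \<open>i\<close> meet only the values of
  \<open>y (i - 1)\<close> and \<open>y i\<close>. A subgroup contains the former exactly when it
  contains their span, so the past enters only through \<open>span_before\<close>; for
  \<open>i = 1\<close> that is the trivial subgroup and imposes nothing.\<close>

lemma coeff_image:
  assumes y: "y \<in> families" and \<rho>: "i \<in> {1..k}" "a < n i" and R: "subgroup R G"
  shows "coeff y ` row_entries (i, a) \<subseteq> R \<longleftrightarrow> span_before n y i \<union> y i ` {..<n i} \<subseteq> R"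
proof -
  have *: "row_entries (i, a) = (\<Union>j\<in>{j. j \<in> {i - 1, i} \<and> 1 \<le> j}. (\<lambda>b. ((i, j), (a, b))) ` {..<n j})"
    using \<rho> by (auto simp: row_entries_def entries_def bidiagonal_positions_def)
  have "coeff y ` row_entries (i, a) = (\<Union>j\<in>{j. j \<in> {i - 1, i} \<and> 1 \<le> j}. y j ` {..<n j})"
    unfolding * by (simp add: image_UN image_image coeff_def)
  also have "\<dots> = (if i = 1 then {} else y (i - 1) ` {..<n (i - 1)}) \<union> y i ` {..<n i}"
    using \<rho>(1) by auto
  finally have eq: "coeff y ` row_entries (i, a) = (if i = 1 then {} else y (i - 1) ` {..<n (i - 1)}) \<union> y i ` {..<n i}" .
  show ?thesis
    unfolding eq using \<rho>(1) span_subset_iff[OF R, of "{..<n (i - 1)}" "y (i - 1)"] subgroup.one_closed[OF R]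
    by (auto simp: state_before_def)
qed

definition row_value :: "(nat \<Rightarrow> nat \<Rightarrow> 'a) \<Rightarrow> nat \<times> nat \<Rightarrow> 'w \<Rightarrow> 'a" where
  "row_value y \<rho> \<omega> = (\<Otimes>d\<in>row_entries \<rho>. coeff y d [^] entry d \<omega>)"

text \<open>The contraction factor of every row. It depends on \<open>G\<close> and \<epsilon>
  alone, neither on the row nor on the vector or the block sizes.\<close>

definition rate :: real where "rate = 1 - (\<epsilon> / order G) ^ (order G)\<^sup>2"

lemma rate_bounds: "0 \<le> rate" "rate < 1"
proof -
  have "0 < order G" using finite_carrier order_gt_0_iff_finite by blast
  then have "0 < \<epsilon> / order G" "\<epsilon> / order G \<le> 1" using eps_pos eps_le_1 by (auto simp: divide_le_eq)
  then show "0 \<le> rate" "rate < 1" by (auto simp: rate_def power_le_one)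
qed

context
  fixes y i a and L :: nat assumes y: "y \<in> families" and i: "i \<in> {1..k}" and a: "a < n i"
begin

interpretation row: balanced_combination M G entry "coeff y" "row_entries (i, a)" \<epsilon>
  using y by (rule row_balanced_combination)

lemma row_law: "prob {\<omega> \<in> space M. row_value y (i, a) \<omega> = c} = row.law (row_entries (i, a)) c"
  by (simp add: row.law_def row.comb_def row_value_def)

lemma row_contraction: "row.contraction = rate"
  by (simp add: row.contraction_def row.atom_bound_def rate_def)

text \<open>The diagonal block alone supplies the repetitions: its column \<open>b\<close> carries
  the coefficient \<open>y i b\<close>.\<close>

lemma row_repetitions:
  "\<forall>s\<in>{s \<in> carrier G. L * order G \<le> card {b\<in>{..<n i}. y i b = s}}.
     L * order G \<le> card {d\<in>row_entries (i, a). coeff y d = s}"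
proof
  fix s assume s: "s \<in> {s \<in> carrier G. L * order G \<le> card {b\<in>{..<n i}. y i b = s}}"
  have "card {b\<in>{..<n i}. y i b = s} \<le> card {d\<in>row_entries (i, a). coeff y d = s}"
  proof (rule card_inj_on_le[of "\<lambda>b. ((i, i), (a, b))"])
    show "(\<lambda>b. ((i, i), (a, b))) ` {b\<in>{..<n i}. y i b = s} \<subseteq> {d\<in>row_entries (i, a). coeff y d = s}"
      using i a by (auto simp: row_entries_def entries_def bidiagonal_positions_def coeff_def)
  qed (auto simp: inj_on_def finite_row_entries)
  then show "L * order G \<le> card {d\<in>row_entries (i, a). coeff y d = s}" using s by simp
qed

lemma prob_row_le:
  assumes "c \<in> carrier G"
  shows "prob {\<omega> \<in> space M. row_value y (i, a) \<omega> = c}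
    \<le> (1 / card (robust_span L {..<n i} (y i)) + rate ^ L)
      * (if span_before n y i \<union> y i ` {..<n i} \<subseteq> robust_span L {..<n i} (y i) then 1 else 1 - \<epsilon>)"
  unfolding row_law coeff_image[OF y i a subgroup_robust_span, symmetric]
  using row.law_upper[OF _ robust_span_def row_repetitions assms, folded robust_span_def]
  by (simp add: row_contraction)

lemma prob_row_ge:
  assumes "span_before n y i \<union> y i ` {..<n i} \<subseteq> robust_span L {..<n i} (y i)"
    and c: "c \<in> robust_span L {..<n i} (y i)"
  shows "1 / card (robust_span L {..<n i} (y i)) - rate ^ L
    \<le> prob {\<omega> \<in> space M. row_value y (i, a) \<omega> = c}"
proof -
  have "coeff y ` row_entries (i, a) \<subseteq> robust_span L {..<n i} (y i)"
    using assms(1) coeff_image[OF y i a subgroup_robust_span] by blast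
  then have "\<bar>row.law (row_entries (i, a)) c - 1 / card (robust_span L {..<n i} (y i))\<bar> \<le> rate ^ L"
    using row.law_equidistributed[OF _ robust_span_def order_refl _ row_repetitions c]
    by (simp add: row_contraction)
  then show ?thesis unfolding row_law by linarith
qed

end

text \<open>Distinct rows use disjoint sets of the independent entries.\<close>

lemma prob_all_rows:
  assumes y: "y \<in> families"
  shows "prob {\<omega> \<in> space M. \<forall>\<rho>\<in>row_index. row_value y \<rho> \<omega> = c \<rho>}
    = (\<Prod>i\<in>{1..k}. \<Prod>a<n i. prob {\<omega> \<in> space M. row_value y (i, a) \<omega> = c (i, a)})"
proof -
  let ?V = "\<lambda>\<rho> z. \<Otimes>d\<in>row_entries \<rho>. coeff y d [^] (z d :: int)"
  have rv: "row_value y \<rho> \<omega> = ?V \<rho> (restrict (\<lambda>d. entry d \<omega>) (row_entries \<rho>))" for \<rho> \<omega>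
    unfolding row_value_def
    using balanced_combination.coeff_carrier[OF row_balanced_combination[OF y]]
    by (intro finprod_cong') auto
  have "prob {\<omega> \<in> space M. \<forall>\<rho>\<in>row_index. row_value y \<rho> \<omega> = c \<rho>}
     = (\<Prod>\<rho>\<in>row_index. prob {\<omega> \<in> space M. row_value y \<rho> \<omega> = c \<rho>})"
    unfolding rv
    by (rule indep_prob_all[OF entry_indep finite_entries _ row_entries_subset, where Q = "\<lambda>\<rho> z. ?V \<rho> z = c \<rho>"])
       (auto simp: disjoint_family_on_def row_entries_def)
  also have "\<dots> = (\<Prod>i\<in>{1..k}. \<Prod>a<n i. prob {\<omega> \<in> space M. row_value y (i, a) \<omega> = c (i, a)})"
    by (subst prod.Sigma) auto
  finally show ?thesis .
qed

end

section \<open>The probability that a given vector is a solution\<close>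

context random_block_matrices
begin

text \<open>The product runs over all columns, so that it applies to \<open>B\<close> too. For
  \<open>A\<close> it agrees with \<open>row_value\<close> almost surely, since the blocks left out
  there vanish almost surely.\<close>

definition row_prod :: "(nat \<Rightarrow> nat \<Rightarrow> 'a) \<Rightarrow> nat \<times> nat \<Rightarrow> int mat \<Rightarrow> 'a" where
  "row_prod y \<rho> C = finprod G (\<lambda>(j, b).
     y j b [^] (C $$ (block_offset n (fst \<rho>) + snd \<rho>, block_offset n j + b))) row_index"

lemma family_pow_closed:
  fixes f :: "nat \<Rightarrow> nat \<Rightarrow> int"
  assumes y: "y \<in> families"
  shows "(\<lambda>(j, b). y j b [^] f j b) \<in> row_index \<rightarrow> carrier G"
proof
  fix p assume "p \<in> row_index"
  then obtain j b where "p = (j, b)" "j \<in> {1..k}" "b < n j" by blast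
  then show "(case p of (j, b) \<Rightarrow> y j b [^] f j b) \<in> carrier G"
    using family_closed[OF y] by (simp add: int_pow_closed)
qed

lemma subgroup_span_family:
  assumes "y \<in> families" "i \<in> {1..k}"
  shows "subgroup (span {..<n i} (y i)) G"
  by (intro subgroup_span funcsetI) (use family_closed[OF assms] in simp)

lemma row_prod_closed: "y \<in> families \<Longrightarrow> row_prod y \<rho> C \<in> carrier G"
  unfolding row_prod_def by (intro finprod_closed family_pow_closed)

lemma zero_blocks_AE:
  assumes "\<And>i j. i \<in> {1..k} \<Longrightarrow> j \<in> {1..k} \<Longrightarrow> Q i j \<Longrightarrow> AE \<omega> in M. block n i j (C \<omega>) = 0\<^sub>m (n i) (n j)"
  shows "AE \<omega> in M. \<forall>i\<in>{1..k}. \<forall>j\<in>{1..k}. Q i j \<longrightarrow>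
    (\<forall>a<n i. \<forall>b<n j. C \<omega> $$ (block_offset n i + a, block_offset n j + b) = (0::int))"
proof -
  have "AE \<omega> in M. Q i j \<longrightarrow> (\<forall>a<n i. \<forall>b<n j. C \<omega> $$ (block_offset n i + a, block_offset n j + b) = (0::int))"
    if ij: "i \<in> {1..k}" "j \<in> {1..k}" for i j
  proof (cases "Q i j")
    case True
    show ?thesis
      using assms[OF ij True]
    proof eventually_elim
      case (elim \<omega>)
      have "block n i j (C \<omega>) $$ (a, b) = C \<omega> $$ (block_offset n i + a, block_offset n j + b)"
        if "a < n i" "b < n j" for a b using that by (simp add: block_def)
      then show ?case unfolding elim by simp
    qed
  qed simp
  then show ?thesis by (simp add: AE_ball_countable)
qed

lemma A_entries_zero_AE:
  "AE \<omega> in M. \<forall>i\<in>{1..k}. \<forall>j\<in>{1..k}. j \<notin> {i - 1, i} \<longrightarrow>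
    (\<forall>a<n i. \<forall>b<n j. A \<omega> $$ (block_offset n i + a, block_offset n j + b) = 0)"
  by (rule zero_blocks_AE) (rule A_zero)

lemma B_entries_zero_AE:
  "AE \<omega> in M. \<forall>i\<in>{1..k}. \<forall>j\<in>{1..k}. j \<ge> i - 1 \<longrightarrow>
    (\<forall>a<n i. \<forall>b<n j. B \<omega> $$ (block_offset n i + a, block_offset n j + b) = 0)"
  by (rule zero_blocks_AE) (rule B_zero)

lemma row_prod_A_AE:
  assumes y: "y \<in> families"
  shows "AE \<omega> in M. \<forall>\<rho>\<in>row_index. row_prod y \<rho> (A \<omega>) = row_value y \<rho> \<omega>"
  using A_entries_zero_AE
proof eventually_elim
  case (elim \<omega>)
  show ?case
  proof
    fix \<rho> assume "\<rho> \<in> row_index"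
    then obtain i a where \<rho>: "\<rho> = (i, a)" "i \<in> {1..k}" "a < n i" by auto
    let ?J = "{(j, b) \<in> row_index. j \<in> {i - 1, i}}"
    have eq: "row_entries \<rho> = (\<lambda>(j, b). ((i, j), (a, b))) ` ?J"
      using \<rho> by (auto simp: row_entries_def entries_def bidiagonal_positions_def image_iff)
    let ?f = "\<lambda>(j, b). y j b [^] (A \<omega> $$ (block_offset n i + a, block_offset n j + b))"
    let ?h = "\<lambda>(j, b). ((i, j), (a, b))"
    have f: "?f \<in> row_index \<rightarrow> carrier G" by (rule family_pow_closed[OF y])
    have fh: "coeff y (?h p) [^] entry (?h p) \<omega> = ?f p" for p
      by (cases p) (simp add: coeff_def entry_def)
    have "row_value y \<rho> \<omega> = finprod G (\<lambda>p. coeff y (?h p) [^] entry (?h p) \<omega>) ?J"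
      unfolding row_value_def eq
    proof (rule finprod_reindex)
      show "(\<lambda>d. coeff y d [^] entry d \<omega>) \<in> ?h ` ?J \<rightarrow> carrier G"
      proof
        fix d assume "d \<in> ?h ` ?J"
        then obtain p where "p \<in> row_index" "d = ?h p" by blast
        then show "coeff y d [^] entry d \<omega> \<in> carrier G" using f by (simp only: fh) blast
      qed
    qed (auto simp: inj_on_def)
    also have "\<dots> = finprod G ?f ?J" by (simp only: fh)
    also have "\<dots> = row_prod y \<rho> (A \<omega>)"
      unfolding row_prod_def \<rho> fst_conv snd_conv
    proof (rule finprod_mono_neutral_cong_left[OF _ _ _ _ f])
      fix p assume "p \<in> row_index - ?J"
      moreover obtain j b where "p = (j, b)" by (cases p)
      ultimately have "p = (j, b)" "j \<in> {1..k}" "b < n j" "j \<notin> {i - 1, i}" by simp_all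
      then show "?f p = \<one>" using elim \<rho> by simp
    qed auto
    finally show "row_prod y \<rho> (A \<omega>) = row_value y \<rho> \<omega>" by simp
  qed
qed

text \<open>Block row \<open>i\<close> of \<open>B\<close> meets only blocks
  \<open>j < i - 1\<close>, whose spans lie in that of block \<open>i\<close>. So the shift caused
  by \<open>B\<close> stays in the subgroup on which the row of \<open>A\<close> is to be
  equidistributed.\<close>

lemma row_prod_B_AE:
  assumes y: "y \<in> families" and mono: "\<And>i j. i \<in> {1..k} \<Longrightarrow> j \<in> {1..i} \<Longrightarrow> span {..<n j} (y j) \<subseteq> span {..<n i} (y i)"
  shows "AE \<omega> in M. \<forall>(i, a)\<in>row_index. row_prod y (i, a) (B \<omega>) \<in> span {..<n i} (y i)"
  using B_entries_zero_AE
proof eventually_elim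
  case (elim \<omega>)
  show ?case
  proof
    fix \<rho> assume "\<rho> \<in> row_index"
    then obtain i a where \<rho>: "\<rho> = (i, a)" and i: "i \<in> {1..k}" and a: "a < n i" by blast
    have sub: "subgroup (span {..<n i} (y i)) G"
      using y i by (rule subgroup_span_family)
    have "row_prod y (i, a) (B \<omega>) \<in> span {..<n i} (y i)"
      unfolding row_prod_def
    proof (rule finprod_in_subgroup[OF sub])
      fix p assume "p \<in> row_index"
      then obtain j b where p: "p = (j, b)" "j \<in> {1..k}" "b < n j" by blast
      have "y j b [^] (B \<omega> $$ (block_offset n i + a, block_offset n j + b)) \<in> span {..<n i} (y i)"
      proof (cases "j \<ge> i - 1")
        case True
        then show ?thesis using elim i a p subgroup.one_closed[OF sub] by simp
      next
        case False
        have "y j b \<in> span {..<n j} (y j)" unfolding span_def using p(3) by (intro generate.incl) simp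
        moreover have "j \<in> {1..i}" using False p(2) by simp
        ultimately have "y j b \<in> span {..<n i} (y i)" using mono[OF i] by blast
        with sub show ?thesis by (rule subgroup_int_pow_closed)
      qed
      then show "(case p of (j, b) \<Rightarrow> y j b [^] (B \<omega> $$ (block_offset n (fst (i, a)) + snd (i, a), block_offset n j + b)))
        \<in> span {..<n i} (y i)" by (simp add: p)
    qed auto
    then show "case \<rho> of (i, a) \<Rightarrow> row_prod y (i, a) (B \<omega>) \<in> span {..<n i} (y i)" by (simp add: \<rho>)
  qed
qed

definition solution_prob :: "(nat \<Rightarrow> nat \<Rightarrow> 'a) \<Rightarrow> real" where
  "solution_prob y = prob {\<omega> \<in> space M. \<forall>\<rho>\<in>row_index. row_prod y \<rho> (A \<omega>) \<otimes> row_prod y \<rho> (B \<omega>) = \<one>}"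

lemma row_value_event:
  assumes y: "y \<in> families"
  shows "{\<omega> \<in> space M. row_value y \<rho> \<omega> = c} \<in> events"
  using balanced_combination.comb_event[OF row_balanced_combination[OF y, of \<rho>] order_refl, where Q = "\<lambda>v. v = c"]
  unfolding row_value_def balanced_combination.comb_def[OF row_balanced_combination[OF y]] .

lemma prob_shifted_rows:
  assumes y: "y \<in> families" and c: "c \<in> row_index \<rightarrow> carrier G"
  shows "prob {\<omega> \<in> space M. \<forall>\<rho>\<in>row_index. row_prod y \<rho> (A \<omega>) \<otimes> c \<rho> = \<one>}
    = (\<Prod>i\<in>{1..k}. \<Prod>a<n i. prob {\<omega> \<in> space M. row_value y (i, a) \<omega> = inv (c (i, a))})"
proof -
  have "prob {\<omega> \<in> space M. \<forall>\<rho>\<in>row_index. row_prod y \<rho> (A \<omega>) \<otimes> c \<rho> = \<one>}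
    = prob {\<omega> \<in> space M. \<forall>\<rho>\<in>row_index. row_value y \<rho> \<omega> = inv (c \<rho>)}"
  proof (rule measure_eq_AE)
    show "AE \<omega> in M. (\<omega> \<in> {\<omega> \<in> space M. \<forall>\<rho>\<in>row_index. row_prod y \<rho> (A \<omega>) \<otimes> c \<rho> = \<one>})
      \<longleftrightarrow> (\<omega> \<in> {\<omega> \<in> space M. \<forall>\<rho>\<in>row_index. row_value y \<rho> \<omega> = inv (c \<rho>)})"
      using row_prod_A_AE[OF y]
    proof eventually_elim
      case (elim \<omega>)
      have "row_prod y \<rho> (A \<omega>) \<otimes> c \<rho> = \<one> \<longleftrightarrow> row_value y \<rho> \<omega> = inv (c \<rho>)" if "\<rho> \<in> row_index" for \<rho>
      proof -
        have "row_prod y \<rho> (A \<omega>) = row_value y \<rho> \<omega>" using elim that by blast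
        moreover have "row_prod y \<rho> (A \<omega>) \<in> carrier G" "c \<rho> \<in> carrier G"
          using row_prod_closed[OF y] c that by auto
        ultimately show ?thesis by (metis inv_equality inv_inv l_inv)
      qed
      then show ?case by auto
    qed
    show "{\<omega> \<in> space M. \<forall>\<rho>\<in>row_index. row_prod y \<rho> (A \<omega>) \<otimes> c \<rho> = \<one>} \<in> events"
      by (rule indep_discrete_event(1)[OF indep_AB])
    show "{\<omega> \<in> space M. \<forall>\<rho>\<in>row_index. row_value y \<rho> \<omega> = inv (c \<rho>)} \<in> events"
      by (intro sets.sets_Collect_finite_All row_value_event y) auto
  qed
  then show ?thesis unfolding prob_all_rows[OF y] .
qed

lemma row_prods_closed:
  "y \<in> families \<Longrightarrow> (\<lambda>\<rho>\<in>row_index. row_prod y \<rho> b) \<in> PiE row_index (\<lambda>_. carrier G)"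
  using row_prod_closed by auto

text \<open>The restriction makes the contribution of \<open>B\<close> an element of a finite set of
  families, over which the probability can be disintegrated.\<close>

lemma solution_prob_eq:
  "solution_prob y = prob {\<omega> \<in> space M. \<forall>\<rho>\<in>row_index.
     row_prod y \<rho> (A \<omega>) \<otimes> (\<lambda>\<rho>\<in>row_index. row_prod y \<rho> (B \<omega>)) \<rho> = \<one>}"
  unfolding solution_prob_def by (intro arg_cong[where f = prob]) auto

text \<open>The bound for a row is the same for every target value, so it survives averaging over
  the shift by \<open>B\<close>.\<close>

lemma solution_prob_le:
  assumes y: "y \<in> families" and \<kappa>: "rate \<le> \<kappa>"
  shows "solution_prob y \<le> (\<Prod>i\<in>{1..k}. weight (1 - \<epsilon>) (\<kappa> ^ L i) (L i) (n i) (span_before n y i) (y i))"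
  unfolding solution_prob_eq
proof (rule indep_discrete_prob_le[OF indep_AB, where T = "PiE row_index (\<lambda>_. carrier G)"])
  show "finite (PiE row_index (\<lambda>_. carrier G))" using finite_carrier by (intro finite_PiE) auto
  show "(\<lambda>\<rho>\<in>row_index. row_prod y \<rho> b) \<in> PiE row_index (\<lambda>_. carrier G)" for b
    using y by (rule row_prods_closed)
  fix c assume "c \<in> PiE row_index (\<lambda>_. carrier G)"
  then have c: "c \<in> row_index \<rightarrow> carrier G" by auto
  show "prob {\<omega> \<in> space M. \<forall>\<rho>\<in>row_index. row_prod y \<rho> (A \<omega>) \<otimes> c \<rho> = \<one>}
    \<le> (\<Prod>i\<in>{1..k}. weight (1 - \<epsilon>) (\<kappa> ^ L i) (L i) (n i) (span_before n y i) (y i))"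
    unfolding prob_shifted_rows[OF y c]
  proof (rule prod_mono, rule conjI)
    fix i assume i: "i \<in> {1..k}"
    let ?R = "robust_span (L i) {..<n i} (y i)"
    let ?w = "(1 / card ?R + \<kappa> ^ L i) * (if span_before n y i \<union> y i ` {..<n i} \<subseteq> ?R then 1 else 1 - \<epsilon>)"
    show "0 \<le> (\<Prod>a<n i. prob {\<omega> \<in> space M. row_value y (i, a) \<omega> = inv (c (i, a))})"
      by (intro prod_nonneg) auto
    have "(\<Prod>a<n i. prob {\<omega> \<in> space M. row_value y (i, a) \<omega> = inv (c (i, a))}) \<le> (\<Prod>a<n i. ?w)"
    proof (rule prod_mono, rule conjI)
      fix a assume "a \<in> {..<n i}"
      then have a: "a < n i" by simp
      have "inv (c (i, a)) \<in> carrier G" using c i a by (auto simp: Pi_iff)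
      then have "prob {\<omega> \<in> space M. row_value y (i, a) \<omega> = inv (c (i, a))}
        \<le> (1 / card ?R + rate ^ L i) * (if span_before n y i \<union> y i ` {..<n i} \<subseteq> ?R then 1 else 1 - \<epsilon>)"
        by (rule prob_row_le[OF y i a])
      also have "\<dots> \<le> ?w"
        using \<kappa> rate_bounds eps_le_1 by (intro mult_right_mono add_left_mono power_mono) auto
      finally show "prob {\<omega> \<in> space M. row_value y (i, a) \<omega> = inv (c (i, a))} \<le> ?w" .
    qed simp
    also have "\<dots> = weight (1 - \<epsilon>) (\<kappa> ^ L i) (L i) (n i) (span_before n y i) (y i)"
      by (simp add: weight_def)
    finally show "(\<Prod>a<n i. prob {\<omega> \<in> space M. row_value y (i, a) \<omega> = inv (c (i, a))})
      \<le> weight (1 - \<epsilon>) (\<kappa> ^ L i) (L i) (n i) (span_before n y i) (y i)" .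
  qed
qed

text \<open>The lower counterpart of \<open>weight\<close>: a vector that is not robust, or whose
  span does not contain the preceding one, gets 0, so that no probability has to be estimated for
  it.\<close>

definition robust_weight :: "real \<Rightarrow> nat \<Rightarrow> nat \<Rightarrow> 'a set \<Rightarrow> (nat \<Rightarrow> 'a) \<Rightarrow> real" where
  "robust_weight \<rho> L m H v =
    (if H \<subseteq> span {..<m} v \<and> robust_span L {..<m} v = span {..<m} v
     then (1 / card (span {..<m} v) - \<rho>) ^ m else 0)"

text \<open>If a block fails, the product is 0. Otherwise the spans increase, hence the shifts by
  \<open>B\<close> stay inside them almost surely, and each row equation has its target in the
  subgroup on which the row is nearly uniform.\<close>

lemma solution_prob_ge:
  assumes y: "y \<in> families" and \<kappa>: "rate \<le> \<kappa>"
    and small: "\<And>i. i \<in> {1..k} \<Longrightarrow> \<kappa> ^ L i \<le> 1 / card (span {..<n i} (y i))"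
  shows "(\<Prod>i\<in>{1..k}. robust_weight (\<kappa> ^ L i) (L i) (n i) (span_before n y i) (y i)) \<le> solution_prob y"
proof (cases "\<forall>i\<in>{1..k}. span_before n y i \<subseteq> span {..<n i} (y i) \<and> robust_span (L i) {..<n i} (y i) = span {..<n i} (y i)")
  case False
  then obtain i where i: "i \<in> {1..k}" "\<not> (span_before n y i \<subseteq> span {..<n i} (y i) \<and> robust_span (L i) {..<n i} (y i) = span {..<n i} (y i))"
    by blast
  then have "robust_weight (\<kappa> ^ L i) (L i) (n i) (span_before n y i) (y i) = 0"
    unfolding robust_weight_def by (intro if_not_P)
  then have "(\<Prod>i\<in>{1..k}. robust_weight (\<kappa> ^ L i) (L i) (n i) (span_before n y i) (y i)) = 0"
    using i(1) by (intro prod_zero) auto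
  moreover have "0 \<le> solution_prob y" by (simp add: solution_prob_def)
  ultimately show ?thesis by (simp only:)
next
  case True
  let ?K = "\<lambda>i. span {..<n i} (y i)"
  have sub: "subgroup (?K i) G" if "i \<in> {1..k}" for i
    using y that by (rule subgroup_span_family)
  have mono: "?K j \<subseteq> ?K i" if "i \<in> {1..k}" "j \<in> {1..i}" for i j
    using that
  proof (induction i)
    case (Suc i)
    show ?case
    proof (cases "j = Suc i")
      case False
      then have "?K j \<subseteq> ?K i" using Suc by auto
      also have "?K i \<subseteq> ?K (Suc i)"
      proof -
        have "span_before n y (Suc i) = ?K i" using Suc.prems False by (simp add: state_before_def)
        then show ?thesis using True Suc.prems(1) by blast
      qed
      finally show ?thesis .
    qed simp
  qed simp
  define T' where "T' = {c. \<forall>(i, a)\<in>row_index. c (i, a) \<in> ?K i}"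
  show ?thesis
    unfolding solution_prob_eq
  proof (rule indep_discrete_prob_ge[OF indep_AB, where T = "PiE row_index (\<lambda>_. carrier G)" and T' = T'])
    show "finite (PiE row_index (\<lambda>_. carrier G))" using finite_carrier by (intro finite_PiE) auto
    show "(\<lambda>\<rho>\<in>row_index. row_prod y \<rho> b) \<in> PiE row_index (\<lambda>_. carrier G)" for b
      using y by (rule row_prods_closed)
    have "AE \<omega> in M. \<forall>(i, a)\<in>row_index. row_prod y (i, a) (B \<omega>) \<in> ?K i"
      by (rule row_prod_B_AE[OF y]) (rule mono)
    then show "AE \<omega> in M. (\<lambda>\<rho>\<in>row_index. row_prod y \<rho> (B \<omega>)) \<in> T'"
      by eventually_elim (simp add: T'_def)
    fix c assume "c \<in> PiE row_index (\<lambda>_. carrier G)" and cT: "c \<in> T'"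
    then have c: "c \<in> row_index \<rightarrow> carrier G" by auto
    show "(\<Prod>i\<in>{1..k}. robust_weight (\<kappa> ^ L i) (L i) (n i) (span_before n y i) (y i))
      \<le> prob {\<omega> \<in> space M. \<forall>\<rho>\<in>row_index. row_prod y \<rho> (A \<omega>) \<otimes> c \<rho> = \<one>}"
      unfolding prob_shifted_rows[OF y c]
    proof (rule prod_mono, rule conjI)
      fix i assume i: "i \<in> {1..k}"
      let ?w = "1 / card (?K i) - \<kappa> ^ L i"
      have w: "0 \<le> ?w" using small[OF i] by simp
      have rw: "robust_weight (\<kappa> ^ L i) (L i) (n i) (span_before n y i) (y i) = ?w ^ n i"
        using True i by (simp add: robust_weight_def)
      then show "0 \<le> robust_weight (\<kappa> ^ L i) (L i) (n i) (span_before n y i) (y i)" using w by simp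
      have "(\<Prod>a<n i. ?w) \<le> (\<Prod>a<n i. prob {\<omega> \<in> space M. row_value y (i, a) \<omega> = inv (c (i, a))})"
      proof (rule prod_mono, rule conjI[OF w])
        fix a assume "a \<in> {..<n i}"
        then have a: "a < n i" by simp
        have K: "robust_span (L i) {..<n i} (y i) = ?K i" "span_before n y i \<subseteq> ?K i" using True i by auto
        have "y i ` {..<n i} \<subseteq> ?K i" using span_subset_iff[OF sub[OF i], THEN iffD1, OF order_refl] .
        moreover have "c (i, a) \<in> ?K i" using cT i a by (simp add: T'_def)
        then have "inv (c (i, a)) \<in> ?K i" by (rule subgroup.m_inv_closed[OF sub[OF i]])
        ultimately have "1 / card (?K i) - rate ^ L i \<le> prob {\<omega> \<in> space M. row_value y (i, a) \<omega> = inv (c (i, a))}"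
          using prob_row_ge[OF y i a, of "L i" "inv (c (i, a))"] K by simp
        moreover have "rate ^ L i \<le> \<kappa> ^ L i" using \<kappa> rate_bounds by (intro power_mono) auto
        ultimately show "?w \<le> prob {\<omega> \<in> space M. row_value y (i, a) \<omega> = inv (c (i, a))}" by linarith
      qed
      then show "robust_weight (\<kappa> ^ L i) (L i) (n i) (span_before n y i) (y i)
        \<le> (\<Prod>a<n i. prob {\<omega> \<in> space M. row_value y (i, a) \<omega> = inv (c (i, a))})"
        by (simp add: rw)
    qed
  qed
qed

lemma solutions_blocks_iff:
  fixes C C' :: "int mat"
  assumes C: "C \<in> carrier_mat (total_size n k) (total_size n k)" "C' \<in> carrier_mat (total_size n k) (total_size n k)"
    and x: "x \<in> vectors (total_size n k)"
  shows "x \<in> solutions (total_size n k) (C + C') \<longleftrightarrow>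
    (\<forall>\<rho>\<in>row_index. row_prod (blocks n k x) \<rho> C \<otimes> row_prod (blocks n k x) \<rho> C' = \<one>)"
proof -
  let ?N = "total_size n k" and ?e = "\<lambda>(i, a). block_offset n i + a"
  note e = bij_betw_block_index[of n k]
  have e_img: "?e ` row_index = {..<?N}" and e_inj: "inj_on ?e row_index" using e by (auto simp: bij_betw_def)
  have xc: "x s \<in> carrier G" if "s < ?N" for s using x that by auto
  have e_less: "block_offset n i + a < ?N" if "i \<in> {1..k}" "a < n i" for i a
    using bij_betwE[OF e] that by auto
  have rp: "row_prod (blocks n k x) \<rho> D = (\<Otimes>s\<in>{..<?N}. x s [^] (D $$ (?e \<rho>, s)))" for \<rho> D
  proof -
    have "(\<Otimes>s\<in>{..<?N}. x s [^] (D $$ (?e \<rho>, s))) = (\<Otimes>p\<in>row_index. x (?e p) [^] (D $$ (?e \<rho>, ?e p)))"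
      unfolding e_img[symmetric] using xc e_less by (intro finprod_reindex e_inj) (auto intro!: int_pow_closed)
    also have "\<dots> = row_prod (blocks n k x) \<rho> D"
      unfolding row_prod_def
      by (intro finprod_cong') (use xc e_less in \<open>auto simp: blocks_def case_prod_unfold intro!: int_pow_closed\<close>)
    finally show ?thesis by simp
  qed
  have row: "(\<Otimes>s\<in>{..<?N}. x s [^] ((C + C') $$ (r, s)))
      = (\<Otimes>s\<in>{..<?N}. x s [^] (C $$ (r, s))) \<otimes> (\<Otimes>s\<in>{..<?N}. x s [^] (C' $$ (r, s)))" if "r < ?N" for r
  proof -
    have "(\<Otimes>s\<in>{..<?N}. x s [^] ((C + C') $$ (r, s))) = (\<Otimes>s\<in>{..<?N}. x s [^] (C $$ (r, s)) \<otimes> x s [^] (C' $$ (r, s)))"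
      using C that xc by (intro finprod_cong') (auto simp: int_pow_mult)
    also have "\<dots> = (\<Otimes>s\<in>{..<?N}. x s [^] (C $$ (r, s))) \<otimes> (\<Otimes>s\<in>{..<?N}. x s [^] (C' $$ (r, s)))"
      using xc by (intro finprod_multf) auto
    finally show ?thesis .
  qed
  have "x \<in> solutions ?N (C + C') \<longleftrightarrow>
     (\<forall>r\<in>?e ` row_index. (\<Otimes>s\<in>{..<?N}. x s [^] ((C + C') $$ (r, s))) = \<one>)"
    unfolding e_img using x by (auto simp: solutions_def)
  also have "\<dots> \<longleftrightarrow> (\<forall>\<rho>\<in>row_index. row_prod (blocks n k x) \<rho> C \<otimes> row_prod (blocks n k x) \<rho> C' = \<one>)"
    unfolding rp ball_simps using row e_less by auto
  finally show ?thesis .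
qed

lemma expectation_card_Hom:
  "expectation (\<lambda>\<omega>. real (card (Hom (cok (A \<omega> + B \<omega>)) G))) = (\<Sum>y\<in>families. solution_prob y)"
proof -
  let ?N = "total_size n k"
  let ?X = "vectors ?N"
  define E where "E y = {\<omega> \<in> space M. \<forall>\<rho>\<in>row_index. row_prod y \<rho> (A \<omega>) \<otimes> row_prod y \<rho> (B \<omega>) = \<one>}" for y
  have finX: "finite ?X" using finite_carrier by (intro finite_PiE) auto
  have bij: "bij_betw (blocks n k) ?X families" by (rule bij_betw_blocks)
  have card: "real (card (Hom (cok (A \<omega> + B \<omega>)) G)) = (\<Sum>x\<in>?X. indicator (E (blocks n k x)) \<omega>)"
    if \<omega>: "\<omega> \<in> space M" for \<omega>
  proof -
    have AB: "A \<omega> \<in> carrier_mat ?N ?N" "B \<omega> \<in> carrier_mat ?N ?N"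
      using indep_discrete_measurable[OF indep_AB, THEN measurable_space] \<omega> by auto
    have "solutions ?N (A \<omega> + B \<omega>) = {x \<in> ?X. \<omega> \<in> E (blocks n k x)}"
      using solutions_blocks_iff[OF AB] \<omega> by (auto simp: solutions_def E_def)
    then have "real (card (Hom (cok (A \<omega> + B \<omega>)) G)) = real (card {x \<in> ?X. \<omega> \<in> E (blocks n k x)})"
      using card_Hom_cok[of "A \<omega> + B \<omega>" ?N] AB by simp
    also have "\<dots> = (\<Sum>x\<in>?X. indicator (E (blocks n k x)) \<omega>)"
    proof -
      have "real (card {x \<in> ?X. \<omega> \<in> E (blocks n k x)}) = (\<Sum>x | x \<in> ?X \<and> \<omega> \<in> E (blocks n k x). 1)" by simp
      also have "\<dots> = (\<Sum>x\<in>?X. if \<omega> \<in> E (blocks n k x) then 1 else 0)" by (rule sum.inter_filter[OF finX])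
      finally show ?thesis by (simp only: indicator_def of_bool_def)
    qed
    finally show ?thesis .
  qed
  \<comment> \<open>The event involves \<open>A\<close> and \<open>B\<close> jointly; its
    measurability comes from the finite decomposition by the contribution of
    \<open>B\<close>.\<close>
  have ev: "E y \<in> events" if "y \<in> families" for y
  proof -
    have "{\<omega> \<in> space M. \<forall>\<rho>\<in>row_index. row_prod y \<rho> (A \<omega>) \<otimes> (\<lambda>\<rho>\<in>row_index. row_prod y \<rho> (B \<omega>)) \<rho> = \<one>} \<in> events"
    proof (rule indep_discrete_disintegrate(1)[OF indep_AB, where T = "PiE row_index (\<lambda>_. carrier G)"])
      show "finite (PiE row_index (\<lambda>_. carrier G))" using finite_carrier by (intro finite_PiE) auto
    qed (rule row_prods_closed[OF that])
    moreover have "{\<omega> \<in> space M. \<forall>\<rho>\<in>row_index. row_prod y \<rho> (A \<omega>) \<otimes> (\<lambda>\<rho>\<in>row_index. row_prod y \<rho> (B \<omega>)) \<rho> = \<one>} = E y"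
      by (auto simp: E_def)
    ultimately show ?thesis by (simp only:)
  qed
  have fam: "blocks n k x \<in> families" if "x \<in> ?X" for x using bij_betwE[OF bij] that by blast
  have "expectation (\<lambda>\<omega>. real (card (Hom (cok (A \<omega> + B \<omega>)) G)))
     = expectation (\<lambda>\<omega>. \<Sum>x\<in>?X. indicator (E (blocks n k x)) \<omega>)"
    by (rule Bochner_Integration.integral_cong[OF refl card])
  also have "\<dots> = (\<Sum>x\<in>?X. expectation (indicator (E (blocks n k x))))"
    using ev fam by (intro Bochner_Integration.integral_sum integrable_real_indicator) (auto simp: emeasure_eq_measure)
  also have "\<dots> = (\<Sum>x\<in>?X. solution_prob (blocks n k x))"
    using ev fam by (intro sum.cong) (auto simp: solution_prob_def E_def)
  also have "\<dots> = (\<Sum>y\<in>families. solution_prob y)" by (rule sum.reindex_bij_betw[OF bij])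
  finally show ?thesis .
qed

end

section \<open>Two-sided bounds for the moment\<close>

context random_block_matrices
begin

lemma expectation_card_Hom_le:
  fixes \<kappa> q :: real
  assumes \<kappa>: "rate \<le> \<kappa>" and q: "0 \<le> q"
    and W: "\<And>i H K. i \<in> {1..k} \<Longrightarrow> subgroup H G \<Longrightarrow> subgroup K G \<Longrightarrow>
      (\<Sum>y | y \<in> vectors (n i) \<and> span {..<n i} y = K. weight (1 - \<epsilon>) (\<kappa> ^ L i) (L i) (n i) H y)
      \<le> (if H \<subseteq> K then 1 else 0) + q"
  shows "expectation (\<lambda>\<omega>. real (card (Hom (cok (A \<omega> + B \<omega>)) G)))
    \<le> (1 + q * card subgroups * weak_chains k {\<one>}) ^ k * weak_chains k {\<one>}"
proof -
  have "(\<Sum>y\<in>families. solution_prob y)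
    \<le> (\<Sum>y\<in>families. \<Prod>i\<in>{1..k}. weight (1 - \<epsilon>) (\<kappa> ^ L i) (L i) (n i) (span_before n y i) (y i))"
    by (intro sum_mono solution_prob_le \<kappa>)
  also have "\<dots> \<le> (1 + q * card subgroups * weak_chains k {\<one>}) ^ k * weak_chains k {\<one>}"
  proof (rule sum_block_paths_le[OF finite_carrier q])
    fix i H y
    show "0 \<le> weight (1 - \<epsilon>) (\<kappa> ^ L i) (L i) (n i) H y"
      using eps_le_1 \<kappa> rate_bounds by (intro weight_nonneg) auto
  qed (rule W)
  finally show ?thesis unfolding expectation_card_Hom .
qed

lemma expectation_card_Hom_ge:
  fixes \<kappa> q :: real
  assumes \<kappa>: "rate \<le> \<kappa>" and q: "q \<le> 1"
    and small: "\<And>i K. i \<in> {1..k} \<Longrightarrow> subgroup K G \<Longrightarrow> \<kappa> ^ L i \<le> 1 / card K"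
    and W: "\<And>i K. i \<in> {1..k} \<Longrightarrow> subgroup K G \<Longrightarrow> 1 - q \<le>
      (\<Sum>y | y \<in> vectors (n i) \<and> span {..<n i} y = K \<and> robust_span (L i) {..<n i} y = K.
        (1 / card K - \<kappa> ^ L i) ^ n i)"
  shows "(1 - q) ^ k * weak_chains k {\<one>} \<le> expectation (\<lambda>\<omega>. real (card (Hom (cok (A \<omega> + B \<omega>)) G)))"
proof -
  have "(1 - q) ^ k * weak_chains k {\<one>}
    \<le> (\<Sum>y\<in>families. \<Prod>i\<in>{1..k}. robust_weight (\<kappa> ^ L i) (L i) (n i) (span_before n y i) (y i))"
  proof (rule sum_block_paths_ge[OF finite_carrier q])
    fix i H y assume i: "i \<in> {1..k}" and y: "y \<in> vectors (n i)"
    have "\<kappa> ^ L i \<le> 1 / card (span {..<n i} y)"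
      using span_in_subgroups[OF y] by (intro small i) (simp add: subgroups_def)
    then show "0 \<le> robust_weight (\<kappa> ^ L i) (L i) (n i) H y"
      by (simp add: robust_weight_def)
  next
    fix i H K assume i: "i \<in> {1..k}" and K: "subgroup K G" and HK: "H \<subseteq> K"
    let ?Y = "vectors (n i)"
    have finY: "finite ?Y" using finite_carrier by (intro finite_PiE) auto
    have "1 - q \<le> (\<Sum>y | y \<in> ?Y \<and> span {..<n i} y = K \<and> robust_span (L i) {..<n i} y = K.
        (1 / card K - \<kappa> ^ L i) ^ n i)" by (rule W[OF i K])
    also have "\<dots> = (\<Sum>y | y \<in> ?Y \<and> span {..<n i} y = K. robust_weight (\<kappa> ^ L i) (L i) (n i) H y)"
      using finY HK by (intro sum.mono_neutral_cong_left) (auto simp: robust_weight_def)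
    finally show "1 - q \<le> (\<Sum>y | y \<in> ?Y \<and> span {..<n i} y = K. robust_weight (\<kappa> ^ L i) (L i) (n i) H y)" .
  qed
  also have "\<dots> \<le> (\<Sum>y\<in>families. solution_prob y)"
  proof (intro sum_mono solution_prob_ge \<kappa> small)
    fix y i assume "y \<in> families" "i \<in> {1..k}"
    then show "subgroup (span {..<n i} (y i)) G" by (rule subgroup_span_family)
  qed
  finally show ?thesis unfolding expectation_card_Hom .
qed

end

text \<open>The logarithm of the product is \<open>m h\<close> times a bracket tending to
  \<open>ln r < 0\<close>. This is how the growth condition on \<open>k\<close> enters: under it a
  geometric error beats every power of \<open>k\<close>.\<close>

lemma power_mult_power_tendsto_0:
  fixes k m :: "nat \<Rightarrow> nat" and r :: real
  assumes r: "0 < r" "r < 1"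
    and k: "\<forall>\<^sub>F h in sequentially. 1 \<le> k h" and m: "filterlim m at_top sequentially"
    and log: "(\<lambda>h. ln (real (k h)) / real (m h)) \<longlonglongrightarrow> 0"
  shows "(\<lambda>h. real (k h) ^ p * r ^ m h) \<longlonglongrightarrow> 0"
proof -
  have lim: "(\<lambda>h. real p * (ln (real (k h)) / real (m h)) + ln r) \<longlonglongrightarrow> real p * 0 + ln r"
    by (intro tendsto_intros log)
  have m': "filterlim (\<lambda>h. real (m h)) at_top sequentially"
    by (rule filterlim_compose[OF filterlim_real_sequentially m])
  have "ln r < 0" using r by simp
  then have "filterlim (\<lambda>h. (real p * (ln (real (k h)) / real (m h)) + ln r) * real (m h)) at_bot sequentially"
    by (intro filterlim_tendsto_neg_mult_at_bot[OF lim _ m']) simp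
  then have "(\<lambda>h. exp ((real p * (ln (real (k h)) / real (m h)) + ln r) * real (m h))) \<longlonglongrightarrow> 0"
    by (rule filterlim_compose[OF exp_at_bot])
  moreover have "\<forall>\<^sub>F h in sequentially. exp ((real p * (ln (real (k h)) / real (m h)) + ln r) * real (m h))
    = real (k h) ^ p * r ^ m h"
    using k m[THEN filterlim_at_top[THEN iffD1], rule_format, of 1]
  proof eventually_elim
    case (elim h)
    have "(real p * (ln (real (k h)) / real (m h)) + ln r) * real (m h) = real p * ln (real (k h)) + real (m h) * ln r"
      using elim by (simp add: field_simps)
    also have "exp \<dots> = real (k h) ^ p * r ^ m h"
      using elim r by (simp add: exp_add exp_of_nat_mult)
    finally show ?case .
  qed
  ultimately show ?thesis by (rule Lim_transform_eventually)
qed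

theorem theorem1p1:
  fixes G :: "('g, 'm) monoid_scheme"
    and P :: "nat set"
    and \<epsilon> :: real
    and M :: "nat \<Rightarrow> 'w measure"
    and k :: "nat \<Rightarrow> nat"
    and n :: "nat \<Rightarrow> nat \<Rightarrow> nat"
    and A B C :: "nat \<Rightarrow> 'w \<Rightarrow> int mat"
  assumes G: "comm_group G" "finite (carrier G)"
    and P: "P = prime_factors (order G)"
    and eps: "\<epsilon> > 0"
    and prob: "\<And>h. h \<ge> 1 \<Longrightarrow> prob_space (M h)"
    and k_pos: "\<And>h. h \<ge> 1 \<Longrightarrow> k h \<ge> 1"
    and n_pos: "\<And>h i. h \<ge> 1 \<Longrightarrow> i \<in> {1..k h} \<Longrightarrow> n h i \<ge> 1"
    and C: "\<And>h \<omega>. h \<ge> 1 \<Longrightarrow> \<omega> \<in> space (M h) \<Longrightarrow> C h \<omega> = A h \<omega> + B h \<omega>"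
    and A1: "\<And>h. h \<ge> 1 \<Longrightarrow> prob_space.indep_var (M h)
        (count_space (carrier_mat (total_size (n h) (k h)) (total_size (n h) (k h)))) (A h)
        (count_space (carrier_mat (total_size (n h) (k h)) (total_size (n h) (k h)))) (B h)"
    and A2: "\<And>h i j. h \<ge> 1 \<Longrightarrow> i \<in> {1..k h} \<Longrightarrow> j \<in> {1..k h} \<Longrightarrow> j \<notin> {i - 1, i} \<Longrightarrow>
        AE \<omega> in M h. block (n h) i j (A h \<omega>) = 0\<^sub>m (n h i) (n h j)"
    and A3_indep: "\<And>h. h \<ge> 1 \<Longrightarrow> prob_space.indep_vars (M h)
        (\<lambda>(i, j). count_space (carrier_mat (n h i) (n h j)))
        (\<lambda>(i, j) \<omega>. block (n h) i j (A h \<omega>)) (bidiagonal_positions (k h))"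
    and A3_balanced: "\<And>h i j. h \<ge> 1 \<Longrightarrow> (i, j) \<in> bidiagonal_positions (k h) \<Longrightarrow>
        balanced_matrix (M h) P \<epsilon> (n h i) (n h j) (\<lambda>\<omega>. block (n h) i j (A h \<omega>))"
    and A4: "\<And>h i j. h \<ge> 1 \<Longrightarrow> i \<in> {1..k h} \<Longrightarrow> j \<in> {1..k h} \<Longrightarrow> j \<ge> i - 1 \<Longrightarrow>
        AE \<omega> in M h. block (n h) i j (B h \<omega>) = 0\<^sub>m (n h i) (n h j)"
    and A5: "filterlim k at_top sequentially"
    and A6: "filterlim (\<lambda>h. min_block_size (n h) (k h)) at_top sequentially"
    and A7: "(\<lambda>h. ln (real (k h)) / real (min_block_size (n h) (k h))) \<longlonglongrightarrow> 0"
  shows "(\<lambda>h. prob_space.expectation (M h) (\<lambda>\<omega>. real (card (Hom (cok (C h \<omega>)) G)))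
              / real (k h) ^ chain_length G)
         \<longlonglongrightarrow> real (num_chains G (chain_length G)) / fact (chain_length G)"
proof -
  interpret comm_group G by (rule G)
  \<comment> \<open>Balancedness is weaker for smaller \<epsilon>, so \<epsilon> may be capped; this
    keeps \<open>1 - \<epsilon>'\<close>, a factor of the weights, nonnegative.\<close>
  define \<epsilon>' where "\<epsilon>' = min \<epsilon> 1"
  have eps': "0 < \<epsilon>'" "\<epsilon>' \<le> 1" "\<epsilon>' \<le> \<epsilon>" using eps by (auto simp: \<epsilon>'_def)
  have model: "random_block_matrices (M h) G (A h) (B h) (n h) (k h) \<epsilon>'" if h: "h \<ge> 1" for h
  proof -
    interpret prob_space "M h" by (rule prob[OF h])
    show ?thesis
    proof unfold_locales
      fix i j assume ij: "(i, j) \<in> bidiagonal_positions (k h)"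
      show "balanced_matrix (M h) (prime_factors (order G)) \<epsilon>' (n h i) (n h j) (\<lambda>\<omega>. block (n h) i j (A h \<omega>))"
        using A3_balanced[OF h ij] eps'(3) unfolding balanced_matrix_def balanced_def P
        by (meson diff_left_mono order_trans)
    qed (use G eps' h A1 A2 A3_indep A4 in auto)
  qed
  define \<rho> where "\<rho> = random_block_matrices.rate G \<epsilon>'"
  \<comment> \<open>\<open>block_weights\<close> asks for a positive base, but the rate is 0 for a
    trivial group with \<open>\<epsilon>' = 1\<close>.\<close>
  define \<kappa> where "\<kappa> = max (1 / 2) \<rho>"
  have "\<rho> < 1" unfolding \<rho>_def by (rule random_block_matrices.rate_bounds(2)[OF model[OF order_refl]])
  then have \<kappa>: "0 < \<kappa>" "\<kappa> < 1" "\<rho> \<le> \<kappa>" by (auto simp: \<kappa>_def)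
  have "0 \<le> 1 - \<epsilon>'" "1 - \<epsilon>' < 1" using eps' by auto
  \<comment> \<open>These depend only on \<open>G\<close> and \<epsilon>, hence not on
    \<open>h\<close>.\<close>
  then obtain d r N where "0 < d" and r: "0 < r" "r < 1"
    and upper: "\<And>n H K. n \<ge> N \<Longrightarrow> subgroup H G \<Longrightarrow> subgroup K G \<Longrightarrow>
      (\<Sum>y | y \<in> vectors n \<and> span {..<n} y = K. weight (1 - \<epsilon>') (\<kappa> ^ (n div d)) (n div d) n H y)
      \<le> (if H \<subseteq> K then 1 else 0) + r ^ n"
    and small: "\<And>n K. n \<ge> N \<Longrightarrow> subgroup K G \<Longrightarrow> \<kappa> ^ (n div d) \<le> 1 / card K"
    and lower: "\<And>n K. n \<ge> N \<Longrightarrow> subgroup K G \<Longrightarrow> 1 - r ^ n \<le>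
      (\<Sum>y | y \<in> vectors n \<and> span {..<n} y = K \<and> robust_span (n div d) {..<n} y = K.
        (1 / card K - \<kappa> ^ (n div d)) ^ n)"
    by (rule block_weights[OF G(2) \<kappa>(1,2)]) (rule that; blast)
  define E where "E h = prob_space.expectation (M h) (\<lambda>\<omega>. real (card (Hom (cok (C h \<omega>)) G)))" for h
  define m where "m h = min_block_size (n h) (k h)" for h
  define f where "f h = real (weak_chains (k h) {\<one>\<^bsub>G\<^esub>})" for h
  define l where "l = chain_length G"
  define Q where "Q = real (card subgroups)"
  have m_le: "m h \<le> n h i" if "i \<in> {1..k h}" for h i
    using that by (auto simp: m_def min_block_size_def)
  have E_eq: "E h = prob_space.expectation (M h) (\<lambda>\<omega>. real (card (Hom (cok (A h \<omega> + B h \<omega>)) G)))"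
    if "h \<ge> 1" for h
    unfolding E_def by (rule Bochner_Integration.integral_cong) (use C that in auto)
  \<comment> \<open>Every block is at least as large as the smallest one and \<open>r < 1\<close>,
    so \<open>r ^ m h\<close> bounds the errors of all blocks.\<close>
  have bounds: "(1 - r ^ m h) ^ k h * f h \<le> E h \<and> E h \<le> (1 + r ^ m h * Q * f h) ^ k h * f h"
    if h: "h \<ge> 1" and mN: "m h \<ge> N" for h
  proof -
    interpret random_block_matrices "M h" G "A h" "B h" "n h" "k h" \<epsilon>' by (rule model[OF h])
    have nN: "n h i \<ge> N" if "i \<in> {1..k h}" for i using m_le[OF that] mN by simp
    have rn: "r ^ n h i \<le> r ^ m h" if "i \<in> {1..k h}" for i
      using m_le[OF that] r by (intro power_decreasing) auto
    have \<kappa>r: "random_block_matrices.rate G \<epsilon>' \<le> \<kappa>" using \<kappa>(3) by (simp add: \<rho>_def)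
    have "E h \<le> (1 + r ^ m h * Q * f h) ^ k h * f h"
      unfolding E_eq[OF h] Q_def f_def
    proof (rule expectation_card_Hom_le[OF \<kappa>r, where L = "\<lambda>i. n h i div d"])
      fix i H K assume i: "i \<in> {1..k h}" and HK: "subgroup H G" "subgroup K G"
      show "(\<Sum>y | y \<in> vectors (n h i) \<and> span {..<n h i} y = K.
          weight (1 - \<epsilon>') (\<kappa> ^ (n h i div d)) (n h i div d) (n h i) H y) \<le> (if H \<subseteq> K then 1 else 0) + r ^ m h"
        using upper[OF nN[OF i] HK] rn[OF i] by linarith
    qed (use r in simp)
    moreover have "(1 - r ^ m h) ^ k h * f h \<le> E h"
      unfolding E_eq[OF h] f_def
    proof (rule expectation_card_Hom_ge[OF \<kappa>r, where L = "\<lambda>i. n h i div d"])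
      fix i K assume i: "i \<in> {1..k h}" and K: "subgroup K G"
      show "\<kappa> ^ (n h i div d) \<le> 1 / card K" by (rule small[OF nN[OF i] K])
      show "1 - r ^ m h \<le> (\<Sum>y | y \<in> vectors (n h i) \<and> span {..<n h i} y = K \<and>
          robust_span (n h i div d) {..<n h i} y = K. (1 / card K - \<kappa> ^ (n h i div d)) ^ n h i)"
        using lower[OF nN[OF i] K] rn[OF i] by linarith
    qed (use r in \<open>simp add: power_le_one\<close>)
    ultimately show ?thesis by blast
  qed
  have k1: "\<forall>\<^sub>F h in sequentially. 1 \<le> k h"
    using eventually_ge_at_top[of 1] by eventually_elim (rule k_pos)
  have m_top: "filterlim m at_top sequentially" using A6 by (simp add: m_def[abs_def])
  have decay: "(\<lambda>h. real (k h) ^ p * r ^ m h) \<longlonglongrightarrow> 0" for p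
    by (rule power_mult_power_tendsto_0[OF r k1 m_top]) (use A7 in \<open>simp add: m_def\<close>)
  have f_lim: "(\<lambda>h. f h / real (k h) ^ l) \<longlonglongrightarrow> real (num_chains G l) / fact l"
    using filterlim_compose[OF weak_chains_asymptotic[OF G(2) trivial_in_subgroups] A5]
    by (simp add: f_def l_def strict_chains_eq_num_chains[OF G(2)])
  \<comment> \<open>The chain count is of order at most \<open>k ^ l\<close>, so the errors of all
    \<open>k\<close> blocks add up to at most a constant times
    \<open>k ^ Suc l * r ^ m h\<close>.\<close>
  have u_lim: "(\<lambda>h. real (k h) * (r ^ m h * Q * f h)) \<longlonglongrightarrow> 0"
  proof (rule Lim_transform_eventually)
    show "(\<lambda>h. Q * (f h / real (k h) ^ l) * (real (k h) ^ Suc l * r ^ m h)) \<longlonglongrightarrow> 0"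
      using tendsto_mult[OF tendsto_mult[OF tendsto_const f_lim] decay[of "Suc l"]] by simp
    show "\<forall>\<^sub>F h in sequentially. Q * (f h / real (k h) ^ l) * (real (k h) ^ Suc l * r ^ m h)
      = real (k h) * (r ^ m h * Q * f h)"
      using k1 by eventually_elim (simp add: field_simps)
  qed
  have ev: "\<forall>\<^sub>F h in sequentially. 1 \<le> h \<and> 1 \<le> k h \<and> N \<le> m h"
    using eventually_ge_at_top[of 1] k1 m_top[THEN filterlim_at_top[THEN iffD1], rule_format, of N]
    by eventually_elim simp
  \<comment> \<open>The limit comes from \<open>f\<close> alone: \<open>k\<close> factors with a
    relative error of u each stay between \<open>1 - k * u\<close> and \<open>exp (k * u)\<close>,
    where u is \<open>r ^ m h\<close> below and \<open>r ^ m h * Q * f h\<close> above.\<close>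
  have "(\<lambda>h. E h / real (k h) ^ l) \<longlonglongrightarrow> real (num_chains G l) / fact l"
  proof (rule tendsto_sandwich)
    show "\<forall>\<^sub>F h in sequentially. (1 - real (k h) ^ 1 * r ^ m h) * (f h / real (k h) ^ l) \<le> E h / real (k h) ^ l"
      using ev
    proof eventually_elim
      case (elim h)
      have "1 - real (k h) ^ 1 * r ^ m h \<le> (1 - r ^ m h) ^ k h"
        using Bernoulli_inequality[of "- (r ^ m h)" "k h"] r by (simp add: power_le_one)
      then have "(1 - real (k h) ^ 1 * r ^ m h) * f h \<le> (1 - r ^ m h) ^ k h * f h"
        by (intro mult_right_mono) (auto simp: f_def)
      also have "\<dots> \<le> E h" using bounds elim by blast
      finally show ?case by (simp add: divide_right_mono)
    qed
    show "\<forall>\<^sub>F h in sequentially. E h / real (k h) ^ l \<le> exp (real (k h) * (r ^ m h * Q * f h)) * (f h / real (k h) ^ l)"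
      using ev
    proof eventually_elim
      case (elim h)
      have "E h \<le> (1 + r ^ m h * Q * f h) ^ k h * f h" using bounds elim by blast
      also have "\<dots> \<le> exp (r ^ m h * Q * f h) ^ k h * f h"
        using r by (intro mult_right_mono power_mono exp_ge_add_one_self) (auto simp: f_def Q_def)
      also have "\<dots> = exp (real (k h) * (r ^ m h * Q * f h)) * f h" by (simp add: exp_of_nat_mult)
      finally show ?case by (simp add: divide_right_mono)
    qed
    show "(\<lambda>h. (1 - real (k h) ^ 1 * r ^ m h) * (f h / real (k h) ^ l)) \<longlonglongrightarrow> real (num_chains G l) / fact l"
      using tendsto_mult[OF tendsto_diff[OF tendsto_const decay[of 1]] f_lim, of 1] by simp
    show "(\<lambda>h. exp (real (k h) * (r ^ m h * Q * f h)) * (f h / real (k h) ^ l)) \<longlonglongrightarrow> real (num_chains G l) / fact l"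
      using tendsto_mult[OF tendsto_exp[OF u_lim] f_lim] by simp
  qed
  then show ?thesis by (simp add: E_def l_def)
qed

end
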